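(* Let $Y$ be the solution of $dY_t=\nu\,dW_t+\kappa(\theta-Y_t)dt$ starting from $Y_0=y_0$, and let $\widetilde X^N$ be the WeakTraj_1 scheme with exact simulation of $Y$ defined in the context. Then for all $p\ge1$ and $\varepsilon>0$ there is a constant $C$ not depending on $N\ge1$ such that: (i) in the Stein and Stein model ($f(y)=y$), when $y_0\neq0$, $$\mathbb{E}\left[\max_{0\le k\le N}\big|\widetilde X_{t_k}-\widetilde X^N_{t_k}\big|^{2p}\right]\le\frac{C}{N^{\frac{2p+1}{2}-\varepsilon}};$$ (ii) in the quadratic Gaussian model ($f(y)=y^2$), $$\mathbb{E}\left[\max_{0\le k\le N}\big|\widetilde X_{t_k}-\widetilde X^N_{t_k}\big|^{2p}\right]\le\frac{C}{N^{2p-\varepsilon}}.$$ In particular, in the Stein and Stein model with $y_0\ne0$ the order of convergence in $L^2$ is not smaller than $3/4-\varepsilon$, i.e. for every $\varepsilon>0$ there is a constant $C$ not depending on $N$ with $\mathbb{E}\big[\max_{0\le k\le N}|\widetilde X_{t_k}-\widetilde X^N_{t_k}|^2\big]^{1/2}\le CN^{-(3/4-\varepsilon)}$.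
   Context: Let $T>0$, $r\in\mathbb{R}$, $\rho\in[-1,1]$, $s_0>0$, $y_0\in\mathbb{R}$, $\nu>0$, $\kappa,\theta\in\mathbb{R}$. Let $(W_t)_{t\in[0,T]}$ and $(B_t)_{t\in[0,T]}$ be independent standard one-dimensional Brownian motions; $Y$ is the Ornstein-Uhlenbeck process driven by $W$ given in the claim. For $f:\mathbb{R}\to\mathbb{R}$ (here $f(y)=y$ or $f(y)=y^2$) define $\psi=f^2$, $\underline\psi=\inf_{y\in\mathbb{R}}\psi(y)$ (equal to $0$ in both models), $F(y)=\frac1\nu\int_0^yf(z)dz$ and $$h(y)=r-\tfrac12f^2(y)-\rho\Big(\tfrac{\kappa(\theta-y)}{\nu}f(y)+\tfrac{\nu}{2}f'(y)\Big).$$ For $N\ge1$ let $\delta_N=T/N$, $t_k=k\delta_N$ for $0\le k\le N$, $\Delta B_{k+1}=B_{t_{k+1}}-B_{t_k}$. The vector $(\widetilde X_{t_k})_{0\le k\le N}$ is defined by $\widetilde X_{t_0}=\log(s_0)$ and, for $1\le k\le N$, $$\widetilde X_{t_k}=\widetilde X_{t_0}+\rho(F(Y_{t_k})-F(Y_{t_0}))+\int_0^{t_k}h(Y_s)ds+\sqrt{1-\rho^2}\sum_{l=0}^{k-1}\sqrt{v_l}\,\Delta B_{l+1},\qquad v_l=\frac1{\delta_N}\int_{t_l}^{t_{l+1}}\psi(Y_s)ds.$$ (It has the same law as $(X_{t_k})_{0\le k\le N}$ where $dX_t=(r-\frac12f^2(Y_t))dt+f(Y_t)(\rho\,dW_t+\sqrt{1-\rho^2}\,dB_t)$,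 $X_0=\log(s_0)$.) The WeakTraj_1 scheme with exact simulation of $Y$ is: $\widetilde X^N_{t_0}=\log(s_0)$ and, for $0\le k\le N-1$, $$\widetilde X^N_{t_{k+1}}=\widetilde X^N_{t_k}+\rho\big(F(Y_{t_{k+1}})-F(Y_{t_k})\big)+\delta_Nh(Y_{t_k})+\sqrt{1-\rho^2}\sqrt{\Big(\psi(Y_{t_k})+\frac{\nu\psi'(Y_{t_k})}{\delta_N}\int_{t_k}^{t_{k+1}}(W_s-W_{t_k})ds\Big)\vee\underline\psi}\;\Delta B_{k+1},$$ where $a\vee b=\max(a,b)$. *)

theory Defs
  imports "HOL-Probability.Probability"
begin

definition standard_brownian_motion ::
  "'a measure \<Rightarrow> real \<Rightarrow> (real \<Rightarrow> 'a \<Rightarrow> real) \<Rightarrow> bool" where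
  "standard_brownian_motion M T W \<longleftrightarrow>
     (\<forall>t\<in>{0..T}. W t \<in> borel_measurable M) \<and>
     (\<forall>\<omega>\<in>space M. continuous_on {0..T} (\<lambda>t. W t \<omega>)) \<and>
     (AE \<omega> in M. W 0 \<omega> = 0) \<and>
     (\<forall>s t. 0 \<le> s \<longrightarrow> s < t \<longrightarrow> t \<le> T \<longrightarrow>
        distributed M lborel (\<lambda>\<omega>. W t \<omega> - W s \<omega>) (\<lambda>x. ennreal (normal_density 0 (sqrt (t - s)) x))) \<and>
     (\<forall>n \<tau>. 0 \<le> \<tau> 0 \<longrightarrow> (\<forall>i<n. \<tau> i \<le> \<tau> (Suc i)) \<longrightarrow> \<tau> n \<le> T \<longrightarrow>
        prob_space.indep_vars M (\<lambda>_. borel) (\<lambda>i \<omega>. W (\<tau> (Suc i)) \<omega> - W (\<tau> i) \<omega>) {..<n})"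

text \<open>Two processes are independent when they are independent as random elements of
  the product space indexed by \<open>{0..T}\<close>.\<close>

definition independent_processes ::
  "'a measure \<Rightarrow> real \<Rightarrow> (real \<Rightarrow> 'a \<Rightarrow> real) \<Rightarrow> (real \<Rightarrow> 'a \<Rightarrow> real) \<Rightarrow> bool" where
  "independent_processes M T W B \<longleftrightarrow>
     prob_space.indep_var M
       (PiM {0..T} (\<lambda>_. borel)) (\<lambda>\<omega>. \<lambda>t\<in>{0..T}. W t \<omega>)
       (PiM {0..T} (\<lambda>_. borel)) (\<lambda>\<omega>. \<lambda>t\<in>{0..T}. B t \<omega>)"

text \<open>The noise is additive, so \<open>dY = \<nu> dW + \<kappa> (\<theta> - Y) dt\<close> is a pathwise integral
  equation. Its solution is unique, so adaptedness need not be required.\<close>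

definition OU_solution ::
  "'a measure \<Rightarrow> real \<Rightarrow> real \<Rightarrow> real \<Rightarrow> real \<Rightarrow> real \<Rightarrow> (real \<Rightarrow> 'a \<Rightarrow> real) \<Rightarrow> (real \<Rightarrow> 'a \<Rightarrow> real) \<Rightarrow> bool" where
  "OU_solution M T \<nu> \<kappa> \<theta> y0 W Y \<longleftrightarrow>
     (\<forall>t\<in>{0..T}. Y t \<in> borel_measurable M) \<and>
     (\<forall>\<omega>\<in>space M. continuous_on {0..T} (\<lambda>t. Y t \<omega>)) \<and>
     (AE \<omega> in M. \<forall>t\<in>{0..T}. Y t \<omega> = y0 + \<nu> * W t \<omega> + (LBINT s=0..t. \<kappa> * (\<theta> - Y s \<omega>)))"

definition psi :: "(real \<Rightarrow> real) \<Rightarrow> real \<Rightarrow> real" where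
  "psi f y = (f y)\<^sup>2"

definition psi_inf :: "(real \<Rightarrow> real) \<Rightarrow> real" where
  "psi_inf f = (INF y. psi f y)"

text \<open>The interval integral is oriented, so this is the intended value for negative \<open>y\<close> too.\<close>

definition F_prim :: "real \<Rightarrow> (real \<Rightarrow> real) \<Rightarrow> real \<Rightarrow> real" where
  "F_prim \<nu> f y = (1 / \<nu>) * (LBINT z=0..y. f z)"

definition h_coef :: "real \<Rightarrow> real \<Rightarrow> real \<Rightarrow> real \<Rightarrow> real \<Rightarrow> (real \<Rightarrow> real) \<Rightarrow> real \<Rightarrow> real" where
  "h_coef r \<rho> \<nu> \<kappa> \<theta> f y =
     r - (1 / 2) * (f y)\<^sup>2 - \<rho> * (\<kappa> * (\<theta> - y) / \<nu> * f y + \<nu> / 2 * deriv f y)"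

definition grid :: "real \<Rightarrow> nat \<Rightarrow> nat \<Rightarrow> real" where
  "grid T N k = real k * (T / real N)"

definition mean_psi ::
  "real \<Rightarrow> (real \<Rightarrow> real) \<Rightarrow> (real \<Rightarrow> 'a \<Rightarrow> real) \<Rightarrow> nat \<Rightarrow> nat \<Rightarrow> 'a \<Rightarrow> real" where
  "mean_psi T f Y N l \<omega> =
     (1 / (T / real N)) * (LBINT s=grid T N l..grid T N (Suc l). psi f (Y s \<omega>))"

text \<open>For \<open>k = 0\<close> every term but \<open>ln s0\<close> vanishes.\<close>

definition X_tilde ::
  "real \<Rightarrow> real \<Rightarrow> real \<Rightarrow> real \<Rightarrow> real \<Rightarrow> real \<Rightarrow> real \<Rightarrow> (real \<Rightarrow> real) \<Rightarrow>
   (real \<Rightarrow> 'a \<Rightarrow> real) \<Rightarrow> (real \<Rightarrow> 'a \<Rightarrow> real) \<Rightarrow> nat \<Rightarrow> nat \<Rightarrow> 'a \<Rightarrow> real" where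
  "X_tilde T r \<rho> s0 \<nu> \<kappa> \<theta> f B Y N k \<omega> =
     ln s0
     + \<rho> * (F_prim \<nu> f (Y (grid T N k) \<omega>) - F_prim \<nu> f (Y (grid T N 0) \<omega>))
     + (LBINT s=0..grid T N k. h_coef r \<rho> \<nu> \<kappa> \<theta> f (Y s \<omega>))
     + sqrt (1 - \<rho>\<^sup>2) * (\<Sum>l<k. sqrt (mean_psi T f Y N l \<omega>) *
         (B (grid T N (Suc l)) \<omega> - B (grid T N l) \<omega>))"

primrec WeakTraj1 ::
  "real \<Rightarrow> real \<Rightarrow> real \<Rightarrow> real \<Rightarrow> real \<Rightarrow> real \<Rightarrow> real \<Rightarrow> (real \<Rightarrow> real) \<Rightarrow>
   (real \<Rightarrow> 'a \<Rightarrow> real) \<Rightarrow> (real \<Rightarrow> 'a \<Rightarrow> real) \<Rightarrow> (real \<Rightarrow> 'a \<Rightarrow> real) \<Rightarrow>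
   nat \<Rightarrow> nat \<Rightarrow> 'a \<Rightarrow> real" where
  "WeakTraj1 T r \<rho> s0 \<nu> \<kappa> \<theta> f W B Y N 0 = (\<lambda>\<omega>. ln s0)"
| "WeakTraj1 T r \<rho> s0 \<nu> \<kappa> \<theta> f W B Y N (Suc k) = (\<lambda>\<omega>.
     WeakTraj1 T r \<rho> s0 \<nu> \<kappa> \<theta> f W B Y N k \<omega>
     + \<rho> * (F_prim \<nu> f (Y (grid T N (Suc k)) \<omega>) - F_prim \<nu> f (Y (grid T N k) \<omega>))
     + (T / real N) * h_coef r \<rho> \<nu> \<kappa> \<theta> f (Y (grid T N k) \<omega>)
     + sqrt (1 - \<rho>\<^sup>2) *
       sqrt (max (psi f (Y (grid T N k) \<omega>)
                  + \<nu> * deriv (psi f) (Y (grid T N k) \<omega>) / (T / real N) *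
                    (LBINT s=grid T N k..grid T N (Suc k). W s \<omega> - W (grid T N k) \<omega>))
                 (psi_inf f)) *
       (B (grid T N (Suc k)) \<omega> - B (grid T N k) \<omega>))"

definition max_error ::
  "real \<Rightarrow> real \<Rightarrow> real \<Rightarrow> real \<Rightarrow> real \<Rightarrow> real \<Rightarrow> real \<Rightarrow> (real \<Rightarrow> real) \<Rightarrow>
   (real \<Rightarrow> 'a \<Rightarrow> real) \<Rightarrow> (real \<Rightarrow> 'a \<Rightarrow> real) \<Rightarrow> (real \<Rightarrow> 'a \<Rightarrow> real) \<Rightarrow>
   nat \<Rightarrow> real \<Rightarrow> 'a \<Rightarrow> real" where
  "max_error T r \<rho> s0 \<nu> \<kappa> \<theta> f W B Y N q \<omega> =
     (MAX k\<in>{0..N}. \<bar>X_tilde T r \<rho> s0 \<nu> \<kappa> \<theta> f B Y N k \<omega>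
                     - WeakTraj1 T r \<rho> s0 \<nu> \<kappa> \<theta> f W B Y N k \<omega>\<bar> powr q)"

end

theory Submission
  imports Defs
begin

text \<open>
  At \<open>t\<^sub>k\<close> the terms in \<open>F\<close> cancel, and the error of the scheme is the sum of a drift part
  \<open>\<delta> \<Sum>\<^sub>l (mean of h(Y) over step l - h(Y at t\<^sub>l))\<close> and of \<open>sqrt (1 - \<rho>\<^sup>2) \<Sum>\<^sub>l D\<^sub>l \<Delta>B\<^sub>l\<close>, where
  \<open>D\<^sub>l\<close> is the difference of the two square-root volatilities on step \<open>l\<close>.

  All estimates are expressed by one notion, \<open>moments_O\<close>: a family of random variables has rate
  \<open>c\<close> if for every \<open>m\<close> its \<open>m\<close>-th absolute moments are bounded by a constant times \<open>c ^ m\<close>.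
  Rates behave like orders of magnitude: they add, multiply, and pass to almost sure limits by
  Fatou's lemma. A time average of a continuous process is a limit of means of finitely many
  variables, so rates pass to time averages too. The equation for \<open>Y\<close> is linear, which makes
  \<open>Y\<^sub>t\<close> an explicit limit of Gaussian sums in the increments of \<open>W\<close>; this provides bounded moments
  of \<open>Y\<^sub>t\<close> (\<open>Y_moments\<close>) and a bound of order \<open>1 / sqrt t\<close> on its density (\<open>Y_density_bound\<close>).

  Drift (\<open>drift_error_moments\<close>). In both models \<open>h\<close> is a polynomial. By Taylor's formula the mean of
  \<open>h(Y)\<close> over a step minus its left value is \<open>\<nu> h'(Y)\<close> times the mean of the increments of \<open>W\<close>, up
  to a remainder of rate \<open>\<delta>\<close>. Weighted by \<open>\<delta>\<close> and summed, the remainders have rate \<open>\<delta>\<close>. The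
  leading terms are centred given the past and form a martingale transform of rate \<open>\<delta>\<close>, because in
  the expansion of an even power the linear term has mean zero and Gronwall's lemma controls the rest.

  Diffusion (\<open>diffusion_max_bound\<close>). Given \<open>W\<close>, the sum of the \<open>D\<^sub>l \<Delta>B\<^sub>l\<close> is Gaussian with variance at
  most \<open>V = \<delta> \<Sum>\<^sub>l D\<^sub>l\<^sup>2\<close>. A maximum over \<open>N + 1\<close> indices is estimated by a union bound with a high moment,
  which costs a factor \<open>N powr \<epsilon>\<close>. This is done conditionally on \<open>W\<close>, so that the cost is relative to
  the moment of order \<open>p\<close> of \<open>V\<close> itself; a high moment of the \<open>D\<^sub>l\<close> would lose the half order gained
  in the linear model.

  Volatility error. Let \<open>a\<close> be the left value of \<open>Y\<close>. For \<open>f(y) = y\<^sup>2\<close> the root of the integrated variance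
  is of the size of \<open>a\<^sup>2\<close> or else everything is small, and \<open>D\<close> has rate \<open>\<delta>\<close>
  (\<open>quadratic_vol_error_moments\<close>). For \<open>f(y) = y\<close> one has \<open>D\<^sup>2 \<le> Q\<close> and \<open>D\<^sup>2 a\<^sup>2 \<le> 4 Q\<^sup>2\<close> with \<open>Q\<close> of rate
  \<open>\<delta>\<close>: the error is of order \<open>sqrt \<delta>\<close> only when \<open>a\<close> is within about \<open>sqrt \<delta>\<close> of zero. Since \<open>Y\<^sub>t\<close> has
  a density, and stays near \<open>y0 \<noteq> 0\<close> for small \<open>t\<close>, this event has probability about \<open>sqrt \<delta>\<close>, which
  improves the moment of order \<open>2 p\<close> from \<open>\<delta> powr p\<close> to about \<open>\<delta> powr (p + 1/2)\<close>
  (\<open>linear_vol_error_moment\<close>).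
\<close>

section \<open>Time averages\<close>

definition time_avg :: "real \<Rightarrow> real \<Rightarrow> (real \<Rightarrow> real) \<Rightarrow> real" where
  "time_avg a b f = integral {a..b} f / (b - a)"

lemma LBINT_eq_time_avg:
  fixes f :: "real \<Rightarrow> real"
  assumes "a < b" "continuous_on {a..b} f"
  shows "(LBINT s=a..b. f s) = (b - a) * time_avg a b f"
proof -
  have "set_integrable lborel {a..b} f"
    using assms by (intro borel_integrable_atLeastAtMost')
  then have "(LBINT s=a..b. f s) = integral {a..b} f"
    using assms by (simp add: interval_integral_Icc set_borel_integral_eq_integral(2))
  then show ?thesis using assms by (simp add: time_avg_def)
qed

lemma time_avg_add:
  assumes "continuous_on {a..b} f" "continuous_on {a..b} g"
  shows "time_avg a b (\<lambda>s. f s + g s) = time_avg a b f + time_avg a b g"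
  unfolding time_avg_def using assms
  by (simp add: integral_add integrable_continuous_real add_divide_distrib)

lemma time_avg_cmult: "time_avg a b (\<lambda>s. c * f s) = c * time_avg a b f"
  unfolding time_avg_def by simp

lemma time_avg_const: "a < b \<Longrightarrow> time_avg a b (\<lambda>s. c) = c"
  unfolding time_avg_def by simp

lemma time_avg_mono:
  assumes "a < b" "continuous_on {a..b} f" "continuous_on {a..b} g"
    "\<And>s. s \<in> {a..b} \<Longrightarrow> f s \<le> g s"
  shows "time_avg a b f \<le> time_avg a b g"
  unfolding time_avg_def using assms
  by (intro divide_right_mono integral_le integrable_continuous_real) auto

lemma time_avg_cong:
  "(\<And>s. s \<in> {a..b} \<Longrightarrow> f s = g s) \<Longrightarrow> time_avg a b f = time_avg a b g"
  unfolding time_avg_def by (metis integral_cong)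

lemma time_avg_square_ge:
  assumes "a < b" "continuous_on {a..b} f"
  shows "(time_avg a b f)\<^sup>2 \<le> time_avg a b (\<lambda>s. (f s)\<^sup>2)"
proof -
  define m where "m = time_avg a b f"
  have "0 = time_avg a b (\<lambda>s. 0)" using assms by (simp add: time_avg_const)
  also have "\<dots> \<le> time_avg a b (\<lambda>s. (f s - m)\<^sup>2)"
    using assms by (intro time_avg_mono continuous_intros) auto
  also have "\<dots> = time_avg a b (\<lambda>s. (f s)\<^sup>2 + ((-2 * m) * f s + m\<^sup>2))"
    by (intro time_avg_cong) (simp add: power2_eq_square algebra_simps)
  also have "\<dots> = time_avg a b (\<lambda>s. (f s)\<^sup>2) + ((- 2 * m) * time_avg a b f + m\<^sup>2)"
    using assms by (simp only: time_avg_add time_avg_cmult time_avg_const continuous_intros)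
  finally show ?thesis unfolding m_def by (simp add: power2_eq_square)
qed

text \<open>Statements about time averages of random processes are reduced to means of finitely many random
  variables through this limit, path by path.\<close>
lemma riemann_sum_tendsto_time_avg:
  assumes ab: "a < b" and f: "continuous_on {a..b} f"
  shows "(\<lambda>n. (\<Sum>j<n. f (a + real j * ((b - a) / real n))) / real n) \<longlonglongrightarrow> time_avg a b f"
proof (rule LIMSEQ_I)
  fix r :: real assume r: "0 < r"
  have "uniformly_continuous_on {a..b} f"
    using f by (intro compact_uniformly_continuous) auto
  then obtain d where d: "d > 0"
    "\<And>x y. x \<in> {a..b} \<Longrightarrow> y \<in> {a..b} \<Longrightarrow> dist x y < d \<Longrightarrow> dist (f x) (f y) < r / 2"
    unfolding uniformly_continuous_on_def using r by (metis half_gt_zero)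
  obtain n0 where n0: "(b - a) / d < real n0" using reals_Archimedean2 by blast
  show "\<exists>no. \<forall>n\<ge>no. norm ((\<Sum>j<n. f (a + real j * ((b - a) / real n))) / real n - time_avg a b f) < r"
  proof (intro exI allI impI)
    fix n assume n: "n \<ge> max n0 1"
    define h where "h = (b - a) / real n"
    define x where "x j = a + real j * h" for j
    have n': "n > 0" "real n0 \<le> real n" using n by auto
    have h: "h > 0" "h < d" "real n * h = b - a"
    proof -
      show "h > 0" using ab n' by (simp add: h_def)
      have "(b - a) / d < real n" using n0 n' by linarith
      then show "h < d" using d(1) n' by (simp add: h_def field_simps)
      show "real n * h = b - a" using n' by (simp add: h_def)
    qed
    have x: "x j \<in> {a..b}" if "j \<le> n" for j
    proof -
      have "real j * h \<le> real n * h" using that h by (intro mult_right_mono) auto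
      then show ?thesis using h by (simp add: x_def)
    qed
    have xs: "x (Suc j) = x j + h" for j by (simp add: x_def algebra_simps)
    have tele: "integral {a..x k} f = (\<Sum>j<k. integral {x j..x (Suc j)} f)" if "k \<le> n" for k
      using that
    proof (induction k)
      case 0 then show ?case by (simp add: x_def)
    next
      case (Suc k)
      have "f integrable_on {a..x (Suc k)}"
        using x[of "Suc k"] Suc.prems by (intro integrable_continuous_real continuous_on_subset[OF f]) auto
      then have "integral {a..x k} f + integral {x k..x (Suc k)} f = integral {a..x (Suc k)} f"
        using x[of k] Suc.prems h xs[of k] by (intro Henstock_Kurzweil_Integration.integral_combine) auto
      then show ?case using Suc by simp
    qed
    have step: "\<bar>h * f (x j) - integral {x j..x (Suc j)} f\<bar> \<le> r / 2 * h" if j: "j < n" for j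
    proof -
      have sub: "{x j..x (Suc j)} \<subseteq> {a..b}" using x[of j] x[of "Suc j"] j by auto
      have int: "f integrable_on {x j..x (Suc j)}"
        by (intro integrable_continuous_real continuous_on_subset[OF f] sub)
      have "integral {x j..x (Suc j)} (\<lambda>s. f s - f (x j)) = integral {x j..x (Suc j)} f - h * f (x j)"
        using int h xs[of j] by (subst integral_diff) auto
      moreover have "norm (integral {x j..x (Suc j)} (\<lambda>s. f s - f (x j))) \<le> r / 2 * (x (Suc j) - x j)"
      proof (rule integral_bound)
        show "x j \<le> x (Suc j)" using xs h by auto
        show "continuous_on {x j..x (Suc j)} (\<lambda>s. f s - f (x j))"
          by (intro continuous_intros continuous_on_subset[OF f] sub)
        show "norm (f s - f (x j)) \<le> r / 2" if "s \<in> {x j..x (Suc j)}" for s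
        proof -
          have "dist s (x j) < d" using that xs[of j] h by (auto simp: dist_real_def)
          then show ?thesis using d(2)[of s "x j"] sub that x[of j] j by (auto simp: dist_real_def)
        qed
      qed
      ultimately show ?thesis using xs[of j] by (auto simp: abs_minus_commute)
    qed
    have "x n = b" using h by (simp add: x_def)
    then have "\<bar>(\<Sum>j<n. h * f (x j)) - integral {a..b} f\<bar> = \<bar>\<Sum>j<n. h * f (x j) - integral {x j..x (Suc j)} f\<bar>"
      using tele[of n] by (simp add: sum_subtractf)
    also have "\<dots> \<le> (\<Sum>j<n. r / 2 * h)" by (intro order_trans[OF sum_abs] sum_mono step) auto
    also have "\<dots> = r / 2 * (real n * h)" by simp
    also have "\<dots> = r / 2 * (b - a)" by (simp only: h(3))
    finally have *: "\<bar>(\<Sum>j<n. h * f (x j)) - integral {a..b} f\<bar> \<le> r / 2 * (b - a)" .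
    have "(\<Sum>j<n. f (x j)) / real n - time_avg a b f = ((\<Sum>j<n. h * f (x j)) - integral {a..b} f) / (b - a)"
    proof -
      have "(\<Sum>j<n. h * f (x j)) = (b - a) * ((\<Sum>j<n. f (x j)) / real n)"
        unfolding sum_distrib_left[symmetric] h_def by simp
      then show ?thesis using ab by (simp add: time_avg_def diff_divide_distrib)
    qed
    also have "\<bar>\<dots>\<bar> \<le> r / 2" using * ab by (simp add: field_simps)
    finally show "norm ((\<Sum>j<n. f (a + real j * ((b - a) / real n))) / real n - time_avg a b f) < r"
      using r by (simp add: x_def h_def)
  qed
qed

section \<open>Families of random variables with uniformly controlled moments\<close>

lemma abs_add_power_le: "\<bar>x + y\<bar> ^ m \<le> 2 ^ m * (\<bar>x\<bar> ^ m + \<bar>y\<bar> ^ m)" for x y :: real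
proof -
  have "\<bar>x + y\<bar> ^ m \<le> (2 * max \<bar>x\<bar> \<bar>y\<bar>) ^ m" by (intro power_mono) auto
  also have "\<dots> = 2 ^ m * (max \<bar>x\<bar> \<bar>y\<bar>) ^ m" by (simp add: power_mult_distrib)
  also have "\<dots> \<le> 2 ^ m * (\<bar>x\<bar> ^ m + \<bar>y\<bar> ^ m)"
    by (intro mult_left_mono) (auto simp: max_def)
  finally show ?thesis .
qed

text \<open>Jensen's inequality for the convex function \<open>t \<mapsto> t ^ m\<close> on the half line.\<close>
lemma mean_power_le:
  fixes x :: "nat \<Rightarrow> real"
  assumes "n > 0"
  shows "\<bar>(\<Sum>j<n. x j) / real n\<bar> ^ m \<le> (\<Sum>j<n. \<bar>x j\<bar> ^ m) / real n"
proof (cases "m = 0")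
  case True then show ?thesis using assms by simp
next
  case False
  have cv: "convex_on {0..} (\<lambda>t::real. t ^ m)"
    by (cases "even m") (auto intro: convex_power_odd convex_on_subset[OF convex_power_even])
  have "(\<Sum>j<n. inverse (real n) *\<^sub>R \<bar>x j\<bar>) ^ m \<le> (\<Sum>j<n. inverse (real n) * \<bar>x j\<bar> ^ m)"
    using assms by (intro convex_on_sum[OF _ _ cv]) auto
  moreover have "\<bar>(\<Sum>j<n. x j) / real n\<bar> ^ m \<le> (\<Sum>j<n. inverse (real n) *\<^sub>R \<bar>x j\<bar>) ^ m"
  proof (intro power_mono)
    have "\<bar>\<Sum>j<n. x j\<bar> / real n \<le> (\<Sum>j<n. \<bar>x j\<bar>) / real n"
      by (intro divide_right_mono sum_abs) auto
    then show "\<bar>(\<Sum>j<n. x j) / real n\<bar> \<le> (\<Sum>j<n. inverse (real n) *\<^sub>R \<bar>x j\<bar>)"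
      by (simp add: sum_distrib_left[symmetric] divide_inverse mult.commute abs_mult)
  qed auto
  ultimately show ?thesis by (simp add: sum_distrib_left[symmetric] divide_inverse mult.commute)
qed

abbreviation (in prob_space) abs_moment :: "('a \<Rightarrow> real) \<Rightarrow> nat \<Rightarrow> ennreal" where
  "abs_moment X m \<equiv> \<integral>\<^sup>+\<omega>. ennreal (\<bar>X \<omega>\<bar> ^ m) \<partial>M"

text \<open>The constant may depend on the order \<open>m\<close> but not on the index; this uniformity is what turns the
  rate \<open>c\<close> into an order of magnitude in the step size. Rates are positive so that they can be
  divided by.\<close>
definition (in prob_space) moments_O :: "'i set \<Rightarrow> ('i \<Rightarrow> 'a \<Rightarrow> real) \<Rightarrow> ('i \<Rightarrow> real) \<Rightarrow> bool" where
  "moments_O I X c \<longleftrightarrow>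
     (\<forall>i\<in>I. X i \<in> borel_measurable M \<and> 0 < c i) \<and>
     (\<forall>m::nat. \<exists>C. \<forall>i\<in>I. abs_moment (X i) m \<le> ennreal (C * c i ^ m))"

lemma ennreal_affine:
  assumes "0 \<le> L" "0 \<le> a" "0 \<le> k" "0 \<le> b"
  shows "ennreal (L * (a + k * b)) = ennreal L * (ennreal a + ennreal k * ennreal b)"
  using assms by (simp add: ennreal_mult ennreal_plus)

context prob_space
begin

text \<open>Integrates a pointwise bound consisting of two terms, the form that the moment estimates below take.\<close>
lemma nn_integral_affine_bound:
  fixes f a b :: "'a \<Rightarrow> real"
  assumes le: "AE \<omega> in M. f \<omega> \<le> L * (a \<omega> + k * b \<omega>)"
    and [measurable]: "a \<in> borel_measurable M" "b \<in> borel_measurable M"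
    and nn: "\<And>\<omega>. 0 \<le> a \<omega>" "\<And>\<omega>. 0 \<le> b \<omega>" "0 \<le> L" "0 \<le> k" "0 \<le> A" "0 \<le> D"
    and A: "(\<integral>\<^sup>+\<omega>. ennreal (a \<omega>) \<partial>M) \<le> ennreal A" and D: "(\<integral>\<^sup>+\<omega>. ennreal (b \<omega>) \<partial>M) \<le> ennreal D"
  shows "(\<integral>\<^sup>+\<omega>. ennreal (f \<omega>) \<partial>M) \<le> ennreal (L * (A + k * D))"
proof -
  have "(\<integral>\<^sup>+\<omega>. ennreal (f \<omega>) \<partial>M) \<le> (\<integral>\<^sup>+\<omega>. ennreal L * (ennreal (a \<omega>) + ennreal k * ennreal (b \<omega>)) \<partial>M)"
    using le by (intro nn_integral_mono_AE)
      (auto elim!: eventually_mono simp: nn ennreal_affine[symmetric] intro!: ennreal_leI)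
  also have "\<dots> = ennreal L * ((\<integral>\<^sup>+\<omega>. ennreal (a \<omega>) \<partial>M) + ennreal k * (\<integral>\<^sup>+\<omega>. ennreal (b \<omega>) \<partial>M))"
    by (simp add: nn_integral_cmult nn_integral_add)
  also have "\<dots> \<le> ennreal L * (ennreal A + ennreal k * ennreal D)"
    by (intro mult_left_mono add_mono A D) auto
  finally show ?thesis using nn by (simp only: ennreal_affine)
qed

lemma moments_OD1: "moments_O I X c \<Longrightarrow> i \<in> I \<Longrightarrow> X i \<in> borel_measurable M"
  and moments_OD2: "moments_O I X c \<Longrightarrow> i \<in> I \<Longrightarrow> 0 < c i"
  by (auto simp: moments_O_def)

lemma moments_OE:
  assumes "moments_O I X c"
  obtains C where "C \<ge> 0"
    "\<And>i. i \<in> I \<Longrightarrow> abs_moment (X i) m \<le> ennreal (C * c i ^ m)"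
proof -
  obtain C where C: "\<forall>i\<in>I. abs_moment (X i) m \<le> ennreal (C * c i ^ m)"
    using assms unfolding moments_O_def by blast
  have "ennreal (C * c i ^ m) \<le> ennreal (\<bar>C\<bar> * c i ^ m)" if "i \<in> I" for i
    using moments_OD2[OF assms that] by (intro ennreal_leI mult_right_mono) auto
  with C show ?thesis by (intro that[of "\<bar>C\<bar>"]) (auto intro: order_trans)
qed

lemma moments_OI:
  assumes "\<And>i. i \<in> I \<Longrightarrow> X i \<in> borel_measurable M" "\<And>i. i \<in> I \<Longrightarrow> 0 < c i"
    "\<And>m::nat. \<exists>C. \<forall>i\<in>I. abs_moment (X i) m \<le> ennreal (C * c i ^ m)"
  shows "moments_O I X c"
  using assms by (auto simp: moments_O_def)

lemma moments_O_mono: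
  assumes Z: "moments_O I Z c"
    and X: "\<And>i. i \<in> I \<Longrightarrow> X i \<in> borel_measurable M"
    and le: "\<And>i. i \<in> I \<Longrightarrow> AE \<omega> in M. \<bar>X i \<omega>\<bar> \<le> \<bar>Z i \<omega>\<bar>"
  shows "moments_O I X c"
proof (rule moments_OI)
  fix m :: nat
  obtain C where C: "\<And>i. i \<in> I \<Longrightarrow> abs_moment (Z i) m \<le> ennreal (C * c i ^ m)"
    using moments_OE[OF Z] by blast
  have "abs_moment (X i) m \<le> abs_moment (Z i) m" if "i \<in> I" for i
    using le[OF that] by (intro nn_integral_mono_AE) (auto intro!: ennreal_leI power_mono)
  with C show "\<exists>C. \<forall>i\<in>I. abs_moment (X i) m \<le> ennreal (C * c i ^ m)"
    by (meson order_trans)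
qed (use X moments_OD2[OF Z] in auto)

lemma moments_O_cong_AE:
  assumes "moments_O I Z c"
    and "\<And>i. i \<in> I \<Longrightarrow> X i \<in> borel_measurable M"
    and "\<And>i. i \<in> I \<Longrightarrow> AE \<omega> in M. X i \<omega> = Z i \<omega>"
  shows "moments_O I X c"
  proof (rule moments_O_mono[OF assms(1,2)])
  show "AE \<omega> in M. \<bar>X i \<omega>\<bar> \<le> \<bar>Z i \<omega>\<bar>" if "i \<in> I" for i
    using assms(3)[OF that] by eventually_elim simp
qed

lemma moments_O_rate:
  assumes X: "moments_O I X c" and d: "\<And>i. i \<in> I \<Longrightarrow> 0 < d i" "\<And>i. i \<in> I \<Longrightarrow> c i \<le> K * d i"
  shows "moments_O I X d"
proof (rule moments_OI)
  fix m :: nat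
  obtain C where C: "C \<ge> 0" "\<And>i. i \<in> I \<Longrightarrow> abs_moment (X i) m \<le> ennreal (C * c i ^ m)"
    using moments_OE[OF X] by blast
  have "C * c i ^ m \<le> (C * K ^ m) * d i ^ m" if i: "i \<in> I" for i
    using power_mono[OF d(2)[OF i], of m] moments_OD2[OF X i] C(1)
    by (simp add: power_mult_distrib mult.assoc mult_left_mono)
  then show "\<exists>C. \<forall>i\<in>I. abs_moment (X i) m \<le> ennreal (C * d i ^ m)"
    using C(2) by (intro exI[of _ "C * K ^ m"]) (meson ennreal_leI order_trans)
qed (use moments_OD1[OF X] d in auto)

lemma moments_O_reindex:
  assumes "moments_O I X c" "\<And>j. j \<in> J \<Longrightarrow> f j \<in> I"
  shows "moments_O J (\<lambda>j. X (f j)) (\<lambda>j. c (f j))"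
  using assms unfolding moments_O_def by blast

lemma moments_O_add:
  assumes X: "moments_O I X c" and Y: "moments_O I Y c"
  shows "moments_O I (\<lambda>i \<omega>. X i \<omega> + Y i \<omega>) c"
proof (rule moments_OI)
  fix m :: nat
  obtain C where C: "C \<ge> 0" "\<And>i. i \<in> I \<Longrightarrow> abs_moment (X i) m \<le> ennreal (C * c i ^ m)"
    using moments_OE[OF X] by blast
  obtain D where D: "D \<ge> 0" "\<And>i. i \<in> I \<Longrightarrow> abs_moment (Y i) m \<le> ennreal (D * c i ^ m)"
    using moments_OE[OF Y] by blast
  have "abs_moment (\<lambda>\<omega>. X i \<omega> + Y i \<omega>) m \<le> ennreal ((2 ^ m * (C + D)) * c i ^ m)" if i: "i \<in> I" for i
  proof -
    have [measurable]: "X i \<in> borel_measurable M" "Y i \<in> borel_measurable M"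
      using moments_OD1[OF X i] moments_OD1[OF Y i] by auto
    have "abs_moment (\<lambda>\<omega>. X i \<omega> + Y i \<omega>) m \<le> ennreal (2 ^ m * (C * c i ^ m + 1 * (D * c i ^ m)))"
      using C D i moments_OD2[OF X i] abs_add_power_le
      by (intro nn_integral_affine_bound[where a="\<lambda>\<omega>. \<bar>X i \<omega>\<bar> ^ m" and b="\<lambda>\<omega>. \<bar>Y i \<omega>\<bar> ^ m"]) auto
    also have "2 ^ m * (C * c i ^ m + 1 * (D * c i ^ m)) = (2 ^ m * (C + D)) * c i ^ m"
      by (simp add: algebra_simps)
    finally show ?thesis .
  qed
  then show "\<exists>C. \<forall>i\<in>I. abs_moment (\<lambda>\<omega>. X i \<omega> + Y i \<omega>) m \<le> ennreal (C * c i ^ m)" by blast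
qed (use moments_OD1[OF X] moments_OD1[OF Y] moments_OD2[OF X] in auto)

text \<open>Young's inequality \<open>2 p q \<le> u p\<^sup>2 + v q\<^sup>2\<close> with \<open>u v = 1\<close>; the choice \<open>u = (d / c) ^ m\<close> makes both
  terms of the order of \<open>(c d) ^ m\<close>.\<close>
lemma moments_O_mult:
  assumes X: "moments_O I X c" and Y: "moments_O I Y d"
  shows "moments_O I (\<lambda>i \<omega>. X i \<omega> * Y i \<omega>) (\<lambda>i. c i * d i)"
proof (rule moments_OI)
  fix m :: nat
  obtain C where C: "C \<ge> 0" "\<And>i. i \<in> I \<Longrightarrow> abs_moment (X i) (2*m) \<le> ennreal (C * c i ^ (2*m))"
    using moments_OE[OF X] by blast
  obtain D where D: "D \<ge> 0" "\<And>i. i \<in> I \<Longrightarrow> abs_moment (Y i) (2*m) \<le> ennreal (D * d i ^ (2*m))"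
    using moments_OE[OF Y] by blast
  have "abs_moment (\<lambda>\<omega>. X i \<omega> * Y i \<omega>) m \<le> ennreal ((C + D) * (c i * d i) ^ m)" if i: "i \<in> I" for i
  proof -
    have [measurable]: "X i \<in> borel_measurable M" "Y i \<in> borel_measurable M"
      using moments_OD1[OF X i] moments_OD1[OF Y i] by auto
    have c: "c i > 0" and d: "d i > 0" using moments_OD2[OF X i] moments_OD2[OF Y i] by auto
    \<comment> \<open>balances the rates \<open>c\<close> and \<open>d\<close>\<close>
    define u where "u = (d i / c i) ^ m"
    define v where "v = (c i / d i) ^ m"
    have u: "u > 0" and v: "v > 0" using c d by (auto simp: u_def v_def)
    have uv: "u * v = 1" using c d by (simp add: u_def v_def power_mult_distrib[symmetric])
    have le: "\<bar>X i \<omega> * Y i \<omega>\<bar> ^ m \<le> u * \<bar>X i \<omega>\<bar> ^ (2*m) + v * \<bar>Y i \<omega>\<bar> ^ (2*m)" for \<omega>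
    proof -
      define p where "p = \<bar>X i \<omega>\<bar> ^ m" define q where "q = \<bar>Y i \<omega>\<bar> ^ m"
      have "0 \<le> u * (p - v * q)\<^sup>2" using u by simp
      also have "\<dots> = u * p\<^sup>2 + v * q\<^sup>2 * (u * v) - 2 * (u * v) * p * q"
        by (simp add: power2_eq_square algebra_simps)
      finally have "2 * (p * q) \<le> u * p\<^sup>2 + v * q\<^sup>2" using uv by simp
      moreover have "0 \<le> p * q" by (simp add: p_def q_def)
      ultimately have "p * q \<le> u * p\<^sup>2 + v * q\<^sup>2" by linarith
      then show ?thesis
        by (simp add: p_def q_def abs_mult power_mult_distrib power_mult[symmetric] mult.commute)
    qed
    have "abs_moment (\<lambda>\<omega>. X i \<omega> * Y i \<omega>) m \<le> ennreal (1 * (u * (C * c i ^ (2*m)) + v * (D * d i ^ (2*m))))"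
    proof (rule nn_integral_affine_bound)
      show "AE \<omega> in M. \<bar>X i \<omega> * Y i \<omega>\<bar> ^ m \<le> 1 * (u * \<bar>X i \<omega>\<bar> ^ (2*m) + v * \<bar>Y i \<omega>\<bar> ^ (2*m))"
        using le by simp
      have "(\<integral>\<^sup>+\<omega>. ennreal (u * \<bar>X i \<omega>\<bar> ^ (2*m)) \<partial>M) = ennreal u * abs_moment (X i) (2*m)"
        using u by (simp add: ennreal_mult' nn_integral_cmult)
      also have "\<dots> \<le> ennreal u * ennreal (C * c i ^ (2*m))" by (intro mult_left_mono C i) auto
      finally show "(\<integral>\<^sup>+\<omega>. ennreal (u * \<bar>X i \<omega>\<bar> ^ (2*m)) \<partial>M) \<le> ennreal (u * (C * c i ^ (2*m)))"
        using u by (simp add: ennreal_mult')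
    qed (use u v c d C D i in auto)
    also have "1 * (u * (C * c i ^ (2*m)) + v * (D * d i ^ (2*m))) = (C + D) * (c i * d i) ^ m"
      using c d unfolding u_def v_def
      by (simp add: power_mult power2_eq_square power_mult_distrib power_divide field_simps)
    finally show ?thesis .
  qed
  then show "\<exists>C. \<forall>i\<in>I. abs_moment (\<lambda>\<omega>. X i \<omega> * Y i \<omega>) m \<le> ennreal (C * (c i * d i) ^ m)" by blast
qed (use moments_OD1[OF X] moments_OD1[OF Y] moments_OD2[OF X] moments_OD2[OF Y] in auto)

lemma moments_O_const:
  assumes "\<And>i. i \<in> I \<Longrightarrow> 0 < c i" "\<And>i. i \<in> I \<Longrightarrow> \<bar>x i\<bar> \<le> K * c i"
  shows "moments_O I (\<lambda>i _. x i) c"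
proof (rule moments_OI)
  fix m :: nat
  have "\<bar>x i\<bar> ^ m \<le> K ^ m * c i ^ m" if "i \<in> I" for i
    using power_mono[OF assms(2)[OF that], of m] by (simp add: power_mult_distrib)
  then show "\<exists>C. \<forall>i\<in>I. abs_moment (\<lambda>\<omega>. x i) m \<le> ennreal (C * c i ^ m)"
    by (intro exI[of _ "K ^ m"]) (auto intro!: ennreal_leI simp: emeasure_space_1)
qed (use assms in auto)

lemma moments_O_cmult:
  assumes X: "moments_O I X c"
  shows "moments_O I (\<lambda>i \<omega>. k * X i \<omega>) c"
  using moments_O_mult[OF moments_O_const[of I "\<lambda>_. 1" "\<lambda>_. k" "\<bar>k\<bar>"] X] by simp

lemma moments_O_power:
  assumes X: "moments_O I X c"
  shows "moments_O I (\<lambda>i \<omega>. X i \<omega> ^ n) (\<lambda>i. c i ^ n)"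
proof (induction n)
  case 0 show ?case using moments_O_const[of I "\<lambda>_. 1" "\<lambda>_. 1" 1] by simp
next
  case (Suc n) show ?case using moments_O_mult[OF X Suc] by simp
qed

lemma moments_O_abs:
  assumes X: "moments_O I X c"
  shows "moments_O I (\<lambda>i \<omega>. \<bar>X i \<omega>\<bar>) c"
  using moments_OD1[OF X] by (intro moments_O_mono[OF X]) auto

text \<open>By Fatou's lemma, moment bounds that are uniform along the approximating sequence survive in the
  almost sure limit.\<close>
lemma moments_O_limit:
  fixes X :: "'i \<Rightarrow> nat \<Rightarrow> 'a \<Rightarrow> real"
  assumes X: "moments_O (I \<times> UNIV) (\<lambda>(i, n). X i n) (\<lambda>(i, n). c i)"
    and Y: "\<And>i. i \<in> I \<Longrightarrow> Y i \<in> borel_measurable M"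
    and lim: "\<And>i. i \<in> I \<Longrightarrow> AE \<omega> in M. (\<lambda>n. X i n \<omega>) \<longlonglongrightarrow> Y i \<omega>"
  shows "moments_O I Y c"
proof (rule moments_OI)
  fix m :: nat
  obtain C where C: "C \<ge> 0"
    "\<And>j. j \<in> I \<times> UNIV \<Longrightarrow> abs_moment (\<lambda>\<omega>. case_prod X j \<omega>) m \<le> ennreal (C * (case j of (i, n) \<Rightarrow> c i) ^ m)"
    using moments_OE[OF X] by blast
  have "abs_moment (Y i) m \<le> ennreal (C * c i ^ m)" if i: "i \<in> I" for i
  proof -
    have [measurable]: "X i n \<in> borel_measurable M" for n
      using moments_OD1[OF X, of "(i, n)"] i by auto
    have "abs_moment (Y i) m = (\<integral>\<^sup>+\<omega>. liminf (\<lambda>n. ennreal (\<bar>X i n \<omega>\<bar> ^ m)) \<partial>M)"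
    proof (rule nn_integral_cong_AE)
      show "AE \<omega> in M. ennreal (\<bar>Y i \<omega>\<bar> ^ m) = liminf (\<lambda>n. ennreal (\<bar>X i n \<omega>\<bar> ^ m))"
        using lim[OF i]
      proof eventually_elim
        case (elim \<omega>)
        have "(\<lambda>n. ennreal (\<bar>X i n \<omega>\<bar> ^ m)) \<longlonglongrightarrow> ennreal (\<bar>Y i \<omega>\<bar> ^ m)"
          using elim by (intro tendsto_ennrealI tendsto_intros)
        then show ?case by (intro lim_imp_Liminf[symmetric]) auto
      qed
    qed
    also have "\<dots> \<le> liminf (\<lambda>n. \<integral>\<^sup>+\<omega>. ennreal (\<bar>X i n \<omega>\<bar> ^ m) \<partial>M)"
      by (intro nn_integral_liminf) auto
    also have "\<dots> \<le> liminf (\<lambda>n. ennreal (C * c i ^ m))"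
      using C(2)[of "(i, _)"] i by (intro Liminf_mono always_eventually) auto
    also have "\<dots> = ennreal (C * c i ^ m)" by (intro lim_imp_Liminf) auto
    finally show ?thesis .
  qed
  then show "\<exists>C. \<forall>i\<in>I. abs_moment (Y i) m \<le> ennreal (C * c i ^ m)" by blast
next
  show "0 < c i" if "i \<in> I" for i using moments_OD2[OF X, of "(i, 0)"] that by auto
qed (use Y in auto)

lemma moments_O_mean:
  fixes X :: "'i \<Rightarrow> nat \<Rightarrow> 'a \<Rightarrow> real"
  assumes X: "moments_O (SIGMA i:I. {..<n i}) (\<lambda>(i, j). X i j) (\<lambda>(i, j). c i)"
    and n: "\<And>i. i \<in> I \<Longrightarrow> n i > 0"
  shows "moments_O I (\<lambda>i \<omega>. (\<Sum>j<n i. X i j \<omega>) / real (n i)) c"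
proof (rule moments_OI)
  have meas: "X i j \<in> borel_measurable M" if "i \<in> I" "j < n i" for i j
    using moments_OD1[OF X, of "(i, j)"] that by auto
  then show "(\<lambda>\<omega>. (\<Sum>j<n i. X i j \<omega>) / real (n i)) \<in> borel_measurable M" if "i \<in> I" for i
    using that by (auto intro!: borel_measurable_divide borel_measurable_sum)
  show pos: "0 < c i" if "i \<in> I" for i using moments_OD2[OF X, of "(i, 0)"] that n by auto
  fix m :: nat
  obtain C where C: "C \<ge> 0"
    "\<And>j. j \<in> (SIGMA i:I. {..<n i}) \<Longrightarrow> abs_moment (\<lambda>\<omega>. case_prod X j \<omega>) m \<le> ennreal (C * (case j of (i, n) \<Rightarrow> c i) ^ m)"
    using moments_OE[OF X] by blast
  have "abs_moment (\<lambda>\<omega>. (\<Sum>j<n i. X i j \<omega>) / real (n i)) m \<le> ennreal (C * c i ^ m)" if i: "i \<in> I" for i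
  proof -
    have "abs_moment (\<lambda>\<omega>. (\<Sum>j<n i. X i j \<omega>) / real (n i)) m
       \<le> (\<integral>\<^sup>+\<omega>. ennreal (1 / real (n i)) * (\<Sum>j<n i. ennreal (\<bar>X i j \<omega>\<bar> ^ m)) \<partial>M)"
    proof (rule nn_integral_mono)
      fix \<omega>
      have "ennreal (1 / real (n i)) * (\<Sum>j<n i. ennreal (\<bar>X i j \<omega>\<bar> ^ m)) = ennreal ((\<Sum>j<n i. \<bar>X i j \<omega>\<bar> ^ m) / real (n i))"
        by (simp add: sum_ennreal ennreal_mult'[symmetric] sum_nonneg)
      then show "ennreal (\<bar>(\<Sum>j<n i. X i j \<omega>) / real (n i)\<bar> ^ m) \<le> ennreal (1 / real (n i)) * (\<Sum>j<n i. ennreal (\<bar>X i j \<omega>\<bar> ^ m))"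
        using mean_power_le[OF n[OF i], of "\<lambda>j. X i j \<omega>" m] by (simp add: ennreal_leI)
    qed
    also have "\<dots> = ennreal (1 / real (n i)) * (\<Sum>j<n i. \<integral>\<^sup>+\<omega>. ennreal (\<bar>X i j \<omega>\<bar> ^ m) \<partial>M)"
      using meas[OF i]
      by (subst nn_integral_cmult, simp, subst nn_integral_sum) (auto simp del: sum_ennreal)
    also have "\<dots> \<le> ennreal (1 / real (n i)) * (\<Sum>j<n i. ennreal (C * c i ^ m))"
      using C(2)[of "(i, _)"] i by (intro mult_left_mono sum_mono) auto
    also have "\<dots> = ennreal (C * c i ^ m)"
      using n[OF i] C(1) pos[OF i]
      by (simp add: ennreal_of_nat_eq_real_of_nat ennreal_mult[symmetric])
    finally show ?thesis .
  qed
  then show "\<exists>C. \<forall>i\<in>I. abs_moment (\<lambda>\<omega>. (\<Sum>j<n i. X i j \<omega>) / real (n i)) m \<le> ennreal (C * c i ^ m)"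
    by blast
qed

lemma time_avg_measurable:
  assumes "a < b" "\<And>s. s \<in> {a..b} \<Longrightarrow> X s \<in> borel_measurable M"
    and "\<And>\<omega>. \<omega> \<in> space M \<Longrightarrow> continuous_on {a..b} (\<lambda>s. X s \<omega>)"
  shows "(\<lambda>\<omega>. time_avg a b (\<lambda>s. X s \<omega>)) \<in> borel_measurable M"
proof (rule borel_measurable_LIMSEQ_real)
  show "(\<lambda>n. (\<Sum>j<n. X (a + real j * ((b - a) / real n)) \<omega>) / real n) \<longlonglongrightarrow> time_avg a b (\<lambda>s. X s \<omega>)"
    if "\<omega> \<in> space M" for \<omega>
    using riemann_sum_tendsto_time_avg[OF assms(1) assms(3)[OF that]] .
  have "a + real j * ((b - a) / real n) \<in> {a..b}" if "j < n" for j n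
  proof -
    have "real j * ((b - a) / real n) \<le> real n * ((b - a) / real n)"
      using that assms(1) by (intro mult_right_mono) auto
    then show ?thesis using assms(1) that by simp
  qed
  then show "(\<lambda>\<omega>. (\<Sum>j<n. X (a + real j * ((b - a) / real n)) \<omega>) / real n) \<in> borel_measurable M" for n
    using assms(2) by (auto intro!: borel_measurable_divide borel_measurable_sum)
qed

text \<open>With continuous paths a time average is the limit of its Riemann sums, to which Jensen's inequality
  and then Fatou's lemma apply.\<close>
lemma moments_O_time_avg:
  fixes X :: "'i \<Rightarrow> real \<Rightarrow> 'a \<Rightarrow> real"
  assumes X: "moments_O (SIGMA i:I. {a i..b i}) (\<lambda>(i, s). X i s) (\<lambda>(i, s). c i)"
    and ab: "\<And>i. i \<in> I \<Longrightarrow> a i < b i"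
    and cont: "\<And>i \<omega>. i \<in> I \<Longrightarrow> \<omega> \<in> space M \<Longrightarrow> continuous_on {a i..b i} (\<lambda>s. X i s \<omega>)"
  shows "moments_O I (\<lambda>i \<omega>. time_avg (a i) (b i) (\<lambda>s. X i s \<omega>)) c"
proof (rule moments_O_limit)
  define s where "s i n j = a i + real j * ((b i - a i) / real n)" for i n j
  have s: "s i n j \<in> {a i..b i}" if "i \<in> I" "j < n" for i n j
  proof -
    have "real j * ((b i - a i) / real n) \<le> real n * ((b i - a i) / real n)"
      using that ab[of i] by (intro mult_right_mono) auto
    then show ?thesis using ab[of i] that by (simp add: s_def)
  qed
  have meas: "X i u \<in> borel_measurable M" if "i \<in> I" "u \<in> {a i..b i}" for i u
    using moments_OD1[OF X, of "(i, u)"] that by auto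
  have "moments_O (SIGMA p:I \<times> UNIV. {..<Suc (snd p)}) (\<lambda>q. (\<lambda>(i, s). X i s) (fst (fst q), s (fst (fst q)) (Suc (snd (fst q))) (snd q)))
      (\<lambda>q. (\<lambda>(i, s). c i) (fst (fst q), s (fst (fst q)) (Suc (snd (fst q))) (snd q)))"
    using s by (intro moments_O_reindex[OF X]) (auto simp del: of_nat_Suc)
  then have "moments_O (SIGMA p:I \<times> UNIV. {..<Suc (snd p)}) (\<lambda>(p, j). X (fst p) (s (fst p) (Suc (snd p)) j)) (\<lambda>(p, j). c (fst p))"
    by (simp add: case_prod_unfold)
  from moments_O_mean[OF this]
  show "moments_O (I \<times> UNIV) (\<lambda>(i, n) \<omega>. (\<Sum>j<Suc n. X i (s i (Suc n) j) \<omega>) / real (Suc n)) (\<lambda>(i, n). c i)"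
    by (simp add: case_prod_unfold)
  show "(\<lambda>\<omega>. time_avg (a i) (b i) (\<lambda>s. X i s \<omega>)) \<in> borel_measurable M" if "i \<in> I" for i
    using that ab meas cont by (intro time_avg_measurable) auto
  show "AE \<omega> in M. (\<lambda>n. (\<Sum>j<Suc n. X i (s i (Suc n) j) \<omega>) / real (Suc n)) \<longlonglongrightarrow> time_avg (a i) (b i) (\<lambda>s. X i s \<omega>)"
    if "i \<in> I" for i
  proof (rule AE_I2)
    fix \<omega> assume "\<omega> \<in> space M"
    from LIMSEQ_Suc[OF riemann_sum_tendsto_time_avg[OF ab[OF that] cont[OF that this]]]
    show "(\<lambda>n. (\<Sum>j<Suc n. X i (s i (Suc n) j) \<omega>) / real (Suc n)) \<longlonglongrightarrow> time_avg (a i) (b i) (\<lambda>s. X i s \<omega>)"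
      unfolding s_def .
  qed
qed

text \<open>Used for square roots: odd powers of \<open>X\<close> are interpolated by
  \<open>\<bar>X\<bar> ^ m \<le> c ^ m + \<bar>X\<bar> ^ (2 * m) / c ^ m\<close>.\<close>
lemma moments_O_of_square:
  assumes X: "moments_O I (\<lambda>i \<omega>. (X i \<omega>)\<^sup>2) (\<lambda>i. (c i)\<^sup>2)"
    and meas: "\<And>i. i \<in> I \<Longrightarrow> X i \<in> borel_measurable M" and pos: "\<And>i. i \<in> I \<Longrightarrow> 0 < c i"
  shows "moments_O I X c"
proof (rule moments_OI)
  fix m :: nat
  obtain C where C: "C \<ge> 0" "\<And>i. i \<in> I \<Longrightarrow> abs_moment (\<lambda>\<omega>. (X i \<omega>)\<^sup>2) m \<le> ennreal (C * (c i)\<^sup>2 ^ m)"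
    using moments_OE[OF X] by blast
  have "abs_moment (X i) m \<le> ennreal ((1 + C) * c i ^ m)" if i: "i \<in> I" for i
  proof -
    note [measurable] = meas[OF i]
    have c: "c i > 0" using pos i by auto
    have le: "\<bar>X i \<omega>\<bar> ^ m \<le> c i ^ m + 1 / c i ^ m * \<bar>(X i \<omega>)\<^sup>2\<bar> ^ m" for \<omega>
    proof -
      define x where "x = \<bar>X i \<omega>\<bar> ^ m" define k where "k = c i ^ m"
      have k: "k > 0" using c by (simp add: k_def)
      have x: "x \<ge> 0" by (simp add: x_def)
      have "x * k \<le> k * k + x * x" using x k
        by (metis add_increasing2 add_increasing linorder_le_cases mult_left_mono mult_right_mono zero_le_square less_imp_le)
      then have "x \<le> k + 1 / k * (x * x)" using k by (simp add: field_simps)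
      moreover have "\<bar>(X i \<omega>)\<^sup>2\<bar> ^ m = x * x"
        by (simp add: x_def power2_eq_square abs_mult power_mult_distrib[symmetric])
      ultimately show ?thesis by (simp add: x_def k_def)
    qed
    have "abs_moment (X i) m \<le> ennreal (1 * (c i ^ m + 1 / c i ^ m * (C * (c i)\<^sup>2 ^ m)))"
      using c le C(1) C(2)[OF i] 
      by (intro nn_integral_affine_bound[where a="\<lambda>_. c i ^ m" and b="\<lambda>\<omega>. \<bar>(X i \<omega>)\<^sup>2\<bar> ^ m"]) (auto simp: emeasure_space_1)
    also have "1 * (c i ^ m + 1 / c i ^ m * (C * (c i)\<^sup>2 ^ m)) = (1 + C) * c i ^ m"
      using c by (simp add: field_simps power2_eq_square power_mult_distrib)
    finally show ?thesis .
  qed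
  then show "\<exists>C. \<forall>i\<in>I. abs_moment (X i) m \<le> ennreal (C * c i ^ m)" by blast
qed (use assms in auto)

end

section \<open>Gaussian moments and densities\<close>

definition gauss_moment :: "nat \<Rightarrow> real" where
  "gauss_moment m = (\<integral>x. std_normal_density x * \<bar>x\<bar> ^ m \<partial>lborel)"

lemma gauss_moment_nonneg: "0 \<le> gauss_moment m"
  unfolding gauss_moment_def by (intro Bochner_Integration.integral_nonneg) auto

lemma gauss_moment_0: "gauss_moment 0 = 1"
  unfolding gauss_moment_def by simp

context prob_space
begin

lemma normal_abs_moment:
  assumes X: "distributed M lborel X (normal_density 0 \<sigma>)" and \<sigma>: "0 < \<sigma>"
  shows "abs_moment X m = ennreal (gauss_moment m * \<sigma> ^ m)"
proof -
  have D: "distributed M lborel (\<lambda>\<omega>. X \<omega> / \<sigma>) std_normal_density"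
    using normal_standard_normal_convert[OF \<sigma>, of X 0] X by simp
  have [measurable]: "X \<in> borel_measurable M" using distributed_measurable[OF X] by simp
  have "abs_moment X m = (\<integral>\<^sup>+\<omega>. ennreal (\<sigma> ^ m) * ennreal (\<bar>X \<omega> / \<sigma>\<bar> ^ m) \<partial>M)"
    using \<sigma> by (intro nn_integral_cong) (simp add: ennreal_mult[symmetric] power_divide)
  also have "\<dots> = ennreal (\<sigma> ^ m) * abs_moment (\<lambda>\<omega>. X \<omega> / \<sigma>) m"
    by (simp add: nn_integral_cmult)
  also have "abs_moment (\<lambda>\<omega>. X \<omega> / \<sigma>) m
      = (\<integral>\<^sup>+x. ennreal (std_normal_density x) * ennreal (\<bar>x\<bar> ^ m) \<partial>lborel)"
    by (rule distributed_nn_integral[OF D, symmetric]) auto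
  also have "\<dots> = (\<integral>\<^sup>+x. ennreal (std_normal_density x * \<bar>x\<bar> ^ m) \<partial>lborel)"
    by (simp add: ennreal_mult)
  also have "\<dots> = ennreal (gauss_moment m)"
    unfolding gauss_moment_def by (intro nn_integral_eq_integral integrable_std_normal_moment_abs) auto
  finally show ?thesis using \<sigma> gauss_moment_nonneg[of m] by (simp add: ennreal_mult[symmetric] mult.commute)
qed

lemma normal_mean_zero:
  assumes X: "distributed M lborel X (normal_density 0 \<sigma>)" and \<sigma>: "0 < \<sigma>"
  shows "expectation X = 0"
  using normal_distributed_expectation[OF \<sigma> X] .

lemma weighted_gaussian_sum_distributed:
  fixes \<xi> :: "nat \<Rightarrow> 'a \<Rightarrow> real"
  assumes "indep_vars (\<lambda>_. borel) \<xi> J" "finite J" "J \<noteq> {}" "\<sigma> > 0"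
    and "\<And>l. l \<in> J \<Longrightarrow> distributed M lborel (\<xi> l) (normal_density 0 \<sigma>)"
    and "\<And>l. l \<in> J \<Longrightarrow> d l \<noteq> 0"
  shows "distributed M lborel (\<lambda>\<omega>. \<Sum>l\<in>J. d l * \<xi> l \<omega>) (normal_density 0 (\<sigma> * sqrt (\<Sum>l\<in>J. (d l)\<^sup>2)))"
proof -
  have "distributed M lborel (\<lambda>\<omega>. \<Sum>l\<in>J. d l * \<xi> l \<omega>)
      (normal_density (\<Sum>l\<in>J. 0) (sqrt (\<Sum>l\<in>J. (\<bar>d l\<bar> * \<sigma>)\<^sup>2)))"
  proof (rule sum_indep_normal)
    show "indep_vars (\<lambda>i. borel) (\<lambda>l \<omega>. d l * \<xi> l \<omega>) J"
      by (rule indep_vars_compose2[OF assms(1)]) auto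
    show "distributed M lborel (\<lambda>\<omega>. d l * \<xi> l \<omega>) (normal_density 0 (\<bar>d l\<bar> * \<sigma>))" if "l \<in> J" for l
      using normal_density_affine[OF assms(5)[OF that] assms(4) assms(6)[OF that], of 0] by simp
  qed (use assms in auto)
  moreover have "sqrt (\<Sum>l\<in>J. (\<bar>d l\<bar> * \<sigma>)\<^sup>2) = \<sigma> * sqrt (\<Sum>l\<in>J. (d l)\<^sup>2)"
    using assms(4) by (simp add: power_mult_distrib sum_distrib_left[symmetric] real_sqrt_mult mult.commute[of _ "\<sigma>\<^sup>2"])
  ultimately show ?thesis by simp
qed

text \<open>The partial sum is Gaussian with variance at most that of the full sum. Terms of weight zero are
  dropped first, since a degenerate Gaussian variable has no density.\<close>
lemma weighted_gaussian_sum_moment: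
  fixes \<xi> :: "nat \<Rightarrow> 'a \<Rightarrow> real"
  assumes ind: "indep_vars (\<lambda>_. borel) \<xi> {..<N}" and "k \<le> N" "\<sigma> > 0"
    and D: "\<And>l. l < N \<Longrightarrow> distributed M lborel (\<xi> l) (normal_density 0 \<sigma>)"
  shows "abs_moment (\<lambda>\<omega>. \<Sum>l<k. d l * \<xi> l \<omega>) m
      \<le> ennreal (gauss_moment m * (\<sigma> * sqrt (\<Sum>l<N. (d l)\<^sup>2)) ^ m)"
proof -
  define J where "J = {l\<in>{..<k}. d l \<noteq> 0}"
  have eq: "(\<Sum>l<k. d l * \<xi> l \<omega>) = (\<Sum>l\<in>J. d l * \<xi> l \<omega>)" for \<omega>
    unfolding J_def by (intro sum.mono_neutral_right) auto
  have J: "J \<subseteq> {..<N}" "finite J" using assms(2) by (auto simp: J_def)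
  show ?thesis
  proof (cases "J = {}")
    case True
    have "0 \<le> (\<sigma> * sqrt (\<Sum>l<N. (d l)\<^sup>2)) ^ m" using assms(3) by (simp add: sum_nonneg)
    then show ?thesis unfolding eq using True gauss_moment_0
      by (cases "m = 0") (auto simp: emeasure_space_1 power_0_left)
  next
    case False
    have "abs_moment (\<lambda>\<omega>. \<Sum>l\<in>J. d l * \<xi> l \<omega>) m = ennreal (gauss_moment m * (\<sigma> * sqrt (\<Sum>l\<in>J. (d l)\<^sup>2)) ^ m)"
    proof (rule normal_abs_moment)
      show "distributed M lborel (\<lambda>\<omega>. \<Sum>l\<in>J. d l * \<xi> l \<omega>) (normal_density 0 (\<sigma> * sqrt (\<Sum>l\<in>J. (d l)\<^sup>2)))"
        using J D False assms(3) by (intro weighted_gaussian_sum_distributed indep_vars_subset[OF ind])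
          (auto simp: J_def)
      have "0 < (\<Sum>l\<in>J. (d l)\<^sup>2)" using J False by (intro sum_pos) (auto simp: J_def)
      then show "0 < \<sigma> * sqrt (\<Sum>l\<in>J. (d l)\<^sup>2)" using assms(3) by simp
    qed
    also have "\<dots> \<le> ennreal (gauss_moment m * (\<sigma> * sqrt (\<Sum>l<N. (d l)\<^sup>2)) ^ m)"
      using J assms(3)
      by (intro ennreal_leI mult_left_mono power_mono gauss_moment_nonneg real_sqrt_le_mono sum_mono2)
        (auto simp: sum_nonneg)
    finally show ?thesis unfolding eq .
  qed
qed

section \<open>Maxima of finitely many variables\<close>

lemma powr_le_1_plus_power:
  fixes u p :: real
  assumes "0 \<le> u" "0 < p" "p \<le> real m"
  shows "u powr p \<le> 1 + u ^ m"
proof (cases "u \<le> 1")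
  case True
  then have "u powr p \<le> 1" using assms by (intro powr_le1) auto
  then show ?thesis using assms by (simp add: add_increasing2)
next
  case False
  then have "u powr p \<le> u powr real m" using assms by (intro powr_mono) auto
  then show ?thesis using False by (simp add: powr_realpow)
qed

text \<open>A union bound in a high moment: for any level \<open>\<lambda>\<close> the power \<open>q\<close> of \<open>\<bar>Z\<^sub>k\<bar> / (c \<lambda>)\<close> is at most one plus
  its power \<open>m\<close>. The choice \<open>\<lambda> = N powr (1 / m)\<close> makes the sum of the \<open>m\<close>-th moments bounded in \<open>N\<close>,
  and \<open>\<lambda> powr q \<le> N powr \<epsilon>\<close> when \<open>m \<ge> q / \<epsilon>\<close>. The constant \<open>K\<close> depends on the variables only through the
  bounds \<open>C\<close>, so the statement applies uniformly to Gaussian sums with arbitrary deterministic weights.\<close>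
lemma max_moment_bound:
  fixes C :: "nat \<Rightarrow> real"
  assumes q: "0 < q" and \<epsilon>: "0 < \<epsilon>"
  obtains K where "0 \<le> K"
    "\<And>N c (Z :: nat \<Rightarrow> 'a \<Rightarrow> real). 1 \<le> N \<Longrightarrow> 0 < c \<Longrightarrow> (\<And>k. k \<le> N \<Longrightarrow> Z k \<in> borel_measurable M) \<Longrightarrow>
       (\<And>k m. k \<le> N \<Longrightarrow> abs_moment (Z k) m \<le> ennreal (C m * c ^ m)) \<Longrightarrow>
       (\<integral>\<^sup>+\<omega>. ennreal (MAX k\<in>{0..N}. \<bar>Z k \<omega>\<bar> powr q) \<partial>M) \<le> ennreal (K * real N powr \<epsilon> * c powr q)"
proof -
  \<comment> \<open>\<open>m \<ge> q\<close> for the comparison of powers, \<open>m \<ge> q / \<epsilon>\<close> for the loss \<open>N powr (q / m) \<le> N powr \<epsilon>\<close>\<close>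
  define m where "m = nat \<lceil>max q (q / \<epsilon>)\<rceil> + 1"
  have m: "q \<le> real m" "q / \<epsilon> \<le> real m" "m > 0" unfolding m_def by linarith+
  define K where "K = 1 + 2 * \<bar>C m\<bar>"
  show ?thesis
  proof (rule that[of K])
    show "0 \<le> K" by (simp add: K_def)
    fix N c and Z :: "nat \<Rightarrow> 'a \<Rightarrow> real"
    assume N: "1 \<le> N" and c: "0 < c" and [measurable]: "\<And>k. k \<le> N \<Longrightarrow> Z k \<in> borel_measurable M"
      and mom: "\<And>k m. k \<le> N \<Longrightarrow> abs_moment (Z k) m \<le> ennreal (C m * c ^ m)"
    define lam where "lam = real N powr (1 / real m)"
    have lam: "lam > 0" "lam ^ m = real N" using N m
      by (auto simp: lam_def powr_realpow[symmetric] powr_powr)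
    define L where "L = (c * lam) powr q"
    have L: "L > 0" using c lam by (simp add: L_def)
    define R where "R = 1 / (c ^ m * real N)"
    have R: "R > 0" using c N by (simp add: R_def)
    have pt: "(MAX k\<in>{0..N}. \<bar>Z k \<omega>\<bar> powr q) \<le> L * (1 + (\<Sum>k\<le>N. R * \<bar>Z k \<omega>\<bar> ^ m))" for \<omega>
    proof (intro Max.boundedI)
      fix y assume "y \<in> (\<lambda>k. \<bar>Z k \<omega>\<bar> powr q) ` {0..N}"
      then obtain k where k: "k \<le> N" "y = \<bar>Z k \<omega>\<bar> powr q" by auto
      have "\<bar>Z k \<omega>\<bar> = (c * lam) * (\<bar>Z k \<omega>\<bar> / (c * lam))" using c lam by simp
      then have "y = L * (\<bar>Z k \<omega>\<bar> / (c * lam)) powr q"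
        unfolding k L_def using c lam by (subst powr_mult[symmetric]) auto
      also have "(\<bar>Z k \<omega>\<bar> / (c * lam)) powr q \<le> 1 + (\<bar>Z k \<omega>\<bar> / (c * lam)) ^ m"
        using c lam q m by (intro powr_le_1_plus_power) auto
      also have "(\<bar>Z k \<omega>\<bar> / (c * lam)) ^ m = R * \<bar>Z k \<omega>\<bar> ^ m"
        using c lam by (simp add: R_def power_divide power_mult_distrib)
      also have "R * \<bar>Z k \<omega>\<bar> ^ m \<le> (\<Sum>k\<le>N. R * \<bar>Z k \<omega>\<bar> ^ m)"
        using k R by (intro member_le_sum) auto
      finally show "y \<le> L * (1 + (\<Sum>k\<le>N. R * \<bar>Z k \<omega>\<bar> ^ m))" using L by simp
    qed auto
    have distrib: "ennreal (L * (1 + (\<Sum>k\<le>N. R * x k))) = ennreal L * (1 + (\<Sum>k\<le>N. ennreal R * ennreal (x k)))"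
      if "\<And>k. 0 \<le> x k" for x
    proof -
      have "(\<Sum>k\<le>N. ennreal R * ennreal (x k)) = (\<Sum>k\<le>N. ennreal (R * x k))"
        using R by (simp add: ennreal_mult')
      also have "\<dots> = ennreal (\<Sum>k\<le>N. R * x k)" using R that by (intro sum_ennreal) auto
      finally have *: "(\<Sum>k\<le>N. ennreal R * ennreal (x k)) = ennreal (\<Sum>k\<le>N. R * x k)" .
      have "0 \<le> (\<Sum>k\<le>N. R * x k)" using R that by (intro sum_nonneg) auto
      then show ?thesis unfolding * using L by (simp add: ennreal_mult' ennreal_plus)
    qed
    have "(\<integral>\<^sup>+\<omega>. ennreal (MAX k\<in>{0..N}. \<bar>Z k \<omega>\<bar> powr q) \<partial>M)
        \<le> (\<integral>\<^sup>+\<omega>. ennreal L * (1 + (\<Sum>k\<le>N. ennreal R * ennreal (\<bar>Z k \<omega>\<bar> ^ m))) \<partial>M)"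
    proof (rule nn_integral_mono)
      fix \<omega>
      have "ennreal (L * (1 + (\<Sum>k\<le>N. R * \<bar>Z k \<omega>\<bar> ^ m))) = ennreal L * (1 + (\<Sum>k\<le>N. ennreal R * ennreal (\<bar>Z k \<omega>\<bar> ^ m)))"
        using L R by (intro distrib) auto
      with ennreal_leI[OF pt[of \<omega>]]
      show "ennreal (MAX k\<in>{0..N}. \<bar>Z k \<omega>\<bar> powr q) \<le> ennreal L * (1 + (\<Sum>k\<le>N. ennreal R * ennreal (\<bar>Z k \<omega>\<bar> ^ m)))"
        by simp
    qed
    also have "\<dots> = ennreal L * (1 + (\<Sum>k\<le>N. ennreal R * abs_moment (Z k) m))"
    proof -
      have "(\<integral>\<^sup>+\<omega>. (\<Sum>k\<le>N. ennreal R * ennreal (\<bar>Z k \<omega>\<bar> ^ m)) \<partial>M) = (\<Sum>k\<le>N. \<integral>\<^sup>+\<omega>. ennreal R * ennreal (\<bar>Z k \<omega>\<bar> ^ m) \<partial>M)"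
        by (intro nn_integral_sum) auto
      then show ?thesis by (simp add: nn_integral_cmult nn_integral_add emeasure_space_1)
    qed
    also have "\<dots> \<le> ennreal L * (1 + (\<Sum>k\<le>N. ennreal R * ennreal (\<bar>C m\<bar> * c ^ m)))"
    proof (intro mult_left_mono add_mono sum_mono)
      fix k assume "k \<in> {..N}"
      then have "abs_moment (Z k) m \<le> ennreal (C m * c ^ m)" using mom by simp
      also have "\<dots> \<le> ennreal (\<bar>C m\<bar> * c ^ m)" using c by (intro ennreal_leI mult_right_mono) auto
      finally show "abs_moment (Z k) m \<le> ennreal (\<bar>C m\<bar> * c ^ m)" .
    qed auto
    also have "\<dots> = ennreal (L * (1 + (\<Sum>k\<le>N. R * (\<bar>C m\<bar> * c ^ m))))"
      using L R c by (intro distrib[symmetric]) auto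
    also have "\<dots> \<le> ennreal (K * real N powr \<epsilon> * c powr q)"
    proof (rule ennreal_leI)
      have "(\<Sum>k\<le>N. R * (\<bar>C m\<bar> * c ^ m)) = (1 + 1 / real N) * \<bar>C m\<bar>"
        using c N by (simp add: R_def field_simps)
      also have "\<dots> \<le> 2 * \<bar>C m\<bar>" using N by (intro mult_right_mono) (auto simp: field_simps)
      finally have 1: "1 + (\<Sum>k\<le>N. R * (\<bar>C m\<bar> * c ^ m)) \<le> K" by (simp add: K_def)
      have "L = c powr q * real N powr (q / real m)"
        using c lam by (simp add: L_def powr_mult lam_def powr_powr)
      also have "\<dots> \<le> c powr q * real N powr \<epsilon>"
        using N m \<epsilon> by (intro mult_left_mono powr_mono) (auto simp: field_simps)
      finally have 2: "L \<le> c powr q * real N powr \<epsilon>" .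
      have "L * (1 + (\<Sum>k\<le>N. R * (\<bar>C m\<bar> * c ^ m))) \<le> (c powr q * real N powr \<epsilon>) * K"
        using 1 2 L R c by (intro mult_mono) (auto intro!: add_nonneg_nonneg sum_nonneg)
      then show "L * (1 + (\<Sum>k\<le>N. R * (\<bar>C m\<bar> * c ^ m))) \<le> K * real N powr \<epsilon> * c powr q"
        by (simp add: mult_ac)
    qed
    finally show "(\<integral>\<^sup>+\<omega>. ennreal (MAX k\<in>{0..N}. \<bar>Z k \<omega>\<bar> powr q) \<partial>M) \<le> ennreal (K * real N powr \<epsilon> * c powr q)" .
  qed
qed

section \<open>Even moments of discrete martingale transforms\<close>

text \<open>In the binomial expansion the terms of degree between \<open>2\<close> and \<open>2 q\<close> in \<open>y\<close> are dominated by one of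
  the two extreme ones, according to which of \<open>\<bar>x\<bar>\<close> and \<open>\<bar>y\<bar>\<close> is larger. The linear term is kept because
  it has mean zero in the application below.\<close>
lemma even_power_expansion:
  fixes x y :: real
  assumes q: "q \<ge> (1::nat)"
  shows "(x + y) ^ (2*q) \<le> x ^ (2*q) + 2 * real q * x ^ (2*q - 1) * y
           + 4 ^ q * (x ^ (2*q - 2) * y\<^sup>2 + y ^ (2*q))"
proof -
  define n where "n = 2 * q"
  have n: "n \<ge> 2" "even n" "even (n - 2)" using q by (auto simp: n_def)
  define B where "B = x ^ (n - 2) * y\<^sup>2 + y ^ n"
  have B: "B \<ge> 0" unfolding B_def using n by (intro add_nonneg_nonneg mult_nonneg_nonneg zero_le_even_power) auto
  have term_le: "y ^ k * x ^ (n - k) \<le> B" if k: "2 \<le> k" "k \<le> n" for k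
  proof -
    have "y ^ k * x ^ (n - k) \<le> \<bar>y\<bar> ^ k * \<bar>x\<bar> ^ (n - k)"
      using abs_ge_self[of "y ^ k * x ^ (n - k)"] by (simp add: abs_mult power_abs)
    also have "\<dots> \<le> B"
    proof (cases "\<bar>y\<bar> \<le> \<bar>x\<bar>")
      case True
      have "2 + (k - 2) = k" using k by simp
      with power_add[of "\<bar>y\<bar>" 2 "k - 2"] have "\<bar>y\<bar> ^ k = \<bar>y\<bar> ^ 2 * \<bar>y\<bar> ^ (k - 2)" by (simp only:)
      also have "\<dots> \<le> \<bar>y\<bar> ^ 2 * \<bar>x\<bar> ^ (k - 2)" using True by (intro mult_left_mono power_mono) auto
      finally have "\<bar>y\<bar> ^ k * \<bar>x\<bar> ^ (n - k) \<le> \<bar>y\<bar> ^ 2 * \<bar>x\<bar> ^ (k - 2) * \<bar>x\<bar> ^ (n - k)"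
        by (intro mult_right_mono) auto
      also have "\<dots> = \<bar>y\<bar> ^ 2 * \<bar>x\<bar> ^ (n - 2)"
        using k by (simp add: power_add[symmetric])
      also have "\<dots> \<le> B" unfolding B_def using n by (simp add: power_even_abs mult.commute zero_le_even_power)
      finally show ?thesis .
    next
      case False
      then have "\<bar>y\<bar> ^ k * \<bar>x\<bar> ^ (n - k) \<le> \<bar>y\<bar> ^ k * \<bar>y\<bar> ^ (n - k)"
        by (intro mult_left_mono power_mono) auto
      also have "\<dots> = y ^ n" using k n by (simp add: power_add[symmetric] power_even_abs)
      also have "\<dots> \<le> B" unfolding B_def using n
        by (simp add: zero_le_even_power)
      finally show ?thesis .
    qed
    finally show ?thesis .
  qed
  have split: "{..n} = {0, 1} \<union> {2..n}" using n by auto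
  have "(x + y) ^ n = (\<Sum>k\<le>n. of_nat (n choose k) * y ^ k * x ^ (n - k))"
    by (subst add.commute) (rule binomial_ring)
  also have "\<dots> = x ^ n + real n * y * x ^ (n - 1) + (\<Sum>k\<in>{2..n}. real (n choose k) * y ^ k * x ^ (n - k))"
    unfolding split by (subst sum.union_disjoint) auto
  also have "(\<Sum>k\<in>{2..n}. real (n choose k) * y ^ k * x ^ (n - k)) \<le> (\<Sum>k\<in>{2..n}. real (n choose k) * B)"
    using term_le by (intro sum_mono) (simp add: mult.assoc mult_left_mono)
  also have "\<dots> \<le> (\<Sum>k\<le>n. real (n choose k) * B)"
    using B by (intro sum_mono2) auto
  also have "\<dots> = 4 ^ q * B"
    using choose_row_sum[of n] by (simp add: sum_distrib_right[symmetric] n_def power_mult of_nat_sum[symmetric] del: of_nat_sum)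
  finally show ?thesis by (simp add: n_def B_def mult_ac)
qed

abbreviation "all_moments X \<equiv> moments_O (UNIV :: unit set) (\<lambda>_. X) (\<lambda>_. 1)"

lemma all_moments_integrable: "all_moments X \<Longrightarrow> integrable M X"
proof -
  assume X: "all_moments X"
  obtain C where "abs_moment X 1 \<le> ennreal (C * 1 ^ 1)"
    using moments_OE[OF X, of 1] by blast
  then have "(\<integral>\<^sup>+\<omega>. ennreal (norm (X \<omega>)) \<partial>M) \<le> ennreal C" by simp
  also have "\<dots> < \<infinity>" by simp
  finally show ?thesis using moments_OD1[OF X] by (intro integrableI_bounded) auto
qed

lemma all_moments_mult: "all_moments X \<Longrightarrow> all_moments Y \<Longrightarrow> all_moments (\<lambda>\<omega>. X \<omega> * Y \<omega>)"
  using moments_O_mult[of "UNIV::unit set" "\<lambda>_. X" "\<lambda>_. 1" "\<lambda>_. Y" "\<lambda>_. 1"] by simp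

lemma all_moments_add: "all_moments X \<Longrightarrow> all_moments Y \<Longrightarrow> all_moments (\<lambda>\<omega>. X \<omega> + Y \<omega>)"
  using moments_O_add[of "UNIV::unit set" "\<lambda>_. X" "\<lambda>_. 1" "\<lambda>_. Y"] by simp

lemma all_moments_power: "all_moments X \<Longrightarrow> all_moments (\<lambda>\<omega>. X \<omega> ^ n)"
  using moments_O_power[of "UNIV::unit set" "\<lambda>_. X" "\<lambda>_. 1" n] by simp

lemma all_moments_const: "all_moments (\<lambda>_. c)"
  using moments_O_const[of "UNIV::unit set" "\<lambda>_. 1" "\<lambda>_. c" "\<bar>c\<bar>"] by simp

lemmas all_moments_intros = all_moments_mult all_moments_add all_moments_power all_moments_const

text \<open>With \<open>x = S k\<close> and \<open>y = a k * G k\<close> in the expansion of the even power, the linear term vanishes in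
  expectation, as \<open>G k\<close> is centred and independent of \<open>(S k, a k)\<close>. The others factor in the same
  way, and each step multiplies \<open>E (S k) ^ (2 q) + 2 A\<close> by at most \<open>1 + 4 ^ q * g\<close>: a discrete Gronwall
  argument. When \<open>g\<close> is of the order of the step size, the bound is uniform over a fixed time horizon.\<close>
lemma martingale_transform_even_moment:
  fixes S a G :: "nat \<Rightarrow> 'a \<Rightarrow> real"
  assumes q: "q \<ge> (1::nat)"
    and S0: "\<And>\<omega>. S 0 \<omega> = 0"
    and SS: "\<And>k \<omega>. k < N \<Longrightarrow> S (Suc k) \<omega> = S k \<omega> + a k \<omega> * G k \<omega>"
    and ind: "\<And>k f. k < N \<Longrightarrow> f \<in> borel_measurable (borel \<Otimes>\<^sub>M borel) \<Longrightarrow>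
      indep_var borel (\<lambda>\<omega>. f (S k \<omega>, a k \<omega>) :: real) borel (G k)"
    and a: "\<And>k. k < N \<Longrightarrow> all_moments (a k)" and G: "\<And>k. k < N \<Longrightarrow> all_moments (G k)"
    and mean: "\<And>k. k < N \<Longrightarrow> expectation (G k) = 0"
    and A: "\<And>k. k < N \<Longrightarrow> expectation (\<lambda>\<omega>. a k \<omega> ^ (2*q)) \<le> A" "A \<ge> 0"
    and g: "\<And>k. k < N \<Longrightarrow> expectation (\<lambda>\<omega>. (G k \<omega>)\<^sup>2) \<le> g" "\<And>k. k < N \<Longrightarrow> expectation (\<lambda>\<omega>. G k \<omega> ^ (2*q)) \<le> g" "g \<ge> 0"
    and k: "k \<le> N"
  shows "all_moments (S k) \<and> expectation (\<lambda>\<omega>. S k \<omega> ^ (2*q)) \<le> 2 * A * exp (4 ^ q * g * real k)"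
proof -
  have S: "all_moments (S k)" if "k \<le> N" for k
    using that
  proof (induction k)
    case 0
    have "S 0 = (\<lambda>_. 0)" by (intro ext S0)
    then show ?case by (simp only: all_moments_const)
  next
    case (Suc k)
    then have k: "k < N" "k \<le> N" by auto
    have "S (Suc k) = (\<lambda>\<omega>. S k \<omega> + a k \<omega> * G k \<omega>)" by (intro ext SS k)
    moreover have "all_moments (\<lambda>\<omega>. S k \<omega> + a k \<omega> * G k \<omega>)"
      by (intro all_moments_add all_moments_mult Suc.IH a G k)
    ultimately show ?case by (simp only:)
  qed
  have "expectation (\<lambda>\<omega>. S k \<omega> ^ (2*q)) + 2 * A \<le> 2 * A * (1 + 4 ^ q * g) ^ k"
    using k
  proof (induction k)
    case 0 then show ?case using S0 q by (simp add: power_0_left)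
  next
    case (Suc k)
    then have k: "k < N" "k \<le> N" by auto
    note Sk = S[OF k(2)] and ak = a[OF k(1)] and Gk = G[OF k(1)]
    have prod: "expectation (\<lambda>\<omega>. f (S k \<omega>, a k \<omega>) * h (G k \<omega>)) =
        expectation (\<lambda>\<omega>. f (S k \<omega>, a k \<omega>)) * expectation (\<lambda>\<omega>. h (G k \<omega>))"
      if f: "f \<in> borel_measurable (borel \<Otimes>\<^sub>M borel)" "h \<in> borel_measurable borel"
        and i: "integrable M (\<lambda>\<omega>. f (S k \<omega>, a k \<omega>))" "integrable M (\<lambda>\<omega>. h (G k \<omega>))" for f and h :: "real \<Rightarrow> real"
      by (rule indep_var_lebesgue_integral[OF indep_var_compose[OF ind[OF k(1) f(1)] measurable_ident f(2), unfolded comp_def id_def] i])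
    have p1: "expectation (\<lambda>\<omega>. (S k \<omega> ^ (2*q - 1) * a k \<omega>) * G k \<omega>) = 0"
    proof -
      have "expectation (\<lambda>\<omega>. (S k \<omega> ^ (2*q - 1) * a k \<omega>) * G k \<omega>) = expectation (\<lambda>\<omega>. S k \<omega> ^ (2*q - 1) * a k \<omega>) * expectation (G k)"
        using prod[of "\<lambda>z. fst z ^ (2*q - 1) * snd z" "\<lambda>x. x"] unfolding fst_conv snd_conv
        by (this; intro borel_measurable_times borel_measurable_power measurable_fst measurable_snd measurable_ident_sets refl all_moments_integrable all_moments_intros Sk ak Gk)
      then show ?thesis using mean[OF k(1)] by simp
    qed
    have p2: "expectation (\<lambda>\<omega>. (S k \<omega> ^ (2*q - 2) * (a k \<omega>)\<^sup>2) * (G k \<omega>)\<^sup>2)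
        = expectation (\<lambda>\<omega>. S k \<omega> ^ (2*q - 2) * (a k \<omega>)\<^sup>2) * expectation (\<lambda>\<omega>. (G k \<omega>)\<^sup>2)"
      using prod[of "\<lambda>z. fst z ^ (2*q - 2) * (snd z)\<^sup>2" "\<lambda>x. x\<^sup>2"] unfolding fst_conv snd_conv
      by (this; intro borel_measurable_times borel_measurable_power measurable_fst measurable_snd measurable_ident_sets refl all_moments_integrable all_moments_intros Sk ak Gk)
    have p3: "expectation (\<lambda>\<omega>. (a k \<omega> ^ (2*q)) * G k \<omega> ^ (2*q))
        = expectation (\<lambda>\<omega>. a k \<omega> ^ (2*q)) * expectation (\<lambda>\<omega>. G k \<omega> ^ (2*q))"
      using prod[of "\<lambda>z. snd z ^ (2*q)" "\<lambda>x. x ^ (2*q)"] unfolding fst_conv snd_conv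
      by (this; intro borel_measurable_times borel_measurable_power measurable_fst measurable_snd measurable_ident_sets refl all_moments_integrable all_moments_intros Sk ak Gk)
    define E where "E = expectation (\<lambda>\<omega>. S k \<omega> ^ (2*q))"
    have E0: "E \<ge> 0" unfolding E_def by (intro Bochner_Integration.integral_nonneg) simp
    have pow: "z ^ (2*q - 2) * z\<^sup>2 = z ^ (2*q)" for z :: real
    proof -
      have "2*q - 2 + 2 = 2*q" using q by simp
      with power_add[of z "2*q - 2" 2] show ?thesis by (simp only:)
    qed
    have young: "x ^ (2*q - 2) * y\<^sup>2 \<le> x ^ (2*q) + y ^ (2*q)" for x y :: real
    proof (cases "\<bar>y\<bar> \<le> \<bar>x\<bar>")
      case True
      then have "y\<^sup>2 \<le> x\<^sup>2" by (simp add: abs_le_square_iff)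
      then have "x ^ (2*q - 2) * y\<^sup>2 \<le> x ^ (2*q - 2) * x\<^sup>2" by (intro mult_left_mono zero_le_even_power) auto
      also have "\<dots> = x ^ (2*q)" by (rule pow)
      finally show ?thesis by (simp add: add_increasing2)
    next
      case False
      then have "\<bar>x\<bar> ^ (2*q - 2) \<le> \<bar>y\<bar> ^ (2*q - 2)" by (intro power_mono) auto
      then have "x ^ (2*q - 2) \<le> y ^ (2*q - 2)" by (simp add: power_even_abs)
      then have "x ^ (2*q - 2) * y\<^sup>2 \<le> y ^ (2*q - 2) * y\<^sup>2" by (intro mult_right_mono) auto
      also have "\<dots> = y ^ (2*q)" by (rule pow)
      finally show ?thesis by (simp add: add_increasing)
    qed
    have Sa: "expectation (\<lambda>\<omega>. S k \<omega> ^ (2*q - 2) * (a k \<omega>)\<^sup>2) \<le> E + A"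
    proof -
      have "expectation (\<lambda>\<omega>. S k \<omega> ^ (2*q - 2) * (a k \<omega>)\<^sup>2) \<le> expectation (\<lambda>\<omega>. S k \<omega> ^ (2*q) + a k \<omega> ^ (2*q))"
        using young Sk ak by (intro Bochner_Integration.integral_mono) (auto intro!: all_moments_integrable all_moments_intros)
      also have "\<dots> = E + expectation (\<lambda>\<omega>. a k \<omega> ^ (2*q))"
        unfolding E_def using Sk ak by (intro Bochner_Integration.integral_add all_moments_integrable all_moments_intros)
      finally show ?thesis using A(1)[OF k(1)] by simp
    qed
    have "expectation (\<lambda>\<omega>. S (Suc k) \<omega> ^ (2*q)) \<le> expectation (\<lambda>\<omega>. S k \<omega> ^ (2*q)
        + (2 * real q) * ((S k \<omega> ^ (2*q - 1) * a k \<omega>) * G k \<omega>)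
        + 4 ^ q * ((S k \<omega> ^ (2*q - 2) * (a k \<omega>)\<^sup>2) * (G k \<omega>)\<^sup>2 + (a k \<omega> ^ (2*q)) * G k \<omega> ^ (2*q)))"
    proof (rule Bochner_Integration.integral_mono)
      show "integrable M (\<lambda>\<omega>. S (Suc k) \<omega> ^ (2*q))"
        using S[OF Suc.prems] by (intro all_moments_integrable all_moments_intros)
      fix \<omega>
      show "S (Suc k) \<omega> ^ (2*q) \<le> S k \<omega> ^ (2*q)
        + (2 * real q) * ((S k \<omega> ^ (2*q - 1) * a k \<omega>) * G k \<omega>)
        + 4 ^ q * ((S k \<omega> ^ (2*q - 2) * (a k \<omega>)\<^sup>2) * (G k \<omega>)\<^sup>2 + (a k \<omega> ^ (2*q)) * G k \<omega> ^ (2*q))"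
        using even_power_expansion[OF q, of "S k \<omega>" "a k \<omega> * G k \<omega>"] SS[OF k(1), of \<omega>]
        by (simp add: power_mult_distrib mult_ac)
    qed (intro all_moments_integrable all_moments_intros Sk ak Gk)
    also have "\<dots> = E + (2 * real q) * 0
        + 4 ^ q * (expectation (\<lambda>\<omega>. S k \<omega> ^ (2*q - 2) * (a k \<omega>)\<^sup>2) * expectation (\<lambda>\<omega>. (G k \<omega>)\<^sup>2)
          + expectation (\<lambda>\<omega>. a k \<omega> ^ (2*q)) * expectation (\<lambda>\<omega>. G k \<omega> ^ (2*q)))"
    proof -
      have "integrable M (\<lambda>\<omega>. S k \<omega> ^ (2*q))" "integrable M (\<lambda>\<omega>. (S k \<omega> ^ (2*q - 1) * a k \<omega>) * G k \<omega>)"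
        "integrable M (\<lambda>\<omega>. (S k \<omega> ^ (2*q - 2) * (a k \<omega>)\<^sup>2) * (G k \<omega>)\<^sup>2)"
        "integrable M (\<lambda>\<omega>. (a k \<omega> ^ (2*q)) * G k \<omega> ^ (2*q))"
        by (intro all_moments_integrable all_moments_intros Sk ak Gk)+
      then show ?thesis unfolding E_def
        by (simp only: Bochner_Integration.integral_add Bochner_Integration.integrable_add
            integrable_mult_right integral_mult_right_zero p1 p2 p3)
    qed
    also have "\<dots> \<le> E + 4 ^ q * ((E + A) * g + A * g)"
    proof -
      have "expectation (\<lambda>\<omega>. S k \<omega> ^ (2*q - 2) * (a k \<omega>)\<^sup>2) * expectation (\<lambda>\<omega>. (G k \<omega>)\<^sup>2) \<le> (E + A) * g"
        using Sa g(1)[OF k(1)] A(2) E0 by (intro mult_mono) (auto intro!: Bochner_Integration.integral_nonneg)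
      moreover have "expectation (\<lambda>\<omega>. a k \<omega> ^ (2*q)) * expectation (\<lambda>\<omega>. G k \<omega> ^ (2*q)) \<le> A * g"
        using A(1)[OF k(1)] g(2)[OF k(1)] A(2) by (intro mult_mono) (auto intro!: Bochner_Integration.integral_nonneg)
      ultimately show ?thesis by simp
    qed
    finally have "expectation (\<lambda>\<omega>. S (Suc k) \<omega> ^ (2*q)) + 2 * A \<le> (E + 2 * A) * (1 + 4 ^ q * g)"
      by (simp add: algebra_simps)
    also have "\<dots> \<le> (2 * A * (1 + 4 ^ q * g) ^ k) * (1 + 4 ^ q * g)"
      using Suc.IH k g(3) by (intro mult_right_mono) (auto simp: E_def)
    finally show ?case by (simp add: mult_ac)
  qed
  also have "2 * A * (1 + 4 ^ q * g) ^ k \<le> 2 * A * exp (4 ^ q * g) ^ k"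
    using A(2) g(3) by (intro mult_left_mono power_mono exp_ge_add_one_self) auto
  also have "exp (4 ^ q * g) ^ k = exp (4 ^ q * g * real k)"
    by (simp add: exp_of_nat_mult[symmetric] mult.commute)
  finally show ?thesis using S[OF k] A(2) by simp
qed

end

section \<open>The Ornstein-Uhlenbeck path as a functional of the Brownian path\<close>

text \<open>The integral term \<open>A\<close> solves a linear ordinary differential equation with integrating factor
  \<open>exp (\<kappa> t)\<close>, so that the function \<open>D\<close> below has derivative zero.\<close>
lemma linear_integral_equation_solution:
  fixes y w :: "real \<Rightarrow> real"
  assumes y: "continuous_on {0..T} y" and w: "continuous_on {0..T} w"
    and eq: "\<And>t. t \<in> {0..T} \<Longrightarrow> y t = y0 + \<nu> * w t + integral {0..t} (\<lambda>s. \<kappa> * (\<theta> - y s))"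
    and t: "t \<in> {0..T}"
  shows "y t = \<theta> + (y0 - \<theta>) * exp (- \<kappa> * t)
    + \<nu> * (w t - \<kappa> * integral {0..t} (\<lambda>s. exp (- \<kappa> * (t - s)) * w s))"
proof -
  define A where "A t = integral {0..t} (\<lambda>s. \<kappa> * (\<theta> - y s))" for t
  define H where "H t = integral {0..t} (\<lambda>s. exp (\<kappa> * s) * w s)" for t
  define D where "D t = exp (\<kappa> * t) * A t - (\<theta> - y0) * exp (\<kappa> * t) + \<kappa> * \<nu> * H t" for t
  have "(D has_real_derivative 0) (at t within {0..T})" if t: "t \<in> {0..T}" for t
  proof -
    have A: "(A has_real_derivative \<kappa> * (\<theta> - y t)) (at t within {0..T})"
      unfolding A_def using t by (intro integral_has_real_derivative continuous_intros y)
    have H: "(H has_real_derivative exp (\<kappa> * t) * w t) (at t within {0..T})"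
      unfolding H_def using t by (intro integral_has_real_derivative continuous_intros w)
    have yt: "y t = y0 + \<nu> * w t + A t" using eq[OF t] by (simp add: A_def)
    show ?thesis unfolding D_def
      by (rule derivative_eq_intros A H refl)+ (simp add: yt algebra_simps)
  qed
  then have "\<exists>c. \<forall>x\<in>{0..T}. D x = c"
    by (intro has_field_derivative_zero_constant) auto
  moreover have "0 \<in> {0..T}" using t by auto
  ultimately have "D t = D 0" using t by metis
  also have "\<dots> = - (\<theta> - y0)" by (simp add: D_def A_def H_def)
  finally have "exp (\<kappa> * t) * A t = (\<theta> - y0) * exp (\<kappa> * t) - \<kappa> * \<nu> * H t - (\<theta> - y0)"
    unfolding D_def by linarith
  then have At: "A t = (\<theta> - y0) - \<kappa> * \<nu> * (exp (- \<kappa> * t) * H t) - (\<theta> - y0) * exp (- \<kappa> * t)"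
  proof -
    define u v where "u = exp (\<kappa> * t)" and "v = exp (- \<kappa> * t)"
    have vu: "v * u = 1" by (simp add: u_def v_def exp_add[symmetric])
    have "A t = v * (u * A t)" using vu by (simp add: mult.assoc[symmetric])
    also have "u * A t = (\<theta> - y0) * u - \<kappa> * \<nu> * H t - (\<theta> - y0)"
      using \<open>exp (\<kappa> * t) * A t = _\<close> by (simp only: u_def)
    also have "v * \<dots> = (\<theta> - y0) * (v * u) - \<kappa> * \<nu> * (v * H t) - (\<theta> - y0) * v"
      by (simp add: algebra_simps)
    finally show ?thesis using vu by (simp add: v_def)
  qed
  have int: "integral {0..t} (\<lambda>s. exp (- \<kappa> * (t - s)) * w s) = exp (- \<kappa> * t) * H t"
  proof -
    have "exp (- \<kappa> * (t - s)) * w s = exp (- \<kappa> * t) * (exp (\<kappa> * s) * w s)" for s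
    proof -
      have "exp (- \<kappa> * (t - s)) = exp (- \<kappa> * t) * exp (\<kappa> * s)"
        by (subst exp_add[symmetric]) (simp add: algebra_simps)
      then show ?thesis by simp
    qed
    then have "integral {0..t} (\<lambda>s. exp (- \<kappa> * (t - s)) * w s)
        = integral {0..t} (\<lambda>s. exp (- \<kappa> * t) * (exp (\<kappa> * s) * w s))"
      by (intro integral_cong)
    then show ?thesis by (simp only: integral_mult_right H_def)
  qed
  have yt: "y t = y0 + \<nu> * w t + A t" using eq[OF t] by (simp add: A_def)
  show ?thesis unfolding int yt At by (simp add: algebra_simps)
qed

text \<open>Summation by parts turns the sum over increments of \<open>w\<close> into Riemann sums of \<open>w\<close> itself. The increments
  of the exponential are the constant fraction \<open>1 - exp (- \<kappa> t / n)\<close> of its values, and \<open>n\<close> times this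
  fraction tends to \<open>\<kappa> t\<close>.\<close>
lemma exponential_riemann_stieltjes_limit:
  fixes w :: "real \<Rightarrow> real"
  assumes t: "0 < t" and w: "continuous_on {0..t} w" and w0: "w 0 = 0"
  shows "(\<lambda>n. \<Sum>i<n. exp (- \<kappa> * (t - real i * (t / real n))) * (w (real (Suc i) * (t / real n)) - w (real i * (t / real n))))
    \<longlonglongrightarrow> w t - \<kappa> * integral {0..t} (\<lambda>s. exp (- \<kappa> * (t - s)) * w s)"
proof -
  define g where "g s = exp (- \<kappa> * (t - s)) * w s" for s
  define A where "A n = (\<Sum>i<n. g (0 + real i * ((t - 0) / real n))) / real n" for n
  have g: "continuous_on {0..t} g" unfolding g_def by (intro continuous_intros w)
  have "A \<longlonglongrightarrow> time_avg 0 t g"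
    unfolding A_def using riemann_sum_tendsto_time_avg[OF t g] .
  then have A: "A \<longlonglongrightarrow> integral {0..t} g / t" by (simp add: time_avg_def)
  define e where "e n = exp (- \<kappa> * (t / real n))" for n
  have e0: "(\<lambda>n. 1 - e n) \<longlonglongrightarrow> 0"
  proof -
    have "(\<lambda>n. 1 - exp (- \<kappa> * (t / real n))) \<longlonglongrightarrow> 1 - exp (- \<kappa> * 0)"
      by (intro tendsto_intros lim_const_over_n)
    then show ?thesis by (simp add: e_def)
  qed
  have ne: "(\<lambda>n. real n * (1 - e n)) \<longlonglongrightarrow> \<kappa> * t"
  proof (cases "\<kappa> = 0")
    case True then show ?thesis by (simp add: e_def)
  next
    case False
    have "((\<lambda>h. (exp (0 + h) - exp 0) / h) \<longlongrightarrow> exp (0::real)) (at 0)"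
      using DERIV_exp[of "0::real"] unfolding DERIV_def .
    moreover have "filterlim (\<lambda>n. - \<kappa> * (t / real n)) (at 0) sequentially"
      unfolding filterlim_at
    proof
      show "(\<lambda>n. - \<kappa> * (t / real n)) \<longlonglongrightarrow> 0"
        using tendsto_mult_right_zero[OF lim_const_over_n[of t], of "- \<kappa>"] by simp
      show "\<forall>\<^sub>F n in sequentially. - \<kappa> * (t / real n) \<in> UNIV \<and> - \<kappa> * (t / real n) \<noteq> 0"
        using eventually_gt_at_top[of 0] by eventually_elim (use False t in auto)
    qed
    ultimately have "(\<lambda>n. (exp (0 + - \<kappa> * (t / real n)) - exp 0) / (- \<kappa> * (t / real n))) \<longlonglongrightarrow> exp 0"
      by (rule filterlim_compose)
    from tendsto_mult_left[OF this, of "\<kappa> * t"]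
    have "(\<lambda>n. \<kappa> * t * ((exp (0 + - \<kappa> * (t / real n)) - exp 0) / (- \<kappa> * (t / real n)))) \<longlonglongrightarrow> \<kappa> * t" by simp
    then show ?thesis
    proof (rule Lim_transform_eventually)
      show "\<forall>\<^sub>F n in sequentially. \<kappa> * t * ((exp (0 + - \<kappa> * (t / real n)) - exp 0) / (- \<kappa> * (t / real n))) = real n * (1 - e n)"
        using eventually_gt_at_top[of 0]
      proof eventually_elim
        case (elim n)
        define c where "c = - \<kappa> * (t / real n)"
        have c: "c \<noteq> 0" "\<kappa> * t = - (c * real n)" using elim False t by (auto simp: c_def)
        show ?case unfolding e_def c_def[symmetric] c(2) using c(1) by (simp add: field_simps)
      qed
    qed
  qed
  have eq: "(\<Sum>i<n. exp (- \<kappa> * (t - real i * (t / real n))) * (w (real (Suc i) * (t / real n)) - w (real i * (t / real n))))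
      = w t - (real n * (1 - e n)) * A n - (1 - e n) * w t" if n: "n > 0" for n
  proof -
    define h where "h = t / real n"
    have nh: "real n * h = t" using n by (simp add: h_def)
    \<comment> \<open>the boundary term at zero vanishes because \<open>w 0 = 0\<close>\<close>
    have "(\<Sum>i<k. exp (- \<kappa> * (t - real i * h)) * (w (real (Suc i) * h) - w (real i * h)))
        = e n * (g (real k * h)) - (1 - e n) * (\<Sum>i<k. g (real i * h))" for k
    proof (induction k)
      case 0 show ?case using w0 by (simp add: g_def)
    next
      case (Suc k)
      have "exp (- \<kappa> * (t - real k * h)) = e n * exp (- \<kappa> * (t - real (Suc k) * h))"
        unfolding e_def h_def[symmetric] by (subst exp_add[symmetric]) (simp add: algebra_simps)
      then have "exp (- \<kappa> * (t - real k * h)) * (w (real (Suc k) * h) - w (real k * h)) = e n * g (real (Suc k) * h) - g (real k * h)"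
        by (simp add: g_def right_diff_distrib)
      then show ?case unfolding sum.lessThan_Suc Suc.IH by (simp only:) (simp add: algebra_simps)
    qed
    note sum_eq = this[of n]
    have An: "(\<Sum>i<n. g (real i * h)) = real n * A n" using n by (simp add: A_def h_def)
    have gn: "g (real n * h) = w t" by (simp add: nh g_def)
    show ?thesis unfolding h_def[symmetric] sum_eq An gn by (simp add: algebra_simps)
  qed
  have "(\<lambda>n. w t - (real n * (1 - e n)) * A n - (1 - e n) * w t) \<longlonglongrightarrow> w t - (\<kappa> * t) * (integral {0..t} g / t) - 0 * w t"
    by (intro tendsto_intros ne A e0)
  then have "(\<lambda>n. w t - (real n * (1 - e n)) * A n - (1 - e n) * w t) \<longlonglongrightarrow> w t - \<kappa> * integral {0..t} g"
    using t by simp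
  then show ?thesis unfolding g_def
    by (rule Lim_transform_eventually[OF _ eventually_mono[OF eventually_gt_at_top[of 0] eq[symmetric]]])
qed

section \<open>Moments and densities of the driving processes\<close>

lemma (in prob_space) moments_O_Un:
  assumes "moments_O I X c" "moments_O J X c"
  shows "moments_O (I \<union> J) X c"
proof (rule moments_OI)
  fix m :: nat
  obtain C where C: "C \<ge> 0" "\<And>i. i \<in> I \<Longrightarrow> abs_moment (X i) m \<le> ennreal (C * c i ^ m)"
    using moments_OE[OF assms(1)] by blast
  obtain D where D: "D \<ge> 0" "\<And>i. i \<in> J \<Longrightarrow> abs_moment (X i) m \<le> ennreal (D * c i ^ m)"
    using moments_OE[OF assms(2)] by blast
  have "abs_moment (X i) m \<le> ennreal ((C + D) * c i ^ m)" if i: "i \<in> I \<union> J" for i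
  proof -
    have "c i > 0" using i moments_OD2 assms by auto
    then have "C * c i ^ m \<le> (C + D) * c i ^ m" "D * c i ^ m \<le> (C + D) * c i ^ m"
      using C(1) D(1) by (auto intro!: mult_right_mono)
    then show ?thesis using i C(2)[of i] D(2)[of i] by (meson UnE ennreal_leI order_trans)
  qed
  then show "\<exists>C. \<forall>i\<in>I \<union> J. abs_moment (X i) m \<le> ennreal (C * c i ^ m)" by blast
qed (use moments_OD1[OF assms(1)] moments_OD1[OF assms(2)] moments_OD2[OF assms(1)] moments_OD2[OF assms(2)] in auto)

definition intervals :: "real \<Rightarrow> (real \<times> real) set" where
  "intervals T = {(a, b). 0 \<le> a \<and> a < b \<and> b \<le> T}"

abbreviation len :: "real \<times> real \<Rightarrow> real" where
  "len i \<equiv> snd i - fst i"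

definition pointed_intervals :: "real \<Rightarrow> ((real \<times> real) \<times> real) set" where
  "pointed_intervals T = (SIGMA i:intervals T. {fst i..snd i})"

text \<open>Time averages over \<open>[a, b]\<close> involve the increments over all \<open>[a, s]\<close>, including the empty one at
  \<open>s = a\<close>, where the rate would degenerate; measuring everything against the full length \<open>b - a\<close> avoids
  this.\<close>
lemma (in prob_space) moments_O_inside:
  assumes X: "moments_O (intervals T) (\<lambda>i. X (fst i) (snd i)) (\<lambda>i. c (len i))"
    and X0: "\<And>a \<omega>. X a a \<omega> = 0"
    and c: "\<And>x. 0 < x \<Longrightarrow> 0 < c x" "\<And>x y. 0 < x \<Longrightarrow> x \<le> y \<Longrightarrow> c x \<le> c y"
  shows "moments_O (pointed_intervals T) (\<lambda>(i, s). X (fst i) s) (\<lambda>(i, s). c (len i))"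
proof -
  let ?I = "{(i, s). i \<in> intervals T \<and> fst i < s \<and> s \<le> snd i}"
  let ?J = "{(i, s). i \<in> intervals T \<and> s = fst i}"
  have "moments_O ?I (\<lambda>j. X (fst (fst (fst j), snd j)) (snd (fst (fst j), snd j))) (\<lambda>j. c (snd (fst (fst j), snd j) - fst (fst (fst j), snd j)))"
    by (rule moments_O_reindex[OF X, of ?I "\<lambda>j. (fst (fst j), snd j)"]) (auto simp: intervals_def)
  then have "moments_O ?I (\<lambda>(i, s). X (fst i) s) (\<lambda>(i, s). c (s - fst i))"
    by (simp add: case_prod_unfold)
  then have 1: "moments_O ?I (\<lambda>(i, s). X (fst i) s) (\<lambda>(i, s). c (len i))"
    by (rule moments_O_rate[where K=1]) (auto simp: intervals_def intro!: c)
  have X00: "X a a = (\<lambda>_. 0)" for a by (intro ext X0)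
  have "moments_O ?J (\<lambda>i _. 0) (\<lambda>(i, s). c (len i))"
    by (rule moments_O_const[where K=1]) (auto simp: intervals_def intro!: c less_imp_le)
  then have 2: "moments_O ?J (\<lambda>(i, s). X (fst i) s) (\<lambda>(i, s). c (len i))"
    by (rule moments_O_cong_AE) (auto simp: X0 X00)
  have "pointed_intervals T = ?I \<union> ?J"
    by (auto simp: pointed_intervals_def intervals_def)
  then show ?thesis using moments_O_Un[OF 1 2] by simp
qed

locale brownian = prob_space M for M :: "'a measure" +
  fixes T :: real and W :: "real \<Rightarrow> 'a \<Rightarrow> real"
  assumes T: "T > 0" and bm: "standard_brownian_motion M T W"
begin

lemma W_measurable: "t \<in> {0..T} \<Longrightarrow> W t \<in> borel_measurable M"
  and W_continuous: "\<omega> \<in> space M \<Longrightarrow> continuous_on {0..T} (\<lambda>t. W t \<omega>)"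
  and W_start: "AE \<omega> in M. W 0 \<omega> = 0"
  and W_increment: "0 \<le> s \<Longrightarrow> s < t \<Longrightarrow> t \<le> T \<Longrightarrow>
    distributed M lborel (\<lambda>\<omega>. W t \<omega> - W s \<omega>) (normal_density 0 (sqrt (t - s)))"
  and W_indep: "0 \<le> \<tau> 0 \<Longrightarrow> (\<And>i. i < n \<Longrightarrow> \<tau> i \<le> \<tau> (Suc i)) \<Longrightarrow> \<tau> n \<le> T \<Longrightarrow>
    indep_vars (\<lambda>_. borel) (\<lambda>i \<omega>. W (\<tau> (Suc i)) \<omega> - W (\<tau> i) \<omega>) {..<n}"
  using bm unfolding standard_brownian_motion_def by blast+

lemma mesh_indep:
  assumes "0 \<le> h" "real n * h \<le> T"
  shows "indep_vars (\<lambda>_. borel) (\<lambda>i \<omega>. W (real (Suc i) * h) \<omega> - W (real i * h) \<omega>) {..<n}"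
  using assms by (intro W_indep[of "\<lambda>i. real i * h" n]) (auto intro!: mult_right_mono)

lemma mesh_distributed:
  assumes "0 < h" "real n * h \<le> T" "i < n"
  shows "distributed M lborel (\<lambda>\<omega>. W (real (Suc i) * h) \<omega> - W (real i * h) \<omega>) (normal_density 0 (sqrt h))"
proof -
  have "real (Suc i) * h \<le> real n * h" using assms by (intro mult_right_mono) auto
  then have "real (Suc i) * h \<le> T" by (rule order_trans[OF _ assms(2)])
  then show ?thesis using W_increment[of "real i * h" "real (Suc i) * h"] assms
    by (simp add: algebra_simps)
qed

lemma W_increment_moments:
  "moments_O (intervals T) (\<lambda>i \<omega>. W (snd i) \<omega> - W (fst i) \<omega>) (\<lambda>i. sqrt (len i))"
proof (rule moments_OI)
  fix m :: nat
  show "\<exists>C. \<forall>i\<in>intervals T. abs_moment (\<lambda>\<omega>. W (snd i) \<omega> - W (fst i) \<omega>) m \<le> ennreal (C * sqrt (len i) ^ m)"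
    using W_increment by (intro exI[of _ "gauss_moment m"] ballI eq_refl normal_abs_moment)
      (auto simp: intervals_def)
qed (use W_measurable in \<open>auto simp: intervals_def\<close>)

lemma W_inside_moments:
  "moments_O (pointed_intervals T) (\<lambda>(i, s) \<omega>. W s \<omega> - W (fst i) \<omega>) (\<lambda>(i, s). sqrt (len i))"
  using moments_O_inside[of T "\<lambda>a s \<omega>. W s \<omega> - W a \<omega>" sqrt] W_increment_moments by simp

end

locale ornstein_uhlenbeck = brownian M T W for M :: "'a measure" and T W +
  fixes Y :: "real \<Rightarrow> 'a \<Rightarrow> real" and \<nu> \<kappa> \<theta> y0 :: real
  assumes nu: "\<nu> > 0" and ou: "OU_solution M T \<nu> \<kappa> \<theta> y0 W Y"
begin

lemma Y_measurable: "t \<in> {0..T} \<Longrightarrow> Y t \<in> borel_measurable M"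
  and Y_continuous: "\<omega> \<in> space M \<Longrightarrow> continuous_on {0..T} (\<lambda>t. Y t \<omega>)"
  using ou unfolding OU_solution_def by blast+

lemma Y_equation:
  "AE \<omega> in M. \<forall>t\<in>{0..T}. Y t \<omega> = y0 + \<nu> * W t \<omega> + integral {0..t} (\<lambda>s. \<kappa> * (\<theta> - Y s \<omega>))"
proof -
  have "AE \<omega> in M. \<forall>t\<in>{0..T}. Y t \<omega> = y0 + \<nu> * W t \<omega> + (LBINT s=0..t. \<kappa> * (\<theta> - Y s \<omega>))"
    using ou unfolding OU_solution_def by blast
  then show ?thesis using AE_space
  proof eventually_elim
    case (elim \<omega>)
    show ?case
    proof
      fix t assume t: "t \<in> {0..T}"
      have "(LBINT s=0..t. \<kappa> * (\<theta> - Y s \<omega>)) = integral {0..t} (\<lambda>s. \<kappa> * (\<theta> - Y s \<omega>))"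
      proof (cases "t = 0")
        case False
        have "continuous_on {0..t} (\<lambda>s. \<kappa> * (\<theta> - Y s \<omega>))"
          using t by (intro continuous_intros continuous_on_subset[OF Y_continuous[OF elim(2)]]) auto
        from LBINT_eq_time_avg[OF _ this] show ?thesis
          using False t by (simp add: time_avg_def zero_ereal_def)
      qed (simp add: zero_ereal_def)
      with elim(1) t show "Y t \<omega> = y0 + \<nu> * W t \<omega> + integral {0..t} (\<lambda>s. \<kappa> * (\<theta> - Y s \<omega>))" by simp
    qed
  qed
qed

text \<open>A Riemann-Stieltjes sum for the Wiener integral of \<open>exp (- \<kappa> (t - s))\<close>. It is a sum of independent
  Gaussian variables whose weights lie between two positive constants.\<close>
definition gauss_sum :: "real \<Rightarrow> nat \<Rightarrow> 'a \<Rightarrow> real" where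
  "gauss_sum t n \<omega> = (\<Sum>i<n. exp (- \<kappa> * (t - real i * (t / real n))) *
     (W (real (Suc i) * (t / real n)) \<omega> - W (real i * (t / real n)) \<omega>))"

definition Y_approx :: "real \<Rightarrow> nat \<Rightarrow> 'a \<Rightarrow> real" where
  "Y_approx t n \<omega> = \<theta> + (y0 - \<theta>) * exp (- \<kappa> * t) + \<nu> * gauss_sum t n \<omega>"

lemma mesh_le: assumes "t \<in> {0..T}" "i \<le> n" shows "real i * (t / real n) \<in> {0..T}"
proof -
  have "real i * (t / real n) \<le> real n * (t / real n)" using assms by (intro mult_right_mono) auto
  also have "\<dots> \<le> t" using assms by simp
  finally show ?thesis using assms by auto
qed

lemma gauss_sum_measurable: "t \<in> {0..T} \<Longrightarrow> gauss_sum t n \<in> borel_measurable M"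
  unfolding gauss_sum_def
  by (intro borel_measurable_sum borel_measurable_times borel_measurable_const borel_measurable_diff W_measurable mesh_le) auto

lemma Y_approx_measurable: "t \<in> {0..T} \<Longrightarrow> Y_approx t n \<in> borel_measurable M"
  unfolding Y_approx_def using gauss_sum_measurable by auto

lemma Y_approx_tendsto:
  "AE \<omega> in M. \<forall>t\<in>{0..T}. (\<lambda>n. Y_approx t n \<omega>) \<longlonglongrightarrow> Y t \<omega>"
  using Y_equation W_start AE_space
proof eventually_elim
  case (elim \<omega>)
  note Y = linear_integral_equation_solution[OF Y_continuous[OF elim(3)] W_continuous[OF elim(3)]]
  show ?case
  proof
    fix t assume t: "t \<in> {0..T}"
    have Yt: "Y t \<omega> = \<theta> + (y0 - \<theta>) * exp (- \<kappa> * t)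
        + \<nu> * (W t \<omega> - \<kappa> * integral {0..t} (\<lambda>s. exp (- \<kappa> * (t - s)) * W s \<omega>))"
      using elim(1) by (intro Y t) auto
    have "(\<lambda>n. gauss_sum t n \<omega>) \<longlonglongrightarrow> W t \<omega> - \<kappa> * integral {0..t} (\<lambda>s. exp (- \<kappa> * (t - s)) * W s \<omega>)"
    proof (cases "t = 0")
      case True then show ?thesis using elim(2) by (simp add: gauss_sum_def)
    next
      case False
      then show ?thesis unfolding gauss_sum_def using t elim(2)
        by (intro exponential_riemann_stieltjes_limit continuous_on_subset[OF W_continuous[OF elim(3)]]) auto
    qed
    then show "(\<lambda>n. Y_approx t n \<omega>) \<longlonglongrightarrow> Y t \<omega>"
      unfolding Y_approx_def Yt by (intro tendsto_intros)
  qed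
qed

lemma exp_bounds:
  assumes "0 \<le> s" "s \<le> T"
  shows "exp (- \<bar>\<kappa>\<bar> * T) \<le> exp (- \<kappa> * s)" "exp (- \<kappa> * s) \<le> exp (\<bar>\<kappa>\<bar> * T)"
proof -
  have "\<bar>\<kappa> * s\<bar> \<le> \<bar>\<kappa>\<bar> * T" using assms by (simp add: abs_mult mult_left_mono)
  then show "exp (- \<bar>\<kappa>\<bar> * T) \<le> exp (- \<kappa> * s)" "exp (- \<kappa> * s) \<le> exp (\<bar>\<kappa>\<bar> * T)" by auto
qed

lemma gauss_weight_bounds:
  assumes "t \<in> {0..T}" "i < n"
  shows "exp (- \<bar>\<kappa>\<bar> * T) \<le> exp (- \<kappa> * (t - real i * (t / real n)))"
    and "exp (- \<kappa> * (t - real i * (t / real n))) \<le> exp (\<bar>\<kappa>\<bar> * T)"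
proof -
  have "real i * (t / real n) \<le> real n * (t / real n)" using assms by (intro mult_right_mono) auto
  then have "real i * (t / real n) \<le> t" using assms by simp
  moreover have "0 \<le> real i * (t / real n)" using assms by simp
  ultimately have "0 \<le> t - real i * (t / real n)" "t - real i * (t / real n) \<le> T" using assms by auto
  from exp_bounds[OF this] show "exp (- \<bar>\<kappa>\<bar> * T) \<le> exp (- \<kappa> * (t - real i * (t / real n)))"
    "exp (- \<kappa> * (t - real i * (t / real n))) \<le> exp (\<bar>\<kappa>\<bar> * T)" by auto
qed

lemma Y_approx_moments:
  "moments_O ({0..T} \<times> UNIV) (\<lambda>(t, n). Y_approx t n) (\<lambda>(t, n). 1)"
proof -
  define L where "L = sqrt T * exp (\<bar>\<kappa>\<bar> * T)"
  have L: "L > 0" using T by (simp add: L_def)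
  have gs: "moments_O ({0..T} \<times> UNIV) (\<lambda>j. gauss_sum (fst j) (snd j)) (\<lambda>j. L)"
  proof (rule moments_OI)
    fix m :: nat
    have "abs_moment (gauss_sum t n) m \<le> ennreal (gauss_moment m * L ^ m)" if t: "t \<in> {0..T}" for t n
    proof (cases "t = 0 \<or> n = 0")
      case True
      then have "gauss_sum t n = (\<lambda>_. 0)" by (auto simp: gauss_sum_def)
      then show ?thesis using L gauss_moment_nonneg[of m] by (cases m) (auto simp: gauss_moment_0 emeasure_space_1)
    next
      case False
      then have h: "0 < t / real n" "real n * (t / real n) \<le> T" using t by auto
      define d where "d i = exp (- \<kappa> * (t - real i * (t / real n)))" for i
      have "abs_moment (gauss_sum t n) m
          \<le> ennreal (gauss_moment m * (sqrt (t / real n) * sqrt (\<Sum>i<n. (d i)\<^sup>2)) ^ m)"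
        unfolding gauss_sum_def d_def[symmetric] using h
        by (intro weighted_gaussian_sum_moment mesh_indep mesh_distributed[OF h]) auto
      also have "\<dots> \<le> ennreal (gauss_moment m * L ^ m)"
      proof (intro ennreal_leI mult_left_mono power_mono gauss_moment_nonneg)
        have "(\<Sum>i<n. (d i)\<^sup>2) \<le> (\<Sum>i<n. (exp (\<bar>\<kappa>\<bar> * T))\<^sup>2)"
          unfolding d_def using gauss_weight_bounds(2)[OF t] by (intro sum_mono power_mono) auto
        then have "sqrt (\<Sum>i<n. (d i)\<^sup>2) \<le> sqrt (real n * (exp (\<bar>\<kappa>\<bar> * T))\<^sup>2)"
          by (intro real_sqrt_le_mono) simp
        then have "sqrt (t / real n) * sqrt (\<Sum>i<n. (d i)\<^sup>2) \<le> sqrt (t / real n) * (sqrt (real n) * exp (\<bar>\<kappa>\<bar> * T))"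
          using t by (intro mult_left_mono) (auto simp: real_sqrt_mult)
        also have "\<dots> = sqrt t * exp (\<bar>\<kappa>\<bar> * T)" using False by (simp add: real_sqrt_divide)
        also have "\<dots> \<le> L" unfolding L_def using t by (intro mult_right_mono) auto
        finally show "sqrt (t / real n) * sqrt (\<Sum>i<n. (d i)\<^sup>2) \<le> L" .
        show "0 \<le> sqrt (t / real n) * sqrt (\<Sum>i<n. (d i)\<^sup>2)" using t by (simp add: sum_nonneg)
      qed
      finally show ?thesis .
    qed
    then show "\<exists>C. \<forall>j\<in>{0..T} \<times> UNIV. abs_moment (gauss_sum (fst j) (snd j)) m \<le> ennreal (C * L ^ m)"
      by (intro exI[of _ "gauss_moment m"]) auto
  qed (use gauss_sum_measurable L in auto)
  have gs1: "moments_O ({0..T} \<times> UNIV) (\<lambda>j \<omega>. \<nu> * gauss_sum (fst j) (snd j) \<omega>) (\<lambda>j. 1)"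
    by (intro moments_O_cmult moments_O_rate[OF gs, of _ L]) auto
  have "\<bar>\<theta> + (y0 - \<theta>) * exp (- \<kappa> * t)\<bar> \<le> (\<bar>\<theta>\<bar> + \<bar>y0 - \<theta>\<bar> * exp (\<bar>\<kappa>\<bar> * T)) * 1" if "t \<in> {0..T}" for t
  proof -
    have "\<bar>(y0 - \<theta>) * exp (- \<kappa> * t)\<bar> \<le> \<bar>y0 - \<theta>\<bar> * exp (\<bar>\<kappa>\<bar> * T)"
      using exp_bounds(2)[of t] that unfolding abs_mult by (intro mult_left_mono) auto
    then show ?thesis using abs_triangle_ineq[of "\<theta>" "(y0 - \<theta>) * exp (- \<kappa> * t)"] by simp
  qed
  then have "moments_O ({0..T} \<times> (UNIV :: nat set)) (\<lambda>j _. \<theta> + (y0 - \<theta>) * exp (- \<kappa> * fst j)) (\<lambda>j. 1)"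
    by (intro moments_O_const[where K="\<bar>\<theta>\<bar> + \<bar>y0 - \<theta>\<bar> * exp (\<bar>\<kappa>\<bar> * T)"]) auto
  from moments_O_add[OF this gs1] show ?thesis
    by (simp add: Y_approx_def[abs_def] case_prod_unfold)
qed

text \<open>The Gaussian approximations have bounded moments, and these pass to the limit.\<close>
lemma Y_moments: "moments_O {0..T} Y (\<lambda>_. 1)"
proof (rule moments_O_limit[of _ Y_approx])
  show "AE \<omega> in M. (\<lambda>n. Y_approx t n \<omega>) \<longlonglongrightarrow> Y t \<omega>" if "t \<in> {0..T}" for t
    using Y_approx_tendsto by eventually_elim (use that in auto)
qed (use Y_approx_moments Y_measurable in auto)

text \<open>The approximations of \<open>Y\<^sub>t\<close> are Gaussian with standard deviation at least
  \<open>\<nu> exp (- \<bar>\<kappa>\<bar> T) sqrt t\<close>, hence have a density bounded by the inverse of this number. Fatou's lemma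
  transfers the resulting bound for continuous test functions to \<open>Y\<^sub>t\<close>.\<close>
lemma Y_density_bound:
  fixes g :: "real \<Rightarrow> real"
  assumes t: "0 < t" "t \<le> T" and g: "continuous_on UNIV g" "\<And>x. 0 \<le> g x"
  shows "(\<integral>\<^sup>+\<omega>. ennreal (g (Y t \<omega>)) \<partial>M)
    \<le> ennreal (exp (\<bar>\<kappa>\<bar> * T) / (\<nu> * sqrt t)) * (\<integral>\<^sup>+x. ennreal (g x) \<partial>lborel)"
proof -
  have tT: "t \<in> {0..T}" using t by auto
  have gm[measurable]: "g \<in> borel_measurable borel" using g(1) by (rule borel_measurable_continuous_onI)
  note [measurable] = Y_approx_measurable[OF tT] Y_measurable[OF tT]
  let ?K = "exp (\<bar>\<kappa>\<bar> * T) / (\<nu> * sqrt t)"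
  have approx: "(\<integral>\<^sup>+\<omega>. ennreal (g (Y_approx t n \<omega>)) \<partial>M) \<le> ennreal ?K * (\<integral>\<^sup>+x. ennreal (g x) \<partial>lborel)" if n: "n > 0" for n
  proof -
    have h: "0 < t / real n" "real n * (t / real n) \<le> T" using t n by auto
    define d where "d i = exp (- \<kappa> * (t - real i * (t / real n)))" for i
    define s where "s = sqrt (t / real n) * sqrt (\<Sum>i<n. (d i)\<^sup>2)"
    have "(\<Sum>i<n. (exp (- \<bar>\<kappa>\<bar> * T))\<^sup>2) \<le> (\<Sum>i<n. (d i)\<^sup>2)"
      unfolding d_def using gauss_weight_bounds(1)[OF tT] by (intro sum_mono power_mono) auto
    then have "sqrt (real n * (exp (- \<bar>\<kappa>\<bar> * T))\<^sup>2) \<le> sqrt (\<Sum>i<n. (d i)\<^sup>2)"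
      by (intro real_sqrt_le_mono) simp
    then have "sqrt (t / real n) * (sqrt (real n) * exp (- \<bar>\<kappa>\<bar> * T)) \<le> s"
      unfolding s_def using t by (intro mult_left_mono) (auto simp: real_sqrt_mult)
    moreover have "sqrt (t / real n) * (sqrt (real n) * exp (- \<bar>\<kappa>\<bar> * T)) = sqrt t * exp (- \<bar>\<kappa>\<bar> * T)"
      using n by (simp add: real_sqrt_divide)
    ultimately have s: "sqrt t * exp (- \<bar>\<kappa>\<bar> * T) \<le> s" by (simp only:)
    then have s0: "s > 0" using t by (smt (verit) exp_gt_zero mult_pos_pos real_sqrt_gt_zero)
    have "distributed M lborel (gauss_sum t n) (normal_density 0 s)"
      unfolding gauss_sum_def[abs_def] d_def[symmetric] s_def using h n
      by (intro weighted_gaussian_sum_distributed mesh_indep mesh_distributed) (auto simp: d_def)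
    from normal_density_affine[OF this s0, of \<nu> "\<theta> + (y0 - \<theta>) * exp (- \<kappa> * t)"]
    have D: "distributed M lborel (Y_approx t n) (normal_density (\<theta> + (y0 - \<theta>) * exp (- \<kappa> * t)) (\<nu> * s))"
      using nu by (simp add: Y_approx_def[abs_def])
    have dens: "normal_density \<mu> (\<nu> * s) x \<le> ?K" for \<mu> x
    proof -
      have "normal_density \<mu> (\<nu> * s) x \<le> 1 / sqrt (2 * pi * (\<nu> * s)\<^sup>2)"
        unfolding normal_density_def by (simp add: divide_right_mono)
      also have "\<dots> = 1 / (sqrt (2 * pi) * (\<nu> * s))"
        using nu s0 by (simp add: real_sqrt_mult)
      also have "\<dots> \<le> 1 / (1 * (\<nu> * s))"
      proof (intro divide_left_mono mult_right_mono)
        show "1 \<le> sqrt (2 * pi)" using pi_gt3 by simp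
      qed (use nu s0 in auto)
      also have "\<dots> \<le> 1 / (\<nu> * (sqrt t * exp (- \<bar>\<kappa>\<bar> * T)))"
        using s nu t s0 by (intro divide_left_mono) auto
      also have "\<dots> = ?K" by (simp add: exp_minus field_simps)
      finally show ?thesis .
    qed
    have "(\<integral>\<^sup>+\<omega>. ennreal (g (Y_approx t n \<omega>)) \<partial>M)
        = (\<integral>\<^sup>+x. ennreal (normal_density (\<theta> + (y0 - \<theta>) * exp (- \<kappa> * t)) (\<nu> * s) x) * ennreal (g x) \<partial>lborel)"
      by (rule distributed_nn_integral[OF D, symmetric]) auto
    also have "\<dots> \<le> (\<integral>\<^sup>+x. ennreal ?K * ennreal (g x) \<partial>lborel)"
      by (intro nn_integral_mono mult_right_mono ennreal_leI dens) auto
    also have "\<dots> = ennreal ?K * (\<integral>\<^sup>+x. ennreal (g x) \<partial>lborel)"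
      by (intro nn_integral_cmult) auto
    finally show ?thesis .
  qed
  have "(\<integral>\<^sup>+\<omega>. ennreal (g (Y t \<omega>)) \<partial>M) = (\<integral>\<^sup>+\<omega>. liminf (\<lambda>n. ennreal (g (Y_approx t (Suc n) \<omega>))) \<partial>M)"
  proof (rule nn_integral_cong_AE)
    show "AE \<omega> in M. ennreal (g (Y t \<omega>)) = liminf (\<lambda>n. ennreal (g (Y_approx t (Suc n) \<omega>)))"
      using Y_approx_tendsto
    proof eventually_elim
      case (elim \<omega>)
      have "(\<lambda>n. Y_approx t (Suc n) \<omega>) \<longlonglongrightarrow> Y t \<omega>" using elim tT by (intro LIMSEQ_Suc) auto
      then have "(\<lambda>n. g (Y_approx t (Suc n) \<omega>)) \<longlonglongrightarrow> g (Y t \<omega>)"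
        by (intro continuous_on_tendsto_compose[OF g(1)]) auto
      then show ?case by (intro lim_imp_Liminf[symmetric] tendsto_ennrealI) auto
    qed
  qed
  also have "\<dots> \<le> liminf (\<lambda>n. \<integral>\<^sup>+\<omega>. ennreal (g (Y_approx t (Suc n) \<omega>)) \<partial>M)"
    by (intro nn_integral_liminf) auto
  also have "\<dots> \<le> liminf (\<lambda>n. ennreal ?K * (\<integral>\<^sup>+x. ennreal (g x) \<partial>lborel))"
    by (intro Liminf_mono always_eventually allI approx) simp
  also have "\<dots> = ennreal ?K * (\<integral>\<^sup>+x. ennreal (g x) \<partial>lborel)" by (intro lim_imp_Liminf) auto
  finally show ?thesis .
qed

text \<open>Almost surely this is \<open>\<integral> \<kappa> (\<theta> - Y) ds\<close> over \<open>[a, s]\<close>, the part of the increment of \<open>Y\<close> that is of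
  the order of the length of the interval.\<close>
definition resid :: "real \<Rightarrow> real \<Rightarrow> 'a \<Rightarrow> real" where
  "resid a s \<omega> = Y s \<omega> - Y a \<omega> - \<nu> * (W s \<omega> - W a \<omega>)"

abbreviation W_mean :: "real \<times> real \<Rightarrow> 'a \<Rightarrow> real" where
  "W_mean i \<omega> \<equiv> time_avg (fst i) (snd i) (\<lambda>s. W s \<omega> - W (fst i) \<omega>)"

abbreviation resid_mean :: "real \<times> real \<Rightarrow> 'a \<Rightarrow> real" where
  "resid_mean i \<omega> \<equiv> time_avg (fst i) (snd i) (\<lambda>s. resid (fst i) s \<omega>)"

abbreviation Y_mean :: "nat \<Rightarrow> real \<times> real \<Rightarrow> 'a \<Rightarrow> real" where
  "Y_mean k i \<omega> \<equiv> time_avg (fst i) (snd i) (\<lambda>s. (Y s \<omega> - Y (fst i) \<omega>) ^ k)"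

lemma Y_pointed_moments: "moments_O (pointed_intervals T) (\<lambda>j. Y (snd j)) (\<lambda>j. 1)"
  using moments_O_reindex[OF Y_moments, of "pointed_intervals T" snd]
  by (auto simp: pointed_intervals_def intervals_def)

lemma resid_inside_moments:
  "moments_O (pointed_intervals T) (\<lambda>(i, s). resid (fst i) s) (\<lambda>(i, s). len i)"
proof (rule moments_O_inside[of T resid "\<lambda>x. x"])
  have "moments_O (pointed_intervals T) (\<lambda>j \<omega>. \<kappa> * \<theta>) (\<lambda>j. 1)"
    by (intro moments_O_const[where K="\<bar>\<kappa> * \<theta>\<bar>"]) auto
  from moments_O_add[OF this moments_O_cmult[OF Y_pointed_moments, of "- \<kappa>"]]
  have "moments_O (pointed_intervals T) (\<lambda>j \<omega>. \<kappa> * \<theta> + (- \<kappa>) * Y (snd j) \<omega>) (\<lambda>j. 1)" .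
  then have "moments_O (SIGMA i:intervals T. {fst i..snd i}) (\<lambda>(i, s) \<omega>. \<kappa> * \<theta> + (- \<kappa>) * Y s \<omega>) (\<lambda>(i, s). 1)"
    by (simp add: pointed_intervals_def case_prod_unfold)
  then have "moments_O (intervals T) (\<lambda>i \<omega>. time_avg (fst i) (snd i) (\<lambda>s. \<kappa> * \<theta> + (- \<kappa>) * Y s \<omega>)) (\<lambda>i. 1)"
  proof (rule moments_O_time_avg)
    fix i \<omega> assume "i \<in> intervals T" "\<omega> \<in> space M"
    then show "continuous_on {fst i..snd i} (\<lambda>s. \<kappa> * \<theta> + (- \<kappa>) * Y s \<omega>)"
      by (intro continuous_intros continuous_on_subset[OF Y_continuous]) (auto simp: intervals_def)
  qed (auto simp: intervals_def)
  moreover have "moments_O (intervals T) (\<lambda>i \<omega>. len i) len"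
    by (intro moments_O_const[where K=1]) (auto simp: intervals_def)
  ultimately have "moments_O (intervals T)
      (\<lambda>i \<omega>. (len i) * time_avg (fst i) (snd i) (\<lambda>s. \<kappa> * \<theta> + (- \<kappa>) * Y s \<omega>)) len"
    using moments_O_mult by fastforce
  then show "moments_O (intervals T) (\<lambda>i. resid (fst i) (snd i)) len"
  proof (rule moments_O_cong_AE)
    fix i assume i: "i \<in> intervals T"
    then have ab: "0 \<le> fst i" "fst i < snd i" "snd i \<le> T" by (auto simp: intervals_def)
    show "resid (fst i) (snd i) \<in> borel_measurable M"
      unfolding resid_def using ab Y_measurable W_measurable by auto
    show "AE \<omega> in M. resid (fst i) (snd i) \<omega> = (len i) * time_avg (fst i) (snd i) (\<lambda>s. \<kappa> * \<theta> + (- \<kappa>) * Y s \<omega>)"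
      using Y_equation AE_space
    proof eventually_elim
      case (elim \<omega>)
      let ?f = "\<lambda>s. \<kappa> * (\<theta> - Y s \<omega>)"
      have "?f integrable_on {0..snd i}"
        using ab by (intro integrable_continuous_real continuous_intros continuous_on_subset[OF Y_continuous[OF elim(2)]]) auto
      then have "integral {0..fst i} ?f + integral {fst i..snd i} ?f = integral {0..snd i} ?f"
        using ab by (intro Henstock_Kurzweil_Integration.integral_combine) auto
      moreover have "Y (fst i) \<omega> = y0 + \<nu> * W (fst i) \<omega> + integral {0..fst i} ?f"
        "Y (snd i) \<omega> = y0 + \<nu> * W (snd i) \<omega> + integral {0..snd i} ?f"
        using elim(1) ab by auto
      ultimately have "resid (fst i) (snd i) \<omega> = integral {fst i..snd i} ?f"
        by (simp add: resid_def algebra_simps)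
      moreover have "?f = (\<lambda>s. \<kappa> * \<theta> + (- \<kappa>) * Y s \<omega>)" by (simp add: algebra_simps)
      ultimately show ?case using ab by (simp add: time_avg_def)
    qed
  qed
qed (auto simp: resid_def)

lemma Y_inside_moments:
  "moments_O (pointed_intervals T) (\<lambda>(i, s) \<omega>. Y s \<omega> - Y (fst i) \<omega>) (\<lambda>(i, s). sqrt (len i))"
proof -
  have "moments_O (pointed_intervals T) (\<lambda>j. resid (fst (fst j)) (snd j)) (\<lambda>j. sqrt (len (fst j)))"
  proof (rule moments_O_rate)
    show "moments_O (pointed_intervals T) (\<lambda>j. resid (fst (fst j)) (snd j)) (\<lambda>j. len (fst j))"
      using resid_inside_moments by (simp add: case_prod_unfold)
    fix j assume "j \<in> pointed_intervals T"
    then have j: "0 < len (fst j)" "len (fst j) \<le> T"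
      by (auto simp: pointed_intervals_def intervals_def)
    then show "0 < sqrt (len (fst j))" by simp
    have "len (fst j) = sqrt (len (fst j)) * sqrt (len (fst j))" using j by simp
    also have "\<dots> \<le> sqrt T * sqrt (len (fst j))" using j by (intro mult_right_mono) auto
    finally show "len (fst j) \<le> sqrt T * sqrt (len (fst j))" .
  qed
  moreover have "moments_O (pointed_intervals T) (\<lambda>j \<omega>. \<nu> * (W (snd j) \<omega> - W (fst (fst j)) \<omega>)) (\<lambda>j. sqrt (len (fst j)))"
    using moments_O_cmult[OF W_inside_moments, of \<nu>] by (simp add: case_prod_unfold)
  ultimately have "moments_O (pointed_intervals T) (\<lambda>j \<omega>. resid (fst (fst j)) (snd j) \<omega> + \<nu> * (W (snd j) \<omega> - W (fst (fst j)) \<omega>)) (\<lambda>j. sqrt (len (fst j)))"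
    by (rule moments_O_add)
  then show ?thesis by (simp add: case_prod_unfold resid_def)
qed

end

section \<open>Time-discretisation of the drift\<close>

text \<open>In both models \<open>h\<close> is a polynomial of degree at most four.\<close>
definition quartic :: "(nat \<Rightarrow> real) \<Rightarrow> real \<Rightarrow> real" where
  "quartic c y = c 0 + c 1 * y + c 2 * y ^ 2 + c 3 * y ^ 3 + c 4 * y ^ 4"

definition quartic_deriv :: "(nat \<Rightarrow> real) \<Rightarrow> real \<Rightarrow> real" where
  "quartic_deriv c y = c 1 + 2 * c 2 * y + 3 * c 3 * y ^ 2 + 4 * c 4 * y ^ 3"

lemma quartic_taylor:
  "quartic c y = quartic c a + quartic_deriv c a * (y - a)
     + (y - a)\<^sup>2 * (c 2 + 3 * c 3 * a + 6 * c 4 * a ^ 2 + (c 3 + 4 * c 4 * a) * (y - a) + c 4 * (y - a) ^ 2)"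
  unfolding quartic_def quartic_deriv_def by (simp add: power2_eq_square power3_eq_cube power4_eq_xxxx algebra_simps)

text \<open>Taylor's formula in which the linear term only carries the noise \<open>\<nu> w\<close>; the rest is linear in the drift
  part of \<open>y - a\<close> or quadratic in \<open>y - a\<close>, and both have the rate of the step size.\<close>
lemma quartic_taylor_noise:
  "quartic c y - quartic c a - \<nu> * quartic_deriv c a * w = quartic_deriv c a * (y - a - \<nu> * w)
     + (c 2 + 3 * c 3 * a + 6 * c 4 * a ^ 2 + (c 3 + 4 * c 4 * a) * (y - a) + c 4 * (y - a) ^ 2) * (y - a)\<^sup>2"
proof -
  define d q where "d = y - a" and "q = quartic_deriv c a"
  show ?thesis unfolding quartic_taylor[of c y a] d_def[symmetric] q_def[symmetric] by (simp add: algebra_simps)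
qed

lemma quartic_continuous [continuous_intros]:
  "continuous_on A f \<Longrightarrow> continuous_on A (\<lambda>x. quartic c (f x))"
  unfolding quartic_def by (intro continuous_intros)

lemma quartic_deriv_continuous: "continuous_on UNIV (quartic_deriv c)"
  unfolding quartic_deriv_def[abs_def] by (intro continuous_intros)

lemma quartic_measurable [measurable]: "quartic c \<in> borel_measurable borel"
  by (intro borel_measurable_continuous_onI quartic_continuous continuous_on_id)

lemma quartic_deriv_measurable [measurable]: "quartic_deriv c \<in> borel_measurable borel"
  by (intro borel_measurable_continuous_onI quartic_deriv_continuous)

context prob_space
begin

lemma bounded_moments_mult:
  "moments_O I X (\<lambda>_. 1) \<Longrightarrow> moments_O I Y c \<Longrightarrow> moments_O I (\<lambda>i \<omega>. X i \<omega> * Y i \<omega>) c"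
  using moments_O_mult[of I X "\<lambda>_. 1" Y c] by simp

lemma bounded_moments_power:
  "moments_O I X (\<lambda>_. 1) \<Longrightarrow> moments_O I (\<lambda>i \<omega>. X i \<omega> ^ n) (\<lambda>_. 1)"
  using moments_O_power[of I X "\<lambda>_. 1" n] by simp

lemma bounded_moments_const: "moments_O I (\<lambda>_ _. k) (\<lambda>_. 1)"
  by (intro moments_O_const[where K="\<bar>k\<bar>"]) auto

lemma moments_O_even:
  assumes X: "\<And>i. i \<in> I \<Longrightarrow> X i \<in> borel_measurable M" and c: "\<And>i. i \<in> I \<Longrightarrow> 0 < c i"
    and bound: "\<And>q::nat. 1 \<le> q \<Longrightarrow> \<exists>C. \<forall>i\<in>I. (\<integral>\<^sup>+\<omega>. ennreal (X i \<omega> ^ (2 * q)) \<partial>M) \<le> ennreal (C * c i ^ (2 * q))"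
  shows "moments_O I X c"
proof (rule moments_O_of_square[OF moments_OI X c])
  fix m :: nat
  show "\<exists>C. \<forall>i\<in>I. abs_moment (\<lambda>\<omega>. (X i \<omega>)\<^sup>2) m \<le> ennreal (C * (c i)\<^sup>2 ^ m)"
  proof (cases "m = 0")
    case True then show ?thesis by (intro exI[of _ 1]) (simp add: emeasure_space_1)
  next
    case False then show ?thesis using bound[of m] by (simp add: power_mult)
  qed
next
  show "0 < (c i)\<^sup>2" if "i \<in> I" for i using c[OF that] by simp
qed (use X in auto)

end

lemma grid_simps: "grid T N 0 = 0" "grid T N (Suc l) - grid T N l = T / real N"
  by (simp_all add: grid_def algebra_simps add_divide_distrib)

lemma grid_interval:
  assumes "0 < T" "l < N" shows "(grid T N l, grid T N (Suc l)) \<in> intervals T"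
proof -
  have "real (Suc l) * (T / real N) \<le> real N * (T / real N)" using assms by (intro mult_right_mono) auto
  then have "real (Suc l) * (T / real N) \<le> T" using assms by simp
  then show ?thesis using assms by (auto simp: intervals_def grid_def intro!: divide_strict_right_mono mult_strict_right_mono)
qed

lemma grid_range:
  assumes "0 < T" "l \<le> N" shows "grid T N l \<in> {0..T}"
proof (cases "N = 0")
  case True then show ?thesis using assms by (simp add: grid_def)
next
  case False
  have "real l * (T / real N) \<le> real N * (T / real N)" using assms by (intro mult_right_mono) auto
  then show ?thesis using assms False by (simp add: grid_def)
qed

context ornstein_uhlenbeck
begin

lemma drift_remainder_moments:
  "moments_O (intervals T) (\<lambda>i \<omega>. time_avg (fst i) (snd i) (\<lambda>s. quartic c (Y s \<omega>)) - quartic c (Y (fst i) \<omega>)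
      - \<nu> * quartic_deriv c (Y (fst i) \<omega>) * W_mean i \<omega>)
    len"
proof -
  define Z where "Z i s \<omega> = quartic c (Y s \<omega>) - quartic c (Y (fst i) \<omega>)
      - \<nu> * quartic_deriv c (Y (fst i) \<omega>) * (W s \<omega> - W (fst i) \<omega>)" for i :: "real \<times> real" and s \<omega>
  let ?P = "pointed_intervals T"
  have a: "moments_O ?P (\<lambda>j. Y (fst (fst j))) (\<lambda>_. 1)"
    using moments_O_reindex[OF Y_moments, of ?P "\<lambda>j. fst (fst j)"]
    by (auto simp: pointed_intervals_def intervals_def)
  have D: "moments_O ?P (\<lambda>j \<omega>. Y (snd j) \<omega> - Y (fst (fst j)) \<omega>) (\<lambda>j. sqrt (len (fst j)))"
    using Y_inside_moments by (simp add: case_prod_unfold)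
  have D1: "moments_O ?P (\<lambda>j \<omega>. Y (snd j) \<omega> - Y (fst (fst j)) \<omega>) (\<lambda>_. 1)"
    by (rule moments_O_rate[OF D, where K="sqrt T"]) (auto simp: pointed_intervals_def intervals_def)
  have D2: "moments_O ?P (\<lambda>j \<omega>. (Y (snd j) \<omega> - Y (fst (fst j)) \<omega>)\<^sup>2) (\<lambda>j. len (fst j))"
    by (rule moments_O_rate[OF moments_O_power[OF D], where K=1]) (auto simp: pointed_intervals_def intervals_def)
  have R: "moments_O ?P (\<lambda>j. resid (fst (fst j)) (snd j)) (\<lambda>j. len (fst j))"
    using resid_inside_moments by (simp add: case_prod_unfold)
  have "moments_O ?P (\<lambda>j \<omega>. quartic_deriv c (Y (fst (fst j)) \<omega>) * resid (fst (fst j)) (snd j) \<omega>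
      + (c 2 + 3 * c 3 * Y (fst (fst j)) \<omega> + 6 * c 4 * Y (fst (fst j)) \<omega> ^ 2
          + (c 3 + 4 * c 4 * Y (fst (fst j)) \<omega>) * (Y (snd j) \<omega> - Y (fst (fst j)) \<omega>)
          + c 4 * (Y (snd j) \<omega> - Y (fst (fst j)) \<omega>) ^ 2) * (Y (snd j) \<omega> - Y (fst (fst j)) \<omega>)\<^sup>2)
      (\<lambda>j. len (fst j))"
    unfolding quartic_deriv_def
    by (rule moments_O_add; rule bounded_moments_mult[OF _ R] bounded_moments_mult[OF _ D2];
        intro moments_O_add bounded_moments_mult bounded_moments_power bounded_moments_const a D1)
  then have "moments_O ?P (\<lambda>j. Z (fst j) (snd j)) (\<lambda>j. len (fst j))"
  proof (rule moments_O_cong_AE)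
    fix j assume "j \<in> ?P"
    then have j: "fst (fst j) \<in> {0..T}" "snd j \<in> {0..T}" by (auto simp: pointed_intervals_def intervals_def)
    note [measurable] = Y_measurable[OF j(1)] Y_measurable[OF j(2)] W_measurable[OF j(1)] W_measurable[OF j(2)]
    show "Z (fst j) (snd j) \<in> borel_measurable M" unfolding Z_def by measurable
    show "AE \<omega> in M. Z (fst j) (snd j) \<omega> = quartic_deriv c (Y (fst (fst j)) \<omega>) * resid (fst (fst j)) (snd j) \<omega>
      + (c 2 + 3 * c 3 * Y (fst (fst j)) \<omega> + 6 * c 4 * Y (fst (fst j)) \<omega> ^ 2
          + (c 3 + 4 * c 4 * Y (fst (fst j)) \<omega>) * (Y (snd j) \<omega> - Y (fst (fst j)) \<omega>)
          + c 4 * (Y (snd j) \<omega> - Y (fst (fst j)) \<omega>) ^ 2) * (Y (snd j) \<omega> - Y (fst (fst j)) \<omega>)\<^sup>2"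
      unfolding Z_def resid_def by (intro AE_I2 quartic_taylor_noise)
  qed
  then have "moments_O (SIGMA i:intervals T. {fst i..snd i}) (\<lambda>(i, s). Z i s) (\<lambda>(i, s). len i)"
    by (simp add: pointed_intervals_def case_prod_unfold)
  then have "moments_O (intervals T) (\<lambda>i \<omega>. time_avg (fst i) (snd i) (\<lambda>s. Z i s \<omega>)) len"
  proof (rule moments_O_time_avg)
    fix i \<omega> assume "i \<in> intervals T" "\<omega> \<in> space M"
    then show "continuous_on {fst i..snd i} (\<lambda>s. Z i s \<omega>)" unfolding Z_def
      by (intro continuous_intros continuous_on_subset[OF Y_continuous] continuous_on_subset[OF W_continuous])
        (auto simp: intervals_def)
  qed (auto simp: intervals_def)
  then show ?thesis
  proof (rule moments_O_cong_AE)
    fix i assume i: "i \<in> intervals T"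
    then have ab: "fst i < snd i" "{fst i..snd i} \<subseteq> {0..T}" by (auto simp: intervals_def)
    have m: "Y (fst i) \<in> borel_measurable M" using ab by (intro Y_measurable) auto
    have m1: "(\<lambda>\<omega>. time_avg (fst i) (snd i) (\<lambda>s. quartic c (Y s \<omega>))) \<in> borel_measurable M"
      using ab by (intro time_avg_measurable continuous_intros continuous_on_subset[OF Y_continuous]
          measurable_compose[OF Y_measurable quartic_measurable]) auto
    have m2: "(\<lambda>\<omega>. W_mean i \<omega>) \<in> borel_measurable M"
      using ab by (intro time_avg_measurable continuous_intros continuous_on_subset[OF W_continuous]
          borel_measurable_diff W_measurable) auto
    show "(\<lambda>\<omega>. time_avg (fst i) (snd i) (\<lambda>s. quartic c (Y s \<omega>)) - quartic c (Y (fst i) \<omega>)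
      - \<nu> * quartic_deriv c (Y (fst i) \<omega>) * W_mean i \<omega>) \<in> borel_measurable M"
      using m m1 m2 by measurable
    show "AE \<omega> in M. time_avg (fst i) (snd i) (\<lambda>s. quartic c (Y s \<omega>)) - quartic c (Y (fst i) \<omega>)
      - \<nu> * quartic_deriv c (Y (fst i) \<omega>) * W_mean i \<omega>
      = time_avg (fst i) (snd i) (\<lambda>s. Z i s \<omega>)"
    proof (rule AE_I2)
      fix \<omega> assume \<omega>: "\<omega> \<in> space M"
      have cY: "continuous_on {fst i..snd i} (\<lambda>s. quartic c (Y s \<omega>))"
        using ab by (intro continuous_intros continuous_on_subset[OF Y_continuous[OF \<omega>]])
      have cW: "continuous_on {fst i..snd i} (\<lambda>s. W s \<omega> - W (fst i) \<omega>)"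
        using ab by (intro continuous_intros continuous_on_subset[OF W_continuous[OF \<omega>]])
      have "time_avg (fst i) (snd i) (\<lambda>s. Z i s \<omega>) = time_avg (fst i) (snd i)
          (\<lambda>s. quartic c (Y s \<omega>) + ((- quartic c (Y (fst i) \<omega>))
             + (- (\<nu> * quartic_deriv c (Y (fst i) \<omega>))) * (W s \<omega> - W (fst i) \<omega>)))"
        unfolding Z_def by (intro time_avg_cong) simp
      also have "\<dots> = time_avg (fst i) (snd i) (\<lambda>s. quartic c (Y s \<omega>)) + ((- quartic c (Y (fst i) \<omega>))
          + (- (\<nu> * quartic_deriv c (Y (fst i) \<omega>))) * W_mean i \<omega>)"
        using ab(1) by (simp only: time_avg_add time_avg_cmult time_avg_const cY cW continuous_intros)
      finally show "time_avg (fst i) (snd i) (\<lambda>s. quartic c (Y s \<omega>)) - quartic c (Y (fst i) \<omega>)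
        - \<nu> * quartic_deriv c (Y (fst i) \<omega>) * W_mean i \<omega>
        = time_avg (fst i) (snd i) (\<lambda>s. Z i s \<omega>)" by simp
    qed
  qed
qed

section \<open>The martingale part of the drift error\<close>

text \<open>
  The \<open>N\<close> steps of the grid are divided into \<open>n\<close> parts each. \<open>mesh_Y\<close>, \<open>mesh_mean\<close> and \<open>mesh_sum\<close> are
  functions of the vector of the mesh increments: approximations of \<open>Y\<close> at the grid points, of the mean of
  \<open>W\<close> minus its left value over a step, and of the martingale transform. In this form the
  independence of a step from its past is a property of finitely many independent increments.
\<close>
definition mesh_increment :: "nat \<Rightarrow> nat \<Rightarrow> nat \<Rightarrow> 'a \<Rightarrow> real" where
  "mesh_increment N n i \<omega> = W (real (Suc i) * (T / (real N * real n))) \<omega> - W (real i * (T / (real N * real n))) \<omega>"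

abbreviation mesh_path :: "nat \<Rightarrow> nat \<Rightarrow> 'a \<Rightarrow> nat \<Rightarrow> real" where
  "mesh_path N n \<omega> \<equiv> \<lambda>i. mesh_increment N n i \<omega>"

definition mesh_Y :: "nat \<Rightarrow> nat \<Rightarrow> nat \<Rightarrow> (nat \<Rightarrow> real) \<Rightarrow> real" where
  "mesh_Y N n l v = \<theta> + (y0 - \<theta>) * exp (- \<kappa> * grid T N l)
     + \<nu> * (\<Sum>i<l * n. exp (- \<kappa> * (grid T N l - real i * (T / (real N * real n)))) * v i)"

definition mesh_mean :: "nat \<Rightarrow> nat \<Rightarrow> (nat \<Rightarrow> real) \<Rightarrow> real" where
  "mesh_mean n l v = (\<Sum>j<n. \<Sum>i<j. v (l * n + i)) / real n"

definition mesh_sum :: "(nat \<Rightarrow> real) \<Rightarrow> nat \<Rightarrow> nat \<Rightarrow> nat \<Rightarrow> (nat \<Rightarrow> real) \<Rightarrow> real" where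
  "mesh_sum c N n k v = (\<Sum>l<k. quartic_deriv c (mesh_Y N n l v) * mesh_mean n l v)"

lemma mesh_Y_eq:
  assumes "N > 0" "n > 0"
  shows "mesh_Y N n l (mesh_path N n \<omega>) = Y_approx (grid T N l) (l * n) \<omega>"
proof (cases "l = 0")
  \<comment> \<open>both sums are empty; this case is separate because the mesh width of \<open>Y_approx\<close> is then a division by zero\<close>
  case True then show ?thesis by (simp add: mesh_Y_def Y_approx_def gauss_sum_def)
next
  case False
  have "grid T N l / real (l * n) = T / (real N * real n)" using False by (simp add: grid_def)
  then show ?thesis by (simp add: mesh_Y_def Y_approx_def gauss_sum_def mesh_increment_def)
qed

lemma mesh_mean_eq:
  assumes "N > 0" "n > 0"
  shows "mesh_mean n l (mesh_path N n \<omega>) =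
    (\<Sum>j<n. W (grid T N l + real j * ((grid T N (Suc l) - grid T N l) / real n)) \<omega> - W (grid T N l) \<omega>) / real n"
proof -
  define h where "h = T / (real N * real n)"
  have g: "grid T N l = real (l * n) * h" using assms by (simp add: grid_def h_def)
  have step: "(grid T N (Suc l) - grid T N l) / real n = h" unfolding grid_simps by (simp add: h_def)
  have "(\<Sum>i<j. mesh_increment N n (l * n + i) \<omega>) = W (real (l * n + j) * h) \<omega> - W (real (l * n) * h) \<omega>" for j
    by (induction j) (simp_all add: mesh_increment_def h_def)
  then have "(\<Sum>i<j. mesh_increment N n (l * n + i) \<omega>) = W (grid T N l + real j * h) \<omega> - W (grid T N l) \<omega>" for j
    unfolding g by (simp add: algebra_simps)
  then show ?thesis by (simp only: mesh_mean_def step)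
qed

lemma mesh_in_pointed_intervals:
  assumes "l < N" "j < n"
  shows "((grid T N l, grid T N (Suc l)), grid T N l + real j * ((grid T N (Suc l) - grid T N l) / real n)) \<in> pointed_intervals T"
proof -
  have i: "(grid T N l, grid T N (Suc l)) \<in> intervals T" using T assms by (intro grid_interval) auto
  let ?d = "grid T N (Suc l) - grid T N l"
  have d: "0 < ?d" using i by (simp add: intervals_def)
  have "real j * (?d / real n) \<le> real n * (?d / real n)" using d assms by (intro mult_right_mono) auto
  also have "\<dots> = ?d" using assms by simp
  finally show ?thesis using i d by (simp add: pointed_intervals_def)
qed

lemma mesh_mean_moments:
  "moments_O {(N, n, l). 0 < n \<and> l < N} (\<lambda>(N, n, l) \<omega>. mesh_mean n l (mesh_path N n \<omega>)) (\<lambda>(N, n, l). sqrt (T / real N))"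
proof -
  let ?I = "{(N, n, l). 0 < n \<and> l < N} :: (nat \<times> nat \<times> nat) set"
  define u where "u N n l j = grid T N l + real j * ((grid T N (Suc l) - grid T N l) / real n)" for N n l j :: nat
  define f where "f = (\<lambda>((N, n, l), j). ((grid T N l, grid T N (Suc l)), u N n l j))"
  have "moments_O (SIGMA i:?I. {..<fst (snd i)}) (\<lambda>j. (\<lambda>(i, s) \<omega>. W s \<omega> - W (fst i) \<omega>) (f j)) (\<lambda>j. (\<lambda>(i, s). sqrt (len i)) (f j))"
    by (rule moments_O_reindex[OF W_inside_moments]) (auto simp: f_def u_def intro!: mesh_in_pointed_intervals simp del: times_divide_eq_right)
  then have "moments_O (SIGMA i:?I. {..<fst (snd i)}) (\<lambda>(i, j). (\<lambda>(N, n, l) \<omega>. W (u N n l j) \<omega> - W (grid T N l) \<omega>) i) (\<lambda>(i, j). (\<lambda>(N, n, l). sqrt (T / real N)) i)"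
    by (simp add: f_def case_prod_unfold grid_simps)
  from moments_O_mean[OF this]
  have mean: "moments_O ?I (\<lambda>i \<omega>. (\<Sum>j<fst (snd i). (\<lambda>(N, n, l) \<omega>. W (u N n l j) \<omega> - W (grid T N l) \<omega>) i \<omega>) / real (fst (snd i))) (\<lambda>(N, n, l). sqrt (T / real N))"
    by auto
  have m: "(\<lambda>\<omega>. (\<Sum>j<n. W (u N n l j) \<omega> - W (grid T N l) \<omega>) / real n) \<in> borel_measurable M" if "l < N" for N n l
  proof -
    have "u N n l j \<in> {0..T}" "grid T N l \<in> {0..T}" if "j < n" for j
      using mesh_in_pointed_intervals[OF \<open>l < N\<close> that] by (auto simp: pointed_intervals_def intervals_def u_def)
    then show ?thesis
      by (intro borel_measurable_divide borel_measurable_sum borel_measurable_diff W_measurable borel_measurable_const) auto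
  qed
  show ?thesis
  proof (rule moments_O_cong_AE[OF mean])
    fix i assume "i \<in> ?I"
    then obtain N n l where i: "i = (N, n, l)" "0 < n" "l < N" by auto
    have eq: "mesh_mean n l (mesh_path N n \<omega>) = (\<Sum>j<n. W (u N n l j) \<omega> - W (grid T N l) \<omega>) / real n" for \<omega>
      using mesh_mean_eq[of N n l \<omega>] i unfolding u_def by simp
    show "(case i of (N, n, l) \<Rightarrow> \<lambda>\<omega>. mesh_mean n l (mesh_path N n \<omega>)) \<in> borel_measurable M"
      using m[OF i(3), of n] by (simp add: i eq)
    show "AE \<omega> in M. (case i of (N, n, l) \<Rightarrow> \<lambda>\<omega>. mesh_mean n l (mesh_path N n \<omega>)) \<omega>
      = (\<Sum>j<fst (snd i). (\<lambda>(N, n, l) \<omega>. W (u N n l j) \<omega> - W (grid T N l) \<omega>) i \<omega>) / real (fst (snd i))"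
      by (simp add: i eq)
  qed
qed

lemma mesh_increments:
  assumes "0 < n" "0 < N"
  shows "indep_vars (\<lambda>_. borel) (mesh_increment N n) {..<N * n}"
    and "i < N * n \<Longrightarrow> distributed M lborel (mesh_increment N n i) (normal_density 0 (sqrt (T / (real N * real n))))"
proof -
  have h: "0 < T / (real N * real n)" "real (N * n) * (T / (real N * real n)) \<le> T" using assms T by auto
  show "indep_vars (\<lambda>_. borel) (mesh_increment N n) {..<N * n}"
    using mesh_indep[OF less_imp_le[OF h(1)] h(2)] by (simp add: mesh_increment_def[abs_def])
  show "distributed M lborel (mesh_increment N n i) (normal_density 0 (sqrt (T / (real N * real n))))" if "i < N * n"
    using mesh_distributed[OF h that] by (simp add: mesh_increment_def[abs_def])
qed

text \<open>The pair on the left depends on the first \<open>k * n\<close> mesh increments, the mean on the right on the next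
  \<open>n\<close> ones.\<close>
lemma mesh_sum_indep:
  assumes n: "0 < n" and k: "k < N" and f: "f \<in> borel_measurable (borel \<Otimes>\<^sub>M borel)"
  shows "indep_var borel (\<lambda>\<omega>. f (mesh_sum c N n k (mesh_path N n \<omega>),
      quartic_deriv c (mesh_Y N n k (mesh_path N n \<omega>))) :: real)
    borel (\<lambda>\<omega>. mesh_mean n k (mesh_path N n \<omega>))"
proof -
  let ?A = "{..<k * n}" and ?B = "{k * n..<Suc k * n}"
  have le: "l * n + n \<le> k * n" if "l < k" for l
    using mult_le_mono1[of "Suc l" k n] that by simp
  have N: "k * n + n \<le> N * n" using mult_le_mono1[of "Suc k" N n] k by simp
  have ind: "indep_var (PiM ?A (\<lambda>_. borel)) (\<lambda>\<omega>. restrict (mesh_path N n \<omega>) ?A)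
      (PiM ?B (\<lambda>_. borel)) (\<lambda>\<omega>. restrict (mesh_path N n \<omega>) ?B)"
    using N n k by (intro indep_var_restrict[OF mesh_increments(1)]) auto
  have lt: "i < k * n" if "i < l * n" "l \<le> k" for i l
    by (rule less_le_trans[OF that(1) mult_le_mono1[OF that(2)]])
  have mY: "mesh_Y N n l \<in> borel_measurable (PiM ?A (\<lambda>_. borel))" if "l \<le> k" for l
    unfolding mesh_Y_def using lt that
    by (intro borel_measurable_add borel_measurable_times borel_measurable_const borel_measurable_sum
        measurable_component_singleton) auto
  have mG: "mesh_mean n l \<in> borel_measurable (PiM ?A (\<lambda>_. borel))" if "l < k" for l
    unfolding mesh_mean_def using le[OF that]
    by (intro borel_measurable_divide borel_measurable_const borel_measurable_sum measurable_component_singleton) auto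
  have mGk: "mesh_mean n k \<in> borel_measurable (PiM ?B (\<lambda>_. borel))"
    unfolding mesh_mean_def
    by (intro borel_measurable_divide borel_measurable_const borel_measurable_sum measurable_component_singleton) auto
  have mS: "mesh_sum c N n k \<in> borel_measurable (PiM ?A (\<lambda>_. borel))"
    unfolding mesh_sum_def
    by (intro borel_measurable_sum borel_measurable_times measurable_compose[OF mY quartic_deriv_measurable] mG) auto
  have mf: "(\<lambda>v. f (mesh_sum c N n k v, quartic_deriv c (mesh_Y N n k v))) \<in> borel_measurable (PiM ?A (\<lambda>_. borel))"
    by (intro measurable_compose[OF measurable_Pair f] mS measurable_compose[OF mY quartic_deriv_measurable]) auto
  have rY: "mesh_Y N n l (restrict v ?A) = mesh_Y N n l v" if "l \<le> k" for l v
    unfolding mesh_Y_def using that by (auto intro!: sum.cong dest: lt)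
  have rG: "mesh_mean n l (restrict v ?A) = mesh_mean n l v" if "l < k" for l v
    unfolding mesh_mean_def using le[OF that] by (auto intro!: sum.cong arg_cong2[where f="(/)"])
  have rGk: "mesh_mean n k (restrict v ?B) = mesh_mean n k v" for v
    unfolding mesh_mean_def by (auto intro!: sum.cong arg_cong2[where f="(/)"])
  have rS: "mesh_sum c N n k (restrict v ?A) = mesh_sum c N n k v" for v
    unfolding mesh_sum_def by (auto intro!: sum.cong simp: rY rG)
  show ?thesis
    using indep_var_compose[OF ind mf mGk] by (simp add: comp_def rS rY rGk del: mult_Suc)
qed

lemma mesh_mean_expectation:
  assumes "0 < n" "l < N"
  shows "expectation (\<lambda>\<omega>. mesh_mean n l (mesh_path N n \<omega>)) = 0"
proof -
  have in_range: "l * n + i < N * n" if "i < n" for i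
    using mult_le_mono1[of "Suc l" N n] assms that by simp
  have D: "distributed M lborel (mesh_increment N n (l * n + i)) (normal_density 0 (sqrt (T / (real N * real n))))" if "i < n" for i
    using assms in_range[OF that] by (intro mesh_increments) auto
  have pos: "0 < sqrt (T / (real N * real n))" using T assms by simp
  have int: "integrable M (mesh_increment N n (l * n + i))" if "i < n" for i
  proof (rule integrableI_bounded)
    show "mesh_increment N n (l * n + i) \<in> borel_measurable M" using distributed_measurable[OF D[OF that]] by simp
    show "(\<integral>\<^sup>+ \<omega>. ennreal (norm (mesh_increment N n (l * n + i) \<omega>)) \<partial>M) < \<infinity>"
      using normal_abs_moment[OF D[OF that] pos, of 1] by simp
  qed
  have "expectation (\<lambda>\<omega>. \<Sum>j<n. \<Sum>i<j. mesh_increment N n (l * n + i) \<omega>) = (\<Sum>j<n. \<Sum>i<j. expectation (mesh_increment N n (l * n + i)))"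
    using int by (subst Bochner_Integration.integral_sum; (intro Bochner_Integration.integrable_sum sum.cong refl Bochner_Integration.integral_sum)?) auto
  also have "\<dots> = 0" using normal_mean_zero[OF D pos] by (intro sum.neutral ballI) auto
  finally show ?thesis by (simp add: mesh_mean_def)
qed

lemma quartic_deriv_moments:
  "moments_O I X (\<lambda>_. 1) \<Longrightarrow> moments_O I (\<lambda>i \<omega>. quartic_deriv c (X i \<omega>)) (\<lambda>_. 1)"
  unfolding quartic_deriv_def
  by (intro moments_O_add bounded_moments_mult bounded_moments_power bounded_moments_const)

text \<open>The means \<open>mesh_mean\<close> are centred with variance of the order of the step \<open>T / N\<close>, and there are at most
  \<open>N\<close> steps: the Gronwall bound does not depend on \<open>N\<close> or on the refinement \<open>n\<close>.\<close>
lemma mesh_sum_moments: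
  "moments_O {(N, n, k). 0 < n \<and> 0 < N \<and> k \<le> N} (\<lambda>(N, n, k) \<omega>. mesh_sum c N n k (mesh_path N n \<omega>)) (\<lambda>_. 1)"
proof (rule moments_O_even)
  let ?I = "{(N, n, k). 0 < n \<and> 0 < N \<and> k \<le> N} :: (nat \<times> nat \<times> nat) set"
  have "moments_O ?I (\<lambda>j. (\<lambda>(t, n). Y_approx t n) ((\<lambda>(N, n, l). (grid T N l, l * n)) j)) (\<lambda>j. (\<lambda>(t, n). 1) ((\<lambda>(N, n, l). (grid T N l, l * n)) j))"
    by (rule moments_O_reindex[OF Y_approx_moments]) (use grid_range[OF T] in auto)
  then have Ya: "moments_O ?I (\<lambda>(N, n, l). Y_approx (grid T N l) (l * n)) (\<lambda>_. 1)"
    by (simp add: case_prod_unfold)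
  have "moments_O ?I (\<lambda>j \<omega>. quartic_deriv c ((\<lambda>(N, n, l). Y_approx (grid T N l) (l * n)) j \<omega>)) (\<lambda>_. 1)"
    by (rule quartic_deriv_moments[OF Ya])
  then have am: "moments_O ?I (\<lambda>j \<omega>. (\<lambda>(N, n, l). quartic_deriv c (mesh_Y N n l (mesh_path N n \<omega>))) j) (\<lambda>_. 1)"
    by (rule moments_O_cong_AE) (use moments_OD1[OF Ya] in \<open>auto simp: mesh_Y_eq case_prod_unfold\<close>)
  note Gm = mesh_mean_moments
  have am1: "all_moments (\<lambda>\<omega>. quartic_deriv c (mesh_Y N n l (mesh_path N n \<omega>)))" if "0 < n" "0 < N" "l \<le> N" for N n l
    using moments_O_reindex[OF am, of "UNIV :: unit set" "\<lambda>_. (N, n, l)"] that by simp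
  have Gm1: "all_moments (\<lambda>\<omega>. mesh_mean n l (mesh_path N n \<omega>))" if "0 < n" "l < N" for N n l
  proof (rule moments_O_rate)
    show "moments_O (UNIV :: unit set) (\<lambda>_ \<omega>. mesh_mean n l (mesh_path N n \<omega>)) (\<lambda>_. sqrt (T / real N))"
      using moments_O_reindex[OF Gm, of "UNIV :: unit set" "\<lambda>_. (N, n, l)"] that by simp
  qed auto
  have main: "all_moments (\<lambda>\<omega>. mesh_sum c N n k (mesh_path N n \<omega>)) \<and>
      expectation (\<lambda>\<omega>. mesh_sum c N n k (mesh_path N n \<omega>) ^ (2 * q)) \<le> 2 * A * exp (4 ^ q * g * real k)"
    if n: "0 < n" "k \<le> N" "1 \<le> q"
      and A: "\<And>l. l < N \<Longrightarrow> abs_moment (\<lambda>\<omega>. quartic_deriv c (mesh_Y N n l (mesh_path N n \<omega>))) (2*q) \<le> ennreal A" "0 \<le> A"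
      and g: "\<And>l. l < N \<Longrightarrow> abs_moment (\<lambda>\<omega>. mesh_mean n l (mesh_path N n \<omega>)) 2 \<le> ennreal g"
        "\<And>l. l < N \<Longrightarrow> abs_moment (\<lambda>\<omega>. mesh_mean n l (mesh_path N n \<omega>)) (2*q) \<le> ennreal g" "0 \<le> g"
    for N n k q A g
  proof -
    have ex: "expectation (\<lambda>\<omega>. X \<omega> ^ (2 * r)) \<le> K"
      if "all_moments X" "abs_moment X (2 * r) \<le> ennreal K" "0 \<le> K" for X r K
    proof -
      have "integrable M (\<lambda>\<omega>. X \<omega> ^ (2 * r))" using that(1) by (intro all_moments_integrable all_moments_power)
      then have "ennreal (expectation (\<lambda>\<omega>. X \<omega> ^ (2 * r))) = (\<integral>\<^sup>+\<omega>. ennreal (X \<omega> ^ (2 * r)) \<partial>M)"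
        by (intro nn_integral_eq_integral[symmetric]) auto
      also have "\<dots> \<le> ennreal K" using that(2) by (simp add: power_even_abs)
      finally show ?thesis using that(3) by (simp add: ennreal_le_iff)
    qed
    show ?thesis
    proof (rule martingale_transform_even_moment[where N=N and a="\<lambda>l \<omega>. quartic_deriv c (mesh_Y N n l (mesh_path N n \<omega>))"
          and G="\<lambda>l \<omega>. mesh_mean n l (mesh_path N n \<omega>)", OF \<open>1 \<le> q\<close>])
      show "expectation (\<lambda>\<omega>. quartic_deriv c (mesh_Y N n l (mesh_path N n \<omega>)) ^ (2 * q)) \<le> A" if "l < N" for l
        using that n by (intro ex am1 A) auto
      show "expectation (\<lambda>\<omega>. (mesh_mean n l (mesh_path N n \<omega>))\<^sup>2) \<le> g" if "l < N" for l
        using ex[OF Gm1[of n l N], of 1 g] that n g by simp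
      show "expectation (\<lambda>\<omega>. mesh_mean n l (mesh_path N n \<omega>) ^ (2 * q)) \<le> g" if "l < N" for l
        using that n by (intro ex Gm1 g) auto
    qed (use n A(2) g(3) am1 Gm1 mesh_mean_expectation mesh_sum_indep in \<open>auto simp: mesh_sum_def\<close>)
  qed
  show "(case i of (N, n, k) \<Rightarrow> \<lambda>\<omega>. mesh_sum c N n k (mesh_path N n \<omega>)) \<in> borel_measurable M" if iI: "i \<in> ?I" for i
  proof -
    obtain N n k where i: "i = (N, n, k)" "0 < n" "0 < N" "k \<le> N" using iI by auto
    have "(\<lambda>\<omega>. quartic_deriv c (mesh_Y N n l (mesh_path N n \<omega>))) \<in> borel_measurable M" if "l < N" for l
      using moments_OD1[OF am1[of n N l], of "()"] i that by simp
    moreover have "(\<lambda>\<omega>. mesh_mean n l (mesh_path N n \<omega>)) \<in> borel_measurable M" if "l < N" for l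
      using moments_OD1[OF Gm1[of n l N], of "()"] i that by simp
    ultimately show ?thesis using i unfolding mesh_sum_def by (auto intro!: borel_measurable_sum borel_measurable_times)
  qed
  fix q :: nat assume q: "1 \<le> q"
  obtain A where A: "A \<ge> 0" "\<And>i. i \<in> ?I \<Longrightarrow> abs_moment (\<lambda>\<omega>. (\<lambda>(N, n, l). quartic_deriv c (mesh_Y N n l (mesh_path N n \<omega>))) i) (2*q) \<le> ennreal (A * 1 ^ (2*q))"
    using moments_OE[OF am] by blast
  obtain G1 where G1: "G1 \<ge> 0" "\<And>i. i \<in> {(N, n, l). 0 < n \<and> l < N} \<Longrightarrow>
      abs_moment (\<lambda>\<omega>. (\<lambda>(N, n, l) \<omega>. mesh_mean n l (mesh_path N n \<omega>)) i \<omega>) 2 \<le> ennreal (G1 * (\<lambda>(N, n, l). sqrt (T / real N)) i ^ 2)"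
    using moments_OE[OF Gm] by blast
  obtain G2 where G2: "G2 \<ge> 0" "\<And>i. i \<in> {(N, n, l). 0 < n \<and> l < N} \<Longrightarrow>
      abs_moment (\<lambda>\<omega>. (\<lambda>(N, n, l) \<omega>. mesh_mean n l (mesh_path N n \<omega>)) i \<omega>) (2*q) \<le> ennreal (G2 * (\<lambda>(N, n, l). sqrt (T / real N)) i ^ (2*q))"
    using moments_OE[OF Gm] by blast
  \<comment> \<open>bounds the second and the \<open>2 q\<close>-th moment of a step mean, both divided by the step size\<close>
  define g where "g = G1 + G2 * T ^ (q - 1)"
  have g: "g \<ge> 0" using G1 G2 T by (simp add: g_def)
  have bound: "(\<integral>\<^sup>+\<omega>. ennreal (mesh_sum c N n k (mesh_path N n \<omega>) ^ (2 * q)) \<partial>M) \<le> ennreal (2 * A * exp (4 ^ q * g * T))"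
    if i: "0 < n" "0 < N" "k \<le> N" for N n k
  proof -
    define d where "d = T / real N"
    have d: "0 < d" "d \<le> T" "real N * d = T" using T i by (auto simp: d_def field_simps)
    have "d ^ q \<le> T ^ (q - 1) * d"
    proof -
      have "d ^ q = d ^ (q - 1) * d" using q by (cases q) auto
      also have "\<dots> \<le> T ^ (q - 1) * d" using d by (intro mult_right_mono power_mono) auto
      finally show ?thesis .
    qed
    then have g12: "G1 * d \<le> g * d" "G2 * d ^ q \<le> g * d"
    proof -
      show "G1 * d \<le> g * d" using d G2 T by (intro mult_right_mono) (auto simp: g_def)
      have "G2 * d ^ q \<le> (G2 * T ^ (q - 1)) * d"
        using \<open>d ^ q \<le> T ^ (q - 1) * d\<close> G2(1) by (simp add: mult.assoc mult_left_mono)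
      also have "\<dots> \<le> g * d" using d G1 by (intro mult_right_mono) (auto simp: g_def)
      finally show "G2 * d ^ q \<le> g * d" .
    qed
    have res: "all_moments (\<lambda>\<omega>. mesh_sum c N n k (mesh_path N n \<omega>)) \<and>
      expectation (\<lambda>\<omega>. mesh_sum c N n k (mesh_path N n \<omega>) ^ (2 * q)) \<le> 2 * A * exp (4 ^ q * (g * d) * real k)"
    proof (rule main)
      show "abs_moment (\<lambda>\<omega>. quartic_deriv c (mesh_Y N n l (mesh_path N n \<omega>))) (2*q) \<le> ennreal A" if "l < N" for l
        using A(2)[of "(N, n, l)"] i that by simp
      show "abs_moment (\<lambda>\<omega>. mesh_mean n l (mesh_path N n \<omega>)) 2 \<le> ennreal (g * d)" if "l < N" for l
      proof -
        have "abs_moment (\<lambda>\<omega>. mesh_mean n l (mesh_path N n \<omega>)) 2 \<le> ennreal (G1 * d)"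
          using G1(2)[of "(N, n, l)"] i that d by (simp add: d_def)
        also have "\<dots> \<le> ennreal (g * d)" using g12 by (intro ennreal_leI) auto
        finally show ?thesis .
      qed
      show "abs_moment (\<lambda>\<omega>. mesh_mean n l (mesh_path N n \<omega>)) (2*q) \<le> ennreal (g * d)" if "l < N" for l
      proof -
        have "sqrt d ^ (2 * q) = d ^ q" using d by (simp add: power_mult)
        then have "abs_moment (\<lambda>\<omega>. mesh_mean n l (mesh_path N n \<omega>)) (2*q) \<le> ennreal (G2 * d ^ q)"
          using G2(2)[of "(N, n, l)"] i that by (simp add: d_def[symmetric])
        also have "\<dots> \<le> ennreal (g * d)" using g12 by (intro ennreal_leI) auto
        finally show ?thesis .
      qed
    qed (use i q A(1) g d in auto)
    then have "integrable M (\<lambda>\<omega>. mesh_sum c N n k (mesh_path N n \<omega>) ^ (2 * q))"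
      by (intro all_moments_integrable all_moments_power) auto
    then have "(\<integral>\<^sup>+\<omega>. ennreal (mesh_sum c N n k (mesh_path N n \<omega>) ^ (2 * q)) \<partial>M) = ennreal (expectation (\<lambda>\<omega>. mesh_sum c N n k (mesh_path N n \<omega>) ^ (2 * q)))"
      by (intro nn_integral_eq_integral) auto
    also have "\<dots> \<le> ennreal (2 * A * exp (4 ^ q * (g * d) * real k))" using res by (intro ennreal_leI) auto
    also have "\<dots> \<le> ennreal (2 * A * exp (4 ^ q * g * T))"
    proof -
      have "d * real k \<le> T" using i d mult_left_mono[of "real k" "real N" d] by (simp add: mult.commute)
      then have "(4 ^ q * g) * (d * real k) \<le> (4 ^ q * g) * T" using g by (intro mult_left_mono) auto
      then show ?thesis using A(1) by (intro ennreal_leI mult_left_mono) (auto simp: mult.assoc)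
    qed
    finally show ?thesis .
  qed
  show "\<exists>C. \<forall>i\<in>?I. (\<integral>\<^sup>+\<omega>. ennreal ((case i of (N, n, k) \<Rightarrow> \<lambda>\<omega>. mesh_sum c N n k (mesh_path N n \<omega>)) \<omega> ^ (2 * q)) \<partial>M) \<le> ennreal (C * 1 ^ (2 * q))"
    using bound by (intro exI[of _ "2 * A * exp (4 ^ q * g * T)"]) auto
qed auto

definition grid_martingale :: "(nat \<Rightarrow> real) \<Rightarrow> nat \<Rightarrow> nat \<Rightarrow> 'a \<Rightarrow> real" where
  "grid_martingale c N k \<omega> = (\<Sum>l<k. quartic_deriv c (Y (grid T N l) \<omega>) *
     time_avg (grid T N l) (grid T N (Suc l)) (\<lambda>s. W s \<omega> - W (grid T N l) \<omega>))"

text \<open>Each grid step is divided into \<open>n\<close> equal parts. As \<open>n\<close> grows, the mesh quantities converge pathwise to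
  \<open>Y\<close> and to the time averages of \<open>W\<close>, and the uniform moment bounds are inherited.\<close>
lemma grid_martingale_moments:
  "moments_O {(N, k). 0 < N \<and> k \<le> N} (\<lambda>(N, k). grid_martingale c N k) (\<lambda>_. 1)"
proof -
  let ?I = "{(N, k). 0 < N \<and> k \<le> N} :: (nat \<times> nat) set"
  define Z where "Z i n \<omega> = mesh_sum c (fst i) (Suc n) (snd i) (\<lambda>j. mesh_increment (fst i) (Suc n) j \<omega>)" for i :: "nat \<times> nat" and n \<omega>
  have "moments_O (?I \<times> UNIV) (\<lambda>j. (\<lambda>(N, n, k) \<omega>. mesh_sum c N n k (mesh_path N n \<omega>)) ((\<lambda>((N, k), n). (N, Suc n, k)) j)) (\<lambda>j. 1)"
    using moments_O_reindex[OF mesh_sum_moments[of c], of "?I \<times> UNIV" "\<lambda>((N, k), n). (N, Suc n, k)"] by auto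
  then have Zm: "moments_O (?I \<times> UNIV) (\<lambda>(i, n). Z i n) (\<lambda>(i, n). 1)"
    by (simp add: Z_def[abs_def] case_prod_unfold)
  show ?thesis
  proof (rule moments_O_limit[OF Zm])
    fix i assume "i \<in> ?I"
    then obtain N k where i: "i = (N, k)" "0 < N" "k \<le> N" by auto
    have iv: "(grid T N l, grid T N (Suc l)) \<in> intervals T" if "l < k" for l
      using T i that by (intro grid_interval) auto
    have iv': "grid T N l < grid T N (Suc l)" "{grid T N l..grid T N (Suc l)} \<subseteq> {0..T}" "grid T N l \<in> {0..T}" if "l < k" for l
      using iv[OF that] by (auto simp: intervals_def)
    show "(case i of (N, k) \<Rightarrow> grid_martingale c N k) \<in> borel_measurable M"
    proof -
      have "(\<lambda>\<omega>. time_avg (grid T N l) (grid T N (Suc l)) (\<lambda>s. W s \<omega> - W (grid T N l) \<omega>)) \<in> borel_measurable M" if "l < k" for l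
        using iv'[OF that] by (intro time_avg_measurable continuous_intros continuous_on_subset[OF W_continuous]
          borel_measurable_diff W_measurable) auto
      then have "grid_martingale c N k \<in> borel_measurable M"
        unfolding grid_martingale_def[abs_def] using iv'(3)
        by (intro borel_measurable_sum borel_measurable_times measurable_compose[OF Y_measurable quartic_deriv_measurable]) auto
      then show ?thesis by (simp add: i)
    qed
    show "AE \<omega> in M. (\<lambda>n. Z i n \<omega>) \<longlonglongrightarrow> (case i of (N, k) \<Rightarrow> grid_martingale c N k) \<omega>"
      using Y_approx_tendsto AE_space
    proof eventually_elim
      case (elim \<omega>)
      have "(\<lambda>n. \<Sum>l<k. quartic_deriv c (mesh_Y N (Suc n) l (\<lambda>j. mesh_increment N (Suc n) j \<omega>)) * mesh_mean (Suc n) l (\<lambda>j. mesh_increment N (Suc n) j \<omega>))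
          \<longlonglongrightarrow> (\<Sum>l<k. quartic_deriv c (Y (grid T N l) \<omega>) * time_avg (grid T N l) (grid T N (Suc l)) (\<lambda>s. W s \<omega> - W (grid T N l) \<omega>))"
      proof (intro tendsto_sum tendsto_mult)
        fix l assume "l \<in> {..<k}"
        then have l: "l < k" by simp
        have Yl: "(\<lambda>n. Y_approx (grid T N l) n \<omega>) \<longlonglongrightarrow> Y (grid T N l) \<omega>" using elim(1) iv'(3)[OF l] by auto
        have "(\<lambda>n. Y_approx (grid T N l) (l * Suc n) \<omega>) \<longlonglongrightarrow> Y (grid T N l) \<omega>"
        proof (cases "l = 0")
          case True
          \<comment> \<open>at time zero the approximation does not depend on the number of terms\<close>
          then have "Y_approx (grid T N l) n \<omega> = Y_approx (grid T N l) (l * Suc m) \<omega>" for n m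
            by (simp add: Y_approx_def gauss_sum_def grid_simps)
          then show ?thesis using Yl by (metis (no_types, lifting) LIMSEQ_const_iff LIMSEQ_unique tendsto_cong_limit tendsto_const ext)
        next
          case False
          have "strict_mono (\<lambda>n. l * Suc n)" using False by (intro strict_monoI) auto
          from LIMSEQ_subseq_LIMSEQ[OF Yl this] show ?thesis by (simp add: comp_def)
        qed
        moreover have "Y_approx (grid T N l) (l * Suc n) \<omega> = mesh_Y N (Suc n) l (\<lambda>j. mesh_increment N (Suc n) j \<omega>)" for n
          using mesh_Y_eq[of N "Suc n" l \<omega>] i by simp
        ultimately have "(\<lambda>n. mesh_Y N (Suc n) l (\<lambda>j. mesh_increment N (Suc n) j \<omega>)) \<longlonglongrightarrow> Y (grid T N l) \<omega>" by simp
        then show "(\<lambda>n. quartic_deriv c (mesh_Y N (Suc n) l (\<lambda>j. mesh_increment N (Suc n) j \<omega>))) \<longlonglongrightarrow> quartic_deriv c (Y (grid T N l) \<omega>)"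
          by (intro continuous_on_tendsto_compose[OF quartic_deriv_continuous]) auto
        have "continuous_on {grid T N l..grid T N (Suc l)} (\<lambda>s. W s \<omega> - W (grid T N l) \<omega>)"
          using iv'(2)[OF l] by (intro continuous_intros continuous_on_subset[OF W_continuous[OF elim(2)]])
        from LIMSEQ_Suc[OF riemann_sum_tendsto_time_avg[OF iv'(1)[OF l] this]]
        show "(\<lambda>n. mesh_mean (Suc n) l (\<lambda>j. mesh_increment N (Suc n) j \<omega>)) \<longlonglongrightarrow>
            time_avg (grid T N l) (grid T N (Suc l)) (\<lambda>s. W s \<omega> - W (grid T N l) \<omega>)"
          using i by (simp add: mesh_mean_eq del: of_nat_Suc)
      qed
      then show ?case by (simp add: i Z_def mesh_sum_def grid_martingale_def)
    qed
  qed
qed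

text \<open>On each step the error is the remainder of \<open>drift_remainder_moments\<close> plus a term of the martingale
  transform. At most \<open>N\<close> remainders of rate \<open>T / N\<close>, weighted by \<open>T / N\<close>, add up to \<open>T\<close> times a mean of
  variables of rate \<open>T / N\<close>.\<close>
lemma drift_error_moments:
  "moments_O {(N, k). 0 < N \<and> k \<le> N}
     (\<lambda>(N, k) \<omega>. T / real N * (\<Sum>l<k. time_avg (grid T N l) (grid T N (Suc l)) (\<lambda>s. quartic c (Y s \<omega>)) - quartic c (Y (grid T N l) \<omega>)))
     (\<lambda>(N, k). T / real N)"
proof -
  let ?I = "{(N, k). 0 < N \<and> k \<le> N} :: (nat \<times> nat) set"
  define R where "R i \<omega> = time_avg (fst i) (snd i) (\<lambda>s. quartic c (Y s \<omega>)) - quartic c (Y (fst i) \<omega>)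
      - \<nu> * quartic_deriv c (Y (fst i) \<omega>) * W_mean i \<omega>" for i :: "real \<times> real" and \<omega>
  define iv where "iv N l = (grid T N l, grid T N (Suc l))" for N l
  have Rm: "moments_O (intervals T) R len"
    unfolding R_def[abs_def] by (rule drift_remainder_moments)
  let ?J = "SIGMA i:?I. {..<fst i}"
  have "moments_O ?J (\<lambda>j. R (iv (fst (fst j)) (snd j))) (\<lambda>j. snd (iv (fst (fst j)) (snd j)) - fst (iv (fst (fst j)) (snd j)))"
    using T by (intro moments_O_reindex[OF Rm]) (auto simp: iv_def intro!: grid_interval)
  then have RJ: "moments_O ?J (\<lambda>j. R (iv (fst (fst j)) (snd j))) (\<lambda>j. T / real (fst (fst j)))"
    by (simp add: iv_def grid_simps)
  then have "moments_O ?J (\<lambda>j \<omega>. if snd j < snd (fst j) then R (iv (fst (fst j)) (snd j)) \<omega> else 0) (\<lambda>j. T / real (fst (fst j)))"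
    by (rule moments_O_mono) (use moments_OD1[OF RJ] in auto)
  then have "moments_O ?J (\<lambda>(i, l) \<omega>. if l < snd i then R (iv (fst i) l) \<omega> else 0) (\<lambda>(i, l). T / real (fst i))"
    by (simp add: case_prod_unfold)
  from moments_O_mean[OF this]
  have "moments_O ?I (\<lambda>i \<omega>. (\<Sum>l<fst i. if l < snd i then R (iv (fst i) l) \<omega> else 0) / real (fst i)) (\<lambda>i. T / real (fst i))"
    by auto
  from moments_O_cmult[OF this, of T]
  have 1: "moments_O ?I (\<lambda>i \<omega>. T * ((\<Sum>l<fst i. if l < snd i then R (iv (fst i) l) \<omega> else 0) / real (fst i))) (\<lambda>i. T / real (fst i))" .
  have "moments_O ?I (\<lambda>i \<omega>. T / real (fst i)) (\<lambda>i. T / real (fst i))"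
    using T by (intro moments_O_const[where K=1]) auto
  from moments_O_mult[OF this moments_O_cmult[OF grid_martingale_moments[of c], of \<nu>]]
  have 2: "moments_O ?I (\<lambda>i \<omega>. T / real (fst i) * (\<nu> * grid_martingale c (fst i) (snd i) \<omega>)) (\<lambda>i. T / real (fst i))"
    by (simp add: case_prod_unfold)
  have eq: "T / real (fst i) * (\<Sum>l<snd i. time_avg (grid T (fst i) l) (grid T (fst i) (Suc l)) (\<lambda>s. quartic c (Y s \<omega>)) - quartic c (Y (grid T (fst i) l) \<omega>))
     = T * ((\<Sum>l<fst i. if l < snd i then R (iv (fst i) l) \<omega> else 0) / real (fst i)) + T / real (fst i) * (\<nu> * grid_martingale c (fst i) (snd i) \<omega>)"
    if i: "i \<in> ?I" for i \<omega>
  proof -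
    have "(\<Sum>l<fst i. if l < snd i then R (iv (fst i) l) \<omega> else 0) = (\<Sum>l\<in>{..<fst i} \<inter> {l. l < snd i}. R (iv (fst i) l) \<omega>)"
      by (simp add: sum.inter_restrict)
    also have "{..<fst i} \<inter> {l. l < snd i} = {..<snd i}" using i by auto
    finally have s1: "(\<Sum>l<fst i. if l < snd i then R (iv (fst i) l) \<omega> else 0) = (\<Sum>l<snd i. R (iv (fst i) l) \<omega>)" .
    have "(\<Sum>l<snd i. time_avg (grid T (fst i) l) (grid T (fst i) (Suc l)) (\<lambda>s. quartic c (Y s \<omega>)) - quartic c (Y (grid T (fst i) l) \<omega>))
        = (\<Sum>l<snd i. R (iv (fst i) l) \<omega>) + \<nu> * grid_martingale c (fst i) (snd i) \<omega>"
      by (simp add: R_def iv_def grid_martingale_def sum_distrib_left sum.distrib[symmetric] mult.assoc)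
    then show ?thesis unfolding s1 by (simp add: algebra_simps add_divide_distrib)
  qed
  have "moments_O ?I (\<lambda>i \<omega>. T / real (fst i) * (\<Sum>l<snd i. time_avg (grid T (fst i) l) (grid T (fst i) (Suc l)) (\<lambda>s. quartic c (Y s \<omega>)) - quartic c (Y (grid T (fst i) l) \<omega>))) (\<lambda>i. T / real (fst i))"
  proof (rule moments_O_cong_AE[OF moments_O_add[OF 1 2]])
    fix i assume i: "i \<in> ?I"
    show "(\<lambda>\<omega>. T / real (fst i) * (\<Sum>l<snd i. time_avg (grid T (fst i) l) (grid T (fst i) (Suc l)) (\<lambda>s. quartic c (Y s \<omega>)) - quartic c (Y (grid T (fst i) l) \<omega>))) \<in> borel_measurable M"
      using moments_OD1[OF moments_O_add[OF 1 2] i] unfolding eq[OF i] .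
  qed (rule AE_I2, erule eq)
  then show ?thesis by (simp add: case_prod_unfold)
qed

end

section \<open>Gaussian sums conditionally on the volatility noise\<close>

text \<open>The right-hand functional is defined and measurable for every sequence, convergent or not. Almost sure limits
  of functionals of the path of \<open>W\<close> can therefore be written as measurable functionals of this path.\<close>
lemma tendsto_eq_real_limsup:
  fixes x :: "nat \<Rightarrow> real"
  assumes "x \<longlonglongrightarrow> l"
  shows "real_of_ereal (limsup (\<lambda>n. ereal (x n))) = l"
proof -
  have "limsup (\<lambda>n. ereal (x n)) = ereal l"
    using assms by (intro lim_imp_Limsup) auto
  then show ?thesis by simp
qed

locale volatility_model = ornstein_uhlenbeck M T W Y \<nu> \<kappa> \<theta> y0
  for M :: "'a measure" and T W Y \<nu> \<kappa> \<theta> y0 +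
  fixes B :: "real \<Rightarrow> 'a \<Rightarrow> real"
  assumes bmB: "standard_brownian_motion M T B" and indep: "independent_processes M T W B"
begin

sublocale B: brownian M T B
  by unfold_locales (fact T bmB)+

abbreviation dB :: "nat \<Rightarrow> nat \<Rightarrow> 'a \<Rightarrow> real" where
  "dB N l \<omega> \<equiv> B (grid T N (Suc l)) \<omega> - B (grid T N l) \<omega>"

abbreviation path_space :: "(real \<Rightarrow> real) measure" where
  "path_space \<equiv> PiM {0..T} (\<lambda>_. borel)"

abbreviation W_path :: "'a \<Rightarrow> real \<Rightarrow> real" where
  "W_path \<omega> \<equiv> (\<lambda>t\<in>{0..T}. W t \<omega>)"

abbreviation B_path :: "'a \<Rightarrow> real \<Rightarrow> real" where
  "B_path \<omega> \<equiv> (\<lambda>t\<in>{0..T}. B t \<omega>)"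

text \<open>Measurable functions of the path of \<open>W\<close>, up to null sets. The error of the volatility belongs to this class
  and is therefore independent of \<open>B\<close>.\<close>
definition W_functional :: "('a \<Rightarrow> real) \<Rightarrow> bool" where
  "W_functional X \<longleftrightarrow> (\<exists>g\<in>borel_measurable path_space. AE \<omega> in M. X \<omega> = g (W_path \<omega>))"

lemma W_functional_W: "t \<in> {0..T} \<Longrightarrow> W_functional (W t)"
  unfolding W_functional_def
  by (intro bexI[of _ "\<lambda>w. w t"] AE_I2 measurable_component_singleton) auto

lemma W_functional_const: "W_functional (\<lambda>_. c)"
  unfolding W_functional_def by (intro bexI[of _ "\<lambda>_. c"]) auto

lemma W_functional_compose2:
  assumes "W_functional X" "W_functional Z"
    and f: "case_prod f \<in> borel_measurable (borel \<Otimes>\<^sub>M borel)"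
  shows "W_functional (\<lambda>\<omega>. f (X \<omega>) (Z \<omega>))"
proof -
  obtain g h where g: "g \<in> borel_measurable path_space" "AE \<omega> in M. X \<omega> = g (W_path \<omega>)"
    and h: "h \<in> borel_measurable path_space" "AE \<omega> in M. Z \<omega> = h (W_path \<omega>)"
    using assms(1,2) unfolding W_functional_def by blast
  have "(\<lambda>w. case_prod f (g w, h w)) \<in> borel_measurable path_space"
    by (intro measurable_compose[OF measurable_Pair f] g h)
  moreover have "AE \<omega> in M. f (X \<omega>) (Z \<omega>) = case_prod f (g (W_path \<omega>), h (W_path \<omega>))"
    using g(2) h(2) by eventually_elim simp
  ultimately show ?thesis unfolding W_functional_def by (intro bexI) auto
qed

lemma W_functional_compose:
  assumes "W_functional X" "f \<in> borel_measurable borel"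
  shows "W_functional (\<lambda>\<omega>. f (X \<omega>))"
  using W_functional_compose2[OF assms(1) W_functional_const, of "\<lambda>x _. f x" 0] assms(2)
  by (simp add: case_prod_unfold measurable_compose[OF measurable_fst])

lemma W_functional_add: "W_functional X \<Longrightarrow> W_functional Z \<Longrightarrow> W_functional (\<lambda>\<omega>. X \<omega> + Z \<omega>)"
  and W_functional_diff: "W_functional X \<Longrightarrow> W_functional Z \<Longrightarrow> W_functional (\<lambda>\<omega>. X \<omega> - Z \<omega>)"
  and W_functional_mult: "W_functional X \<Longrightarrow> W_functional Z \<Longrightarrow> W_functional (\<lambda>\<omega>. X \<omega> * Z \<omega>)"
  and W_functional_max: "W_functional X \<Longrightarrow> W_functional Z \<Longrightarrow> W_functional (\<lambda>\<omega>. max (X \<omega>) (Z \<omega>))"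
  by (rule W_functional_compose2; simp add: case_prod_unfold)+

lemma W_functional_sum: "(\<And>i. i \<in> A \<Longrightarrow> W_functional (X i)) \<Longrightarrow> W_functional (\<lambda>\<omega>. \<Sum>i\<in>A. X i \<omega>)"
  by (induction A rule: infinite_finite_induct) (auto intro: W_functional_const W_functional_add)

lemma W_functional_limit:
  assumes X: "\<And>n::nat. W_functional (X n)" and lim: "AE \<omega> in M. (\<lambda>n. X n \<omega>) \<longlonglongrightarrow> Z \<omega>"
  shows "W_functional Z"
proof -
  have "\<forall>n. \<exists>g. g \<in> borel_measurable path_space \<and> (AE \<omega> in M. X n \<omega> = g (W_path \<omega>))"
    using X unfolding W_functional_def by blast
  from choice[OF this] obtain g where g: "\<And>n. g n \<in> borel_measurable path_space" "\<And>n. AE \<omega> in M. X n \<omega> = g n (W_path \<omega>)"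
    by blast
  have "AE \<omega> in M. \<forall>n. X n \<omega> = g n (W_path \<omega>)" using g(2) by (simp add: AE_all_countable)
  then have "AE \<omega> in M. Z \<omega> = real_of_ereal (limsup (\<lambda>n. ereal (g n (W_path \<omega>))))"
    using lim by eventually_elim (simp add: tendsto_eq_real_limsup)
  moreover have "(\<lambda>w. real_of_ereal (limsup (\<lambda>n. ereal (g n w)))) \<in> borel_measurable path_space"
    using g(1) by measurable
  ultimately show ?thesis unfolding W_functional_def by (intro bexI) auto
qed

lemma W_functional_Y:
  assumes t: "t \<in> {0..T}" shows "W_functional (Y t)"
proof (rule W_functional_limit)
  show "AE \<omega> in M. (\<lambda>n. Y_approx t n \<omega>) \<longlonglongrightarrow> Y t \<omega>"
    using Y_approx_tendsto by eventually_elim (use t in auto)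
  show "W_functional (Y_approx t n)" for n
    unfolding Y_approx_def[abs_def] gauss_sum_def
    by (intro W_functional_add W_functional_mult W_functional_const W_functional_sum W_functional_diff W_functional_W mesh_le[OF t]) auto
qed

lemma W_functional_time_avg:
  assumes "a < b" and X: "\<And>s. s \<in> {a..b} \<Longrightarrow> W_functional (X s)"
    and cont: "\<And>\<omega>. \<omega> \<in> space M \<Longrightarrow> continuous_on {a..b} (\<lambda>s. X s \<omega>)"
  shows "W_functional (\<lambda>\<omega>. time_avg a b (\<lambda>s. X s \<omega>))"
proof (rule W_functional_limit)
  show "AE \<omega> in M. (\<lambda>n. (1 / real n) * (\<Sum>j<n. X (a + real j * ((b - a) / real n)) \<omega>)) \<longlonglongrightarrow> time_avg a b (\<lambda>s. X s \<omega>)"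
    using riemann_sum_tendsto_time_avg[OF assms(1) cont] by (intro AE_I2) simp
  have "a + real j * ((b - a) / real n) \<in> {a..b}" if "j < n" for j n
  proof -
    have "real j * ((b - a) / real n) \<le> real n * ((b - a) / real n)"
      using that assms(1) by (intro mult_right_mono) auto
    then show ?thesis using assms(1) that by simp
  qed
  then show "W_functional (\<lambda>\<omega>. (1 / real n) * (\<Sum>j<n. X (a + real j * ((b - a) / real n)) \<omega>))" for n
    by (intro W_functional_mult W_functional_const W_functional_sum X) auto
qed

lemma grid_increments_B:
  assumes "0 < N"
  shows "indep_vars (\<lambda>_. borel) (\<lambda>l \<omega>. B (grid T N (Suc l)) \<omega> - B (grid T N l) \<omega>) {..<N}"
    and "l < N \<Longrightarrow> distributed M lborel (\<lambda>\<omega>. B (grid T N (Suc l)) \<omega> - B (grid T N l) \<omega>) (normal_density 0 (sqrt (T / real N)))"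
  using B.mesh_indep[of "T / real N" N] B.mesh_distributed[of "T / real N" N l] assms T by (simp_all add: grid_def)

text \<open>As the paths of \<open>W\<close> and \<open>B\<close> are independent, Fubini's theorem allows to freeze the path of \<open>W\<close>. The sum
  is then one of independent Gaussian variables with deterministic weights, its moments are governed by its variance,
  and \<open>max_moment_bound\<close> applies with a constant that does not depend on the weights.\<close>
lemma diffusion_max_bound:
  assumes q: "0 < q" and \<epsilon>: "0 < \<epsilon>"
  obtains K where "0 \<le> K"
    "\<And>N D. 1 \<le> N \<Longrightarrow> (\<And>l. l < N \<Longrightarrow> W_functional (D l)) \<Longrightarrow>
      (\<integral>\<^sup>+\<omega>. ennreal (MAX k\<in>{0..N}. \<bar>\<Sum>l<k. D l \<omega> * dB N l \<omega>\<bar> powr q) \<partial>M)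
      \<le> ennreal (K * real N powr \<epsilon>) * (\<integral>\<^sup>+\<omega>. ennreal ((T / real N * (\<Sum>l<N. (D l \<omega>)\<^sup>2)) powr (q / 2)) \<partial>M)"
proof -
  obtain K where K: "0 \<le> K" and max: "\<And>N c (Z :: nat \<Rightarrow> 'a \<Rightarrow> real). 1 \<le> N \<Longrightarrow> 0 < c \<Longrightarrow> (\<And>k. k \<le> N \<Longrightarrow> Z k \<in> borel_measurable M) \<Longrightarrow>
       (\<And>k m. k \<le> N \<Longrightarrow> abs_moment (Z k) m \<le> ennreal (gauss_moment m * c ^ m)) \<Longrightarrow>
       (\<integral>\<^sup>+\<omega>. ennreal (MAX k\<in>{0..N}. \<bar>Z k \<omega>\<bar> powr q) \<partial>M) \<le> ennreal (K * real N powr \<epsilon> * c powr q)"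
    using max_moment_bound[OF q \<epsilon>, of gauss_moment] by blast
  show ?thesis
  proof (rule that[OF K])
    fix N :: nat and D :: "nat \<Rightarrow> 'a \<Rightarrow> real" assume N: "1 \<le> N" and D: "\<And>l. l < N \<Longrightarrow> W_functional (D l)"
    define P where "P l g \<longleftrightarrow> g \<in> borel_measurable path_space \<and> (AE \<omega> in M. D l \<omega> = g (W_path \<omega>))" for l g
    define g where "g l = (SOME g. P l g)" for l
    have P: "P l (g l)" if "l < N" for l
      unfolding g_def using D[OF that] unfolding W_functional_def P_def[symmetric] Bex_def
      by (intro someI_ex[of "P l"])
    have g[measurable]: "g l \<in> borel_measurable path_space" if "l < N" for l
      using P[OF that] unfolding P_def by (rule conjunct1)
    have "AE \<omega> in M. D l \<omega> = g l (W_path \<omega>)" if "l < N" for l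
      using P[OF that] unfolding P_def by (rule conjunct2)
    then have "AE \<omega> in M. \<forall>l\<in>{..<N}. D l \<omega> = g l (W_path \<omega>)"
      by (subst AE_finite_all) auto
    then have Dg': "AE \<omega> in M. \<forall>l<N. D l \<omega> = g l (W_path \<omega>)"
      by eventually_elim simp
    define S where "S k w b = (\<Sum>l<k. g l w * (b (grid T N (Suc l)) - b (grid T N l)))" for k and w b :: "real \<Rightarrow> real"
    define \<Phi> where "\<Phi> w b = ennreal (MAX k\<in>{0..N}. \<bar>S k w b\<bar> powr q)" for w b
    define \<Psi> where "\<Psi> w = ennreal (K * real N powr \<epsilon>) * ennreal ((T / real N * (\<Sum>l<N. (g l w)\<^sup>2)) powr (q / 2))" for w
    have gr: "grid T N l \<in> {0..T}" if "l \<le> N" for l by (rule grid_range[OF T that])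
    have [measurable]: "(\<lambda>b. b (grid T N l)) \<in> borel_measurable path_space" if "l \<le> N" for l
      using gr[OF that] by (intro measurable_component_singleton) auto
    have Sm: "(\<lambda>z. S k (fst z) (snd z)) \<in> borel_measurable (path_space \<Otimes>\<^sub>M path_space)" if "k \<le> N" for k
      unfolding S_def using that by (intro borel_measurable_sum) measurable
    have \<Phi>m: "case_prod \<Phi> \<in> borel_measurable (path_space \<Otimes>\<^sub>M path_space)"
      unfolding \<Phi>_def case_prod_unfold using Sm by (intro measurable_compose[OF _ measurable_ennreal] borel_measurable_Max) auto
    have Vm: "(\<lambda>w. ennreal ((T / real N * (\<Sum>l<N. (g l w)\<^sup>2)) powr (q / 2))) \<in> borel_measurable path_space"
      by measurable
    have \<Psi>m: "\<Psi> \<in> borel_measurable path_space" unfolding \<Psi>_def by measurable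
    have ind: "indep_var path_space W_path path_space B_path"
      using indep unfolding independent_processes_def .
    then have rv: "W_path \<in> measurable M path_space" "B_path \<in> measurable M path_space"
      and joint: "distr M path_space W_path \<Otimes>\<^sub>M distr M path_space B_path = distr M (path_space \<Otimes>\<^sub>M path_space) (\<lambda>\<omega>. (W_path \<omega>, B_path \<omega>))"
      unfolding indep_var_distribution_eq by auto
    interpret PB: prob_space "distr M path_space B_path" by (rule prob_space_distr[OF rv(2)])
    have inner: "(\<integral>\<^sup>+b. \<Phi> w b \<partial>distr M path_space B_path) \<le> \<Psi> w" if w: "w \<in> space path_space" for w
    proof -
      have "(\<integral>\<^sup>+b. \<Phi> w b \<partial>distr M path_space B_path) = (\<integral>\<^sup>+\<omega>. \<Phi> w (B_path \<omega>) \<partial>M)"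
        using measurable_compose[OF measurable_Pair1'[OF w] \<Phi>m] by (intro nn_integral_distr rv) (simp add: comp_def)
      also have "\<dots> = (\<integral>\<^sup>+\<omega>. ennreal (MAX k\<in>{0..N}. \<bar>\<Sum>l<k. g l w * dB N l \<omega>\<bar> powr q) \<partial>M)"
      proof (rule nn_integral_cong)
        fix \<omega>
        have "S k w (B_path \<omega>) = (\<Sum>l<k. g l w * dB N l \<omega>)" if "k \<le> N" for k
          unfolding S_def using gr that by (intro sum.cong) auto
        then show "\<Phi> w (B_path \<omega>) = ennreal (MAX k\<in>{0..N}. \<bar>\<Sum>l<k. g l w * dB N l \<omega>\<bar> powr q)"
          unfolding \<Phi>_def by (intro arg_cong[where f=ennreal] arg_cong[where f=Max] image_cong) auto
      qed
      also have "\<dots> \<le> \<Psi> w"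
      \<comment> \<open>\<open>max_moment_bound\<close> requires a positive rate, so vanishing weights are a separate case\<close>
      proof (cases "(\<Sum>l<N. (g l w)\<^sup>2) = 0")
        case True
        then have "g l w = 0" if "l < N" for l using that by (simp add: sum_nonneg_eq_0_iff)
        then have "(\<Sum>l<k. g l w * dB N l \<omega>) = 0" if "k \<le> N" for k \<omega>
          using that by (intro sum.neutral) auto
        then have "(MAX k\<in>{0..N}. \<bar>\<Sum>l<k. g l w * dB N l \<omega>\<bar> powr q) = (MAX k\<in>{0..N}. 0)" for \<omega>
          by (intro arg_cong[where f=Max] image_cong) auto
        then show ?thesis by simp
      next
        case False
        define c where "c = sqrt (T / real N) * sqrt (\<Sum>l<N. (g l w)\<^sup>2)"
        have sp: "0 < (\<Sum>l<N. (g l w)\<^sup>2)" using False by (simp add: sum_nonneg less_le)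
        then have c: "0 < c" using T N by (simp add: c_def)
        have "(\<integral>\<^sup>+\<omega>. ennreal (MAX k\<in>{0..N}. \<bar>\<Sum>l<k. g l w * dB N l \<omega>\<bar> powr q) \<partial>M)
            \<le> ennreal (K * real N powr \<epsilon> * c powr q)"
        proof (rule max[OF N c])
          show "(\<lambda>\<omega>. \<Sum>l<k. g l w * dB N l \<omega>) \<in> borel_measurable M" if "k \<le> N" for k
            using gr that by (intro borel_measurable_sum borel_measurable_times borel_measurable_diff borel_measurable_const B.W_measurable) auto
          show "abs_moment (\<lambda>\<omega>. \<Sum>l<k. g l w * dB N l \<omega>) m \<le> ennreal (gauss_moment m * c ^ m)"
            if "k \<le> N" for k m
            unfolding c_def using N T that by (intro weighted_gaussian_sum_moment grid_increments_B) auto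
        qed
        also have "c powr q = (T / real N * (\<Sum>l<N. (g l w)\<^sup>2)) powr (q / 2)"
        proof -
          have "c = (T / real N * (\<Sum>l<N. (g l w)\<^sup>2)) powr (1 / 2)"
            using sp T N by (simp add: c_def real_sqrt_mult[symmetric] powr_half_sqrt)
          then show ?thesis by (simp add: powr_powr)
        qed
        also have "ennreal (K * real N powr \<epsilon> * (T / real N * (\<Sum>l<N. (g l w)\<^sup>2)) powr (q / 2)) = \<Psi> w"
          unfolding \<Psi>_def using K by (simp add: ennreal_mult)
        finally show ?thesis .
      qed
      finally show ?thesis .
    qed
    have "(\<integral>\<^sup>+\<omega>. ennreal (MAX k\<in>{0..N}. \<bar>\<Sum>l<k. D l \<omega> * dB N l \<omega>\<bar> powr q) \<partial>M)
        = (\<integral>\<^sup>+\<omega>. case_prod \<Phi> (W_path \<omega>, B_path \<omega>) \<partial>M)"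
    proof (rule nn_integral_cong_AE)
      show "AE \<omega> in M. ennreal (MAX k\<in>{0..N}. \<bar>\<Sum>l<k. D l \<omega> * dB N l \<omega>\<bar> powr q)
          = case_prod \<Phi> (W_path \<omega>, B_path \<omega>)"
        using Dg'
      proof eventually_elim
        case (elim \<omega>)
        have "(\<Sum>l<k. D l \<omega> * dB N l \<omega>) = S k (W_path \<omega>) (B_path \<omega>)" if "k \<le> N" for k
          unfolding S_def using gr that elim by (intro sum.cong) auto
        then show ?case unfolding \<Phi>_def split
          by (intro arg_cong[where f=ennreal] arg_cong[where f=Max] image_cong) auto
      qed
    qed
    also have "\<dots> = (\<integral>\<^sup>+z. case_prod \<Phi> z \<partial>(distr M path_space W_path \<Otimes>\<^sub>M distr M path_space B_path))"
      unfolding joint using \<Phi>m rv by (intro nn_integral_distr[symmetric]) auto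
    also have "\<dots> = (\<integral>\<^sup>+w. \<integral>\<^sup>+b. case_prod \<Phi> (w, b) \<partial>distr M path_space B_path \<partial>distr M path_space W_path)"
      using \<Phi>m by (intro PB.nn_integral_fst[symmetric]) (simp cong: measurable_cong_sets)
    also have "\<dots> \<le> (\<integral>\<^sup>+w. \<Psi> w \<partial>distr M path_space W_path)"
      using inner by (intro nn_integral_mono) simp
    also have "\<dots> = (\<integral>\<^sup>+\<omega>. \<Psi> (W_path \<omega>) \<partial>M)" using \<Psi>m rv by (intro nn_integral_distr) auto
    also have "\<dots> = ennreal (K * real N powr \<epsilon>) * (\<integral>\<^sup>+\<omega>. ennreal ((T / real N * (\<Sum>l<N. (g l (W_path \<omega>))\<^sup>2)) powr (q / 2)) \<partial>M)"
      unfolding \<Psi>_def by (intro nn_integral_cmult measurable_compose[OF rv(1) Vm])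
    also have "(\<integral>\<^sup>+\<omega>. ennreal ((T / real N * (\<Sum>l<N. (g l (W_path \<omega>))\<^sup>2)) powr (q / 2)) \<partial>M)
        = (\<integral>\<^sup>+\<omega>. ennreal ((T / real N * (\<Sum>l<N. (D l \<omega>)\<^sup>2)) powr (q / 2)) \<partial>M)"
      using Dg' by (intro nn_integral_cong_AE) (auto elim!: eventually_mono)
    finally show "(\<integral>\<^sup>+\<omega>. ennreal (MAX k\<in>{0..N}. \<bar>\<Sum>l<k. D l \<omega> * dB N l \<omega>\<bar> powr q) \<partial>M)
      \<le> ennreal (K * real N powr \<epsilon>) * (\<integral>\<^sup>+\<omega>. ennreal ((T / real N * (\<Sum>l<N. (D l \<omega>)\<^sup>2)) powr (q / 2)) \<partial>M)" .
  qed
qed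

end

section \<open>Pathwise bounds for the volatility error\<close>

lemma sqrt_diff_times_sum:
  assumes "0 \<le> v" "0 \<le> u"
  shows "\<bar>sqrt v - sqrt u\<bar> * (sqrt v + sqrt u) = \<bar>v - u\<bar>"
proof -
  have "\<bar>sqrt v - sqrt u\<bar> * \<bar>sqrt v + sqrt u\<bar> = \<bar>(sqrt v - sqrt u) * (sqrt v + sqrt u)\<bar>" by (simp add: abs_mult)
  also have "(sqrt v - sqrt u) * (sqrt v + sqrt u) = v - u" using assms by (simp add: algebra_simps)
  finally show ?thesis using assms by simp
qed

lemma sqrt_diff_square_le:
  assumes "0 \<le> v" "0 \<le> u"
  shows "(sqrt v - sqrt u)\<^sup>2 \<le> \<bar>v - u\<bar>"
proof -
  have "(sqrt v - sqrt u)\<^sup>2 = \<bar>sqrt v - sqrt u\<bar> * \<bar>sqrt v - sqrt u\<bar>" by (simp add: power2_eq_square)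
  also have "\<dots> \<le> \<bar>sqrt v - sqrt u\<bar> * (sqrt v + sqrt u)" 
    using real_sqrt_ge_zero[OF assms(1)] real_sqrt_ge_zero[OF assms(2)] by (intro mult_left_mono) linarith+
  finally show ?thesis using sqrt_diff_times_sum[OF assms] by simp
qed

text \<open>Here \<open>v\<close> is the mean of \<open>Y\<^sup>2\<close> over a step with left value \<open>a\<close> and mean displacement \<open>d\<close>, \<open>A\<close> is the mean
  squared displacement, and \<open>E\<close> is the mean of its drift part. The first bound is
  \<open>(sqrt v - sqrt u)\<^sup>2 \<le> \<bar>v - u\<bar>\<close>; the second one uses
  \<open>\<bar>D\<bar> * (sqrt v + sqrt u) = \<bar>v - u\<bar>\<close> and \<open>\<bar>a\<bar> \<le> sqrt v + sqrt Q\<close>.\<close>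
lemma linear_volatility_bound:
  fixes a z A E d :: real
  assumes v: "v = a\<^sup>2 + 2 * a * z + A + 2 * a * E" "(a + d)\<^sup>2 \<le> v" and A: "d\<^sup>2 \<le> A"
    and D: "D = sqrt v - sqrt (max (a\<^sup>2 + 2 * a * z) 0)" and Q: "Q = A + 2 * \<bar>a\<bar> * \<bar>E\<bar>"
  shows "D\<^sup>2 \<le> Q" "D\<^sup>2 * a\<^sup>2 \<le> 4 * Q\<^sup>2"
proof -
  define u where "u = max (a\<^sup>2 + 2 * a * z) 0"
  have v0: "0 \<le> v" using v(2) by (meson order_trans zero_le_power2)
  have u0: "0 \<le> u" by (simp add: u_def)
  have A0: "0 \<le> A" using A by (meson order_trans zero_le_power2)
  have "\<bar>v - u\<bar> \<le> \<bar>v - (a\<^sup>2 + 2 * a * z)\<bar>" using v0 by (auto simp: u_def max_def)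
  also have "\<dots> = \<bar>A + 2 * a * E\<bar>" by (simp add: v(1))
  also have "\<dots> \<le> Q" unfolding Q using A0 by (intro order_trans[OF abs_triangle_ineq]) (simp add: abs_mult)
  finally have vu: "\<bar>v - u\<bar> \<le> Q" .
  show D2: "D\<^sup>2 \<le> Q" using sqrt_diff_square_le[OF v0 u0] vu D unfolding u_def[symmetric] by simp
  have Q0: "0 \<le> Q" using A0 by (simp add: Q)
  have absD: "\<bar>D\<bar> \<le> sqrt Q" using D2 by (metis real_sqrt_abs real_sqrt_le_mono)
  have "\<bar>a + d\<bar> \<le> sqrt v" using v(2) by (metis real_sqrt_abs real_sqrt_le_mono)
  moreover have "\<bar>d\<bar> \<le> sqrt Q"
  proof -
    have "d\<^sup>2 \<le> Q" using A by (simp add: Q add_increasing2)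
    then show ?thesis by (metis real_sqrt_abs real_sqrt_le_mono)
  qed
  ultimately have a: "\<bar>a\<bar> \<le> sqrt v + sqrt Q" by linarith
  have "\<bar>D\<bar> * \<bar>a\<bar> \<le> \<bar>D\<bar> * (sqrt v + sqrt Q)" using a by (intro mult_left_mono) auto
  also have "\<dots> = \<bar>D\<bar> * sqrt v + \<bar>D\<bar> * sqrt Q" by (rule distrib_left)
  also have "\<dots> \<le> \<bar>D\<bar> * (sqrt v + sqrt u) + sqrt Q * sqrt Q"
    using absD u0 Q0 by (intro add_mono mult_left_mono mult_right_mono) auto
  also have "\<dots> = \<bar>v - u\<bar> + Q" using sqrt_diff_times_sum[OF v0 u0] Q0 by (simp add: D u_def)
  also have "\<dots> \<le> 2 * Q" using vu by simp
  finally have "(\<bar>D\<bar> * \<bar>a\<bar>)\<^sup>2 \<le> (2 * Q)\<^sup>2" by (intro power_mono) auto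
  then show "D\<^sup>2 * a\<^sup>2 \<le> 4 * Q\<^sup>2" by (simp add: power_mult_distrib)
qed

text \<open>Now \<open>v\<close> is the mean of \<open>Y ^ 4\<close>, and \<open>s\<^sup>2\<close>, \<open>A3\<close>, \<open>A2\<close> are the means of the fourth, third and second powers of
  the displacement. If \<open>\<bar>a\<bar>\<close> is at least \<open>2 sqrt s\<close>, then \<open>sqrt v\<close> is at least \<open>a\<^sup>2 / 4\<close> and dividing
  \<open>\<bar>v - u\<bar>\<close> by it removes the growing factors. Otherwise \<open>a\<^sup>2\<close> is at most \<open>4 s\<close> and \<open>D\<^sup>2 \<le> \<bar>v - u\<bar>\<close>
  suffices.\<close>

lemma quadratic_volatility_bound:
  fixes a z s E d A2 A3 :: real
  assumes v: "v = a ^ 4 + 4 * a ^ 3 * z + 4 * a ^ 3 * E + 6 * a\<^sup>2 * A2 + 4 * a * A3 + s\<^sup>2"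
      "(a + d) ^ 4 \<le> v"
    and s: "0 \<le> s" "d\<^sup>2 \<le> s" "0 \<le> A2" "A2 \<le> s" "2 * \<bar>a * A3\<bar> \<le> a\<^sup>2 * A2 + s\<^sup>2"
    and D: "D = sqrt v - sqrt (max (a ^ 4 + 4 * a ^ 3 * z) 0)"
  shows "\<bar>D\<bar> \<le> 16 * (\<bar>a\<bar> * \<bar>E\<bar>) + 35 * s"
proof -
  define u where "u = max (a ^ 4 + 4 * a ^ 3 * z) 0"
  define e where "e = \<bar>a\<bar> * \<bar>E\<bar>"
  define R where "R = 4 * (a\<^sup>2 * e) + 8 * (a\<^sup>2 * s) + 3 * s\<^sup>2"
  have e0: "0 \<le> e" by (simp add: e_def)
  have v0: "0 \<le> v" using v(2) by (meson order_trans zero_le_even_power even_numeral)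
  have u0: "0 \<le> u" by (simp add: u_def)
  have "\<bar>v - u\<bar> \<le> \<bar>v - (a ^ 4 + 4 * a ^ 3 * z)\<bar>" using v0 by (auto simp: u_def max_def)
  also have "\<dots> = \<bar>4 * (a ^ 3 * E) + 6 * (a\<^sup>2 * A2) + 4 * (a * A3) + s\<^sup>2\<bar>" by (simp add: v(1) algebra_simps)
  also have "\<dots> \<le> 4 * \<bar>a ^ 3 * E\<bar> + 6 * (a\<^sup>2 * A2) + 4 * \<bar>a * A3\<bar> + s\<^sup>2"
    using s(3) by (smt (verit) mult_nonneg_nonneg zero_le_power2)
  also have "\<bar>a ^ 3 * E\<bar> = a\<^sup>2 * e"
    by (simp add: e_def abs_mult power3_eq_cube power2_eq_square)
  also have "4 * (a\<^sup>2 * e) + 6 * (a\<^sup>2 * A2) + 4 * \<bar>a * A3\<bar> + s\<^sup>2 \<le> 4 * (a\<^sup>2 * e) + 8 * (a\<^sup>2 * A2) + 3 * s\<^sup>2"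
    using s(5) by linarith
  also have "\<dots> \<le> R" unfolding R_def using s(4) by (simp add: mult_left_mono)
  finally have vu: "\<bar>v - u\<bar> \<le> R" .
  show ?thesis
  proof (cases "2 * sqrt s \<le> \<bar>a\<bar>")
    case True
    have as: "4 * s \<le> a\<^sup>2"
    proof -
      have "(2 * sqrt s)\<^sup>2 \<le> \<bar>a\<bar>\<^sup>2" using True s(1) by (intro power_mono) auto
      then show ?thesis using s(1) by (simp add: power_mult_distrib)
    qed
    show ?thesis
    proof (cases "a = 0")
      case True
      then have "s = 0" using as s(1) by simp
      then have "R = 0" using True by (simp add: R_def)
      then have "D\<^sup>2 \<le> 0" using sqrt_diff_square_le[OF v0 u0] vu D unfolding u_def[symmetric] by simp
      then show ?thesis using \<open>s = 0\<close> by simp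
    next
      case False
      have "\<bar>d\<bar> \<le> sqrt s" using s(2) by (metis real_sqrt_abs real_sqrt_le_mono)
      then have "\<bar>a\<bar> / 2 \<le> \<bar>a + d\<bar>" using True by linarith
      then have "(\<bar>a\<bar> / 2)\<^sup>2 \<le> \<bar>a + d\<bar>\<^sup>2" by (intro power_mono) auto
      then have "a\<^sup>2 / 4 \<le> (a + d)\<^sup>2" by (simp add: power_divide)
      also have "(a + d)\<^sup>2 \<le> sqrt v"
      proof (rule real_le_rsqrt)
        show "((a + d)\<^sup>2)\<^sup>2 \<le> v" using v(2) by (simp add: power_mult[symmetric])
      qed
      finally have sv: "a\<^sup>2 / 4 \<le> sqrt v" .
      have "\<bar>D\<bar> * (a\<^sup>2 / 4) \<le> \<bar>D\<bar> * (sqrt v + sqrt u)" using sv real_sqrt_ge_zero[OF u0] by (intro mult_left_mono) linarith+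
      also have "\<dots> \<le> R" using sqrt_diff_times_sum[OF v0 u0] vu by (simp add: D u_def)
      also have "R \<le> 4 * (a\<^sup>2 * e) + 8 * (a\<^sup>2 * s) + 3 * (a\<^sup>2 / 4 * s)"
        unfolding R_def power2_eq_square[of s] using as s(1) by (intro add_left_mono mult_left_mono mult_right_mono) auto
      also have "\<dots> = (16 * e + 35 * s) * (a\<^sup>2 / 4)" by (simp add: algebra_simps)
      finally have "\<bar>D\<bar> \<le> 16 * e + 35 * s" using False by (simp add: mult_le_cancel_right)
      then show ?thesis by (simp add: e_def)
    qed
  next
    case False
    have as: "a\<^sup>2 \<le> 4 * s"
    proof -
      have "\<bar>a\<bar>\<^sup>2 \<le> (2 * sqrt s)\<^sup>2" using False by (intro power_mono) auto
      then show ?thesis using s(1) by (simp add: power_mult_distrib)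
    qed
    have "D\<^sup>2 \<le> R" using sqrt_diff_square_le[OF v0 u0] vu D unfolding u_def[symmetric] by simp
    also have "R \<le> 4 * (4 * s * e) + 8 * (4 * s * s) + 3 * s\<^sup>2"
      unfolding R_def using as s(1) e0 by (intro add_mono mult_left_mono mult_right_mono order_refl) auto
    also have "\<dots> \<le> (8 * e + 6 * s)\<^sup>2"
      using e0 s(1) by (simp add: power2_eq_square algebra_simps)
    finally have "\<bar>D\<bar> \<le> 8 * e + 6 * s" using e0 s(1) by (metis abs_le_square_iff abs_of_nonneg add_nonneg_nonneg mult_nonneg_nonneg zero_le_numeral)
    then show ?thesis using e0 s(1) unfolding e_def[symmetric] by linarith
  qed
qed

section \<open>Real powers and the Cauchy weight\<close>

text \<open>Jensen's inequality for a real exponent. The function \<open>x powr p\<close> is convex on the open half line, and zero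
  entries are reached by shifting all entries by a small positive amount.\<close>
lemma mean_powr_le:
  fixes x :: "nat \<Rightarrow> real"
  assumes N: "0 < N" and p: "1 \<le> p" and x: "\<And>l. l < N \<Longrightarrow> 0 \<le> x l"
  shows "((\<Sum>l<N. x l) / real N) powr p \<le> (\<Sum>l<N. x l powr p) / real N"
proof (rule LIMSEQ_le)
  let ?e = "\<lambda>n. inverse (real (Suc n))"
  have e: "?e \<longlonglongrightarrow> 0" by (rule LIMSEQ_inverse_real_of_nat)
  show "(\<lambda>n. ((\<Sum>l<N. x l + ?e n) / real N) powr p) \<longlonglongrightarrow> ((\<Sum>l<N. x l) / real N) powr p"
  proof (rule tendsto_powr')
    have "(\<lambda>n. (\<Sum>l<N. x l + ?e n) / real N) \<longlonglongrightarrow> (\<Sum>l<N. x l + 0) / real N"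
      by (intro tendsto_intros e) (use N in auto)
    then show "(\<lambda>n. (\<Sum>l<N. x l + ?e n) / real N) \<longlonglongrightarrow> (\<Sum>l<N. x l) / real N" by simp
    have "0 \<le> (\<Sum>l<N. x l + ?e n) / real N" for n
      using x by (intro divide_nonneg_nonneg sum_nonneg add_nonneg_nonneg) auto
    then show "(\<Sum>l<N. x l) / real N \<noteq> 0 \<or> 0 < p \<and> (\<forall>\<^sub>F n in sequentially. 0 \<le> (\<Sum>l<N. x l + ?e n) / real N)"
      using p by (auto intro!: always_eventually)
  qed (rule tendsto_const)
  show "(\<lambda>n. (\<Sum>l<N. (x l + ?e n) powr p) / real N) \<longlonglongrightarrow> (\<Sum>l<N. x l powr p) / real N"
  proof (intro tendsto_divide tendsto_sum tendsto_const)
    fix l assume "l \<in> {..<N}"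
    then have xl: "0 \<le> x l" using x by simp
    have "(\<lambda>n. x l + ?e n) \<longlonglongrightarrow> x l + 0" by (intro tendsto_intros e)
    then show "(\<lambda>n. (x l + ?e n) powr p) \<longlonglongrightarrow> x l powr p"
      using p xl by (intro tendsto_powr') (auto intro!: always_eventually)
  qed (use N in auto)
  show "\<exists>n0. \<forall>n\<ge>n0. ((\<Sum>l<N. x l + ?e n) / real N) powr p \<le> (\<Sum>l<N. (x l + ?e n) powr p) / real N"
  proof (intro exI allI impI)
    fix n
    have "(\<Sum>l<N. inverse (real N) *\<^sub>R (x l + ?e n)) powr p \<le> (\<Sum>l<N. inverse (real N) * (x l + ?e n) powr p)"
      using N x by (intro convex_on_sum[OF _ _ powr_convex[OF p]]) (auto intro!: add_nonneg_pos)
    then show "((\<Sum>l<N. x l + ?e n) / real N) powr p \<le> (\<Sum>l<N. (x l + ?e n) powr p) / real N"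
      unfolding real_scaleR_def sum_distrib_left[symmetric] by (simp add: divide_inverse mult.commute)
  qed
qed

lemma powr_rate:
  fixes \<delta> :: real
  assumes "0 < \<delta>" "\<delta> \<le> T" "e \<le> e1"
  shows "\<delta> powr e1 \<le> T powr (e1 - e) * \<delta> powr e"
proof -
  have "\<delta> powr e1 = \<delta> powr (e1 - e) * \<delta> powr e" by (simp add: powr_add[symmetric])
  also have "\<dots> \<le> T powr (e1 - e) * \<delta> powr e" using assms by (intro mult_right_mono powr_mono2) auto
  finally show ?thesis .
qed

text \<open>A continuous substitute for \<open>min 1 ((x / y)\<^sup>2)\<close>, whose integral over \<open>y\<close> is proportional to \<open>x\<close>.\<close>
definition cauchy_weight :: "real \<Rightarrow> real \<Rightarrow> real" where
  "cauchy_weight x y = x\<^sup>2 / (x\<^sup>2 + y\<^sup>2)"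

lemma cauchy_weight_nonneg: "0 \<le> cauchy_weight x y"
  by (simp add: cauchy_weight_def)

lemma cauchy_weight_le_1: "cauchy_weight x y \<le> 1"
  by (auto simp: cauchy_weight_def divide_le_eq_1 add_pos_nonneg sum_power2_gt_zero_iff intro: zero_less_power2)

lemma cauchy_weight_continuous: "0 < x \<Longrightarrow> continuous_on UNIV (cauchy_weight x)"
  unfolding cauchy_weight_def[abs_def]
  by (intro continuous_intros) (simp add: add_pos_nonneg less_imp_neq[symmetric])

lemma nn_integral_cauchy_weight:
  assumes x: "0 < x"
  shows "(\<integral>\<^sup>+y. ennreal (cauchy_weight x y) \<partial>lborel) = ennreal (pi * x)"
proof -
  have [measurable]: "cauchy_weight x \<in> borel_measurable borel"
    using cauchy_weight_continuous[OF x] by (rule borel_measurable_continuous_onI)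
  have e: "einterval (- \<infinity>) \<infinity> = UNIV" by (auto simp: einterval_def)
  have int: "integrable lborel (\<lambda>y::real. inverse (1 + y\<^sup>2))" "(\<integral>y. inverse (1 + y\<^sup>2) \<partial>lborel) = pi"
    using integrable_inverse_1_plus_square LBINT_inverse_1_plus_square
    by (simp_all add: set_integrable_def interval_lebesgue_integral_def set_lebesgue_integral_def e)
  have "(\<integral>\<^sup>+y. ennreal (cauchy_weight x y) \<partial>lborel) = ennreal \<bar>x\<bar> * (\<integral>\<^sup>+y. ennreal (cauchy_weight x (0 + x * y)) \<partial>lborel)"
    using x by (intro nn_integral_real_affine) auto
  also have "(\<integral>\<^sup>+y. ennreal (cauchy_weight x (0 + x * y)) \<partial>lborel) = (\<integral>\<^sup>+y. ennreal (inverse (1 + y\<^sup>2)) \<partial>lborel)"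
  proof (intro nn_integral_cong arg_cong[where f=ennreal])
    fix y :: real
    have "x\<^sup>2 + (x * y)\<^sup>2 = x\<^sup>2 * (1 + y\<^sup>2)" by (simp add: power_mult_distrib algebra_simps)
    then show "cauchy_weight x (0 + x * y) = inverse (1 + y\<^sup>2)" using x by (simp add: cauchy_weight_def divide_inverse)
  qed
  also have "\<dots> = ennreal pi" using int by (subst nn_integral_eq_integral) auto
  finally show ?thesis using x by (simp add: ennreal_mult[symmetric] mult.commute)
qed

lemma (in prob_space) moments_O_powr:
  assumes X: "moments_O I X c" and p: "0 < p"
  obtains C where "0 \<le> C" "\<And>i. i \<in> I \<Longrightarrow> (\<integral>\<^sup>+\<omega>. ennreal (\<bar>X i \<omega>\<bar> powr p) \<partial>M) \<le> ennreal (C * c i powr p)"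
proof -
  define m where "m = nat \<lceil>p\<rceil>"
  have m: "p \<le> real m" unfolding m_def by linarith
  obtain C where C: "C \<ge> 0" "\<And>i. i \<in> I \<Longrightarrow> abs_moment (X i) m \<le> ennreal (C * c i ^ m)"
    using moments_OE[OF X] by blast
  have "(\<integral>\<^sup>+\<omega>. ennreal (\<bar>X i \<omega>\<bar> powr p) \<partial>M) \<le> ennreal ((1 + C) * c i powr p)" if i: "i \<in> I" for i
  proof -
    have c: "0 < c i" using moments_OD2[OF X i] .
    note [measurable] = moments_OD1[OF X i]
    \<comment> \<open>comparison with the power \<open>m\<close> after scaling by the rate\<close>
    have le: "\<bar>X i \<omega>\<bar> powr p \<le> c i powr p * (1 + (1 / c i ^ m) * \<bar>X i \<omega>\<bar> ^ m)" for \<omega>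
    proof -
      have "c i * (\<bar>X i \<omega>\<bar> / c i) = \<bar>X i \<omega>\<bar>" using c by simp
      then have "\<bar>X i \<omega>\<bar> powr p = (c i * (\<bar>X i \<omega>\<bar> / c i)) powr p" by (simp only:)
      also have "\<dots> = c i powr p * (\<bar>X i \<omega>\<bar> / c i) powr p" by (rule powr_mult)
      also have "\<dots> \<le> c i powr p * (1 + (\<bar>X i \<omega>\<bar> / c i) ^ m)"
        using c p m by (intro mult_left_mono powr_le_1_plus_power) auto
      finally show ?thesis by (simp add: power_divide)
    qed
    have "(\<integral>\<^sup>+\<omega>. ennreal (\<bar>X i \<omega>\<bar> powr p) \<partial>M) \<le> ennreal (c i powr p * (1 + 1 / c i ^ m * (C * c i ^ m)))"
      using c C(1) C(2)[OF i] le 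
      by (intro nn_integral_affine_bound[where a="\<lambda>_. 1" and b="\<lambda>\<omega>. \<bar>X i \<omega>\<bar> ^ m"]) (auto simp: emeasure_space_1)
    also have "c i powr p * (1 + 1 / c i ^ m * (C * c i ^ m)) = (1 + C) * c i powr p"
      using c by (simp add: mult.commute)
    finally show ?thesis .
  qed
  then show ?thesis using C(1) by (intro that[of "1 + C"]) auto
qed

section \<open>Moments of the volatility error\<close>

context ornstein_uhlenbeck
begin

lemma Y_start: "AE \<omega> in M. Y 0 \<omega> = y0"
  using Y_equation W_start by eventually_elim (use T in auto)

text \<open>Two bounds are combined. The density of \<open>Y\<^sub>t\<close> yields \<open>x / sqrt t\<close>, which suffices when
  \<open>sqrt t \<ge> x powr \<eta>\<close>. For smaller \<open>t\<close> the value \<open>Y\<^sub>t\<close> is near zero only if it has moved by \<open>\<bar>y0\<bar> / 2\<close> from its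
  starting point, and a high moment of this displacement is smaller than any given power of \<open>x\<close>.\<close>
lemma cauchy_weight_expectation:
  assumes y0: "y0 \<noteq> 0" and \<eta>: "0 < \<eta>" "\<eta> < 1" and X: "0 < X"
  obtains C where "0 \<le> C"
    "\<And>x t. 0 < x \<Longrightarrow> x \<le> X \<Longrightarrow> t \<in> {0..T} \<Longrightarrow>
      (\<integral>\<^sup>+\<omega>. ennreal (cauchy_weight x (Y t \<omega>)) \<partial>M) \<le> ennreal (C * x powr (1 - \<eta>))"
proof -
  \<comment> \<open>then \<open>(x powr \<eta>) ^ k\<close> is at most of the order of \<open>x\<close>\<close>
  define k where "k = nat \<lceil>1 / \<eta>\<rceil>"
  have k: "1 / \<eta> \<le> real k" unfolding k_def by linarith
  then have \<eta>k: "1 \<le> \<eta> * real k" using \<eta> by (simp add: field_simps)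
  have "moments_O {0<..T} (\<lambda>t. (\<lambda>(i, s) \<omega>. Y s \<omega> - Y (fst i) \<omega>) ((0, t), t)) (\<lambda>t. (\<lambda>(i, s). sqrt (len i)) ((0, t), t))"
    by (rule moments_O_reindex[OF Y_inside_moments]) (auto simp: pointed_intervals_def intervals_def)
  then have "moments_O {0<..T} (\<lambda>t \<omega>. Y t \<omega> - Y 0 \<omega>) (\<lambda>t. sqrt t)" by simp
  then obtain Cm where Cm: "0 \<le> Cm" "\<And>t. t \<in> {0<..T} \<Longrightarrow> abs_moment (\<lambda>\<omega>. Y t \<omega> - Y 0 \<omega>) k \<le> ennreal (Cm * sqrt t ^ k)"
    using moments_OE by blast
  define K where "K = exp (\<bar>\<kappa>\<bar> * T) / \<nu>"
  have K: "0 \<le> K" using nu by (simp add: K_def)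
  define a where "a = 4 / y0\<^sup>2"
  define b where "b = (2 / \<bar>y0\<bar>) ^ k"
  have ab: "0 \<le> a" "0 \<le> b" by (auto simp: a_def b_def)
  have Xp: "0 \<le> X powr (1 + \<eta>)" "0 \<le> X powr (\<eta> * real k - (1 - \<eta>))" by auto
  have density: "(\<integral>\<^sup>+\<omega>. ennreal (cauchy_weight x (Y t \<omega>)) \<partial>M) \<le> ennreal (K / sqrt t * (pi * x))"
    if "0 < x" "t \<in> {0<..T}" for x t
  proof -
    have "(\<integral>\<^sup>+\<omega>. ennreal (cauchy_weight x (Y t \<omega>)) \<partial>M) \<le> ennreal (exp (\<bar>\<kappa>\<bar> * T) / (\<nu> * sqrt t)) * (\<integral>\<^sup>+y. ennreal (cauchy_weight x y) \<partial>lborel)"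
      using that by (intro Y_density_bound cauchy_weight_continuous cauchy_weight_nonneg) auto
    also have "\<dots> = ennreal (K / sqrt t * (pi * x))"
      using nn_integral_cauchy_weight[OF that(1)] that nu by (simp add: K_def ennreal_mult[symmetric])
    finally show ?thesis .
  qed
  have small: "cauchy_weight x y \<le> a * x\<^sup>2 + b * \<bar>y - y0\<bar> ^ k" if "0 < x" for x y
  proof (cases "\<bar>y0\<bar> / 2 \<le> \<bar>y\<bar>")
    case True
    then have "(\<bar>y0\<bar> / 2)\<^sup>2 \<le> \<bar>y\<bar>\<^sup>2" by (intro power_mono) auto
    then have y: "y0\<^sup>2 / 4 \<le> x\<^sup>2 + y\<^sup>2" by (simp add: power_divide add_increasing)
    have "cauchy_weight x y \<le> x\<^sup>2 / (y0\<^sup>2 / 4)"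
      unfolding cauchy_weight_def using y y0 that by (intro divide_left_mono) (auto intro!: mult_pos_pos add_pos_nonneg)
    also have "\<dots> = a * x\<^sup>2" by (simp add: a_def)
    finally show ?thesis using ab by (simp add: add_increasing2)
  next
    case False
    then have "\<bar>y0\<bar> / 2 \<le> \<bar>y - y0\<bar>" by linarith
    then have "1 \<le> 2 / \<bar>y0\<bar> * \<bar>y - y0\<bar>" using y0 by (simp add: field_simps)
    then have "1 \<le> (2 / \<bar>y0\<bar> * \<bar>y - y0\<bar>) ^ k" by (rule one_le_power)
    then have "1 \<le> b * \<bar>y - y0\<bar> ^ k" by (simp only: b_def power_mult_distrib)
    then show ?thesis using cauchy_weight_le_1[of x y] ab by (smt (verit) mult_nonneg_nonneg zero_le_power2)
  qed
  define C where "C = K * pi + a * X powr (1 + \<eta>) + b * Cm * X powr (\<eta> * real k - (1 - \<eta>))"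
  have C: "0 \<le> C" unfolding C_def using K ab Cm(1) Xp by (intro add_nonneg_nonneg mult_nonneg_nonneg) auto
  have x2: "a * x\<^sup>2 \<le> a * X powr (1 + \<eta>) * x powr (1 - \<eta>)" if "0 < x" "x \<le> X" for x
  proof -
    have "x\<^sup>2 = x powr 2" using that by (simp add: powr_numeral)
    also have "\<dots> \<le> X powr (2 - (1 - \<eta>)) * x powr (1 - \<eta>)" using that \<eta> by (intro powr_rate) auto
    also have "2 - (1 - \<eta>) = 1 + \<eta>" by simp
    finally show ?thesis using ab by (simp add: mult.assoc mult_left_mono)
  qed
  show ?thesis
  proof (rule that[OF C])
    fix x t assume x: "0 < x" "x \<le> X" and t: "t \<in> {0..T}"
    have xp: "0 \<le> x powr (1 - \<eta>)" by simp
    note [measurable] = Y_measurable[OF t] Y_measurable[of 0]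
    show "(\<integral>\<^sup>+\<omega>. ennreal (cauchy_weight x (Y t \<omega>)) \<partial>M) \<le> ennreal (C * x powr (1 - \<eta>))"
    proof (cases "0 < t \<and> x powr \<eta> \<le> sqrt t")
      case True
      have "K / sqrt t * (pi * x) \<le> K / x powr \<eta> * (pi * x)"
        using True K x by (intro mult_right_mono divide_left_mono) auto
      also have "\<dots> = K * pi * x powr (1 - \<eta>)" using x by (simp add: powr_diff)
      also have "\<dots> \<le> C * x powr (1 - \<eta>)"
      proof (rule mult_right_mono[OF _ xp])
        have "0 \<le> a * X powr (1 + \<eta>)" "0 \<le> b * Cm * X powr (\<eta> * real k - (1 - \<eta>))"
          using ab Cm(1) by auto
        then show "K * pi \<le> C" unfolding C_def by linarith
      qed
      finally have "ennreal (K / sqrt t * (pi * x)) \<le> ennreal (C * x powr (1 - \<eta>))" by (rule ennreal_leI)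
      moreover have "(\<integral>\<^sup>+\<omega>. ennreal (cauchy_weight x (Y t \<omega>)) \<partial>M) \<le> ennreal (K / sqrt t * (pi * x))"
        using True t by (intro density x) auto
      ultimately show ?thesis by (rule order_trans[rotated])
    next
      case False
      have moment: "abs_moment (\<lambda>\<omega>. Y t \<omega> - y0) k \<le> ennreal (Cm * sqrt t ^ k)"
      proof -
        have "abs_moment (\<lambda>\<omega>. Y t \<omega> - y0) k = abs_moment (\<lambda>\<omega>. Y t \<omega> - Y 0 \<omega>) k"
          using Y_start by (intro nn_integral_cong_AE) (auto elim!: eventually_mono)
        also have "\<dots> \<le> ennreal (Cm * sqrt t ^ k)"
        proof (cases "t = 0")
          case True
          have "k > 0" using \<eta>k \<eta> by (intro gr0I) auto
          then show ?thesis using True by (simp add: power_0_left)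
        next
          case False then show ?thesis using Cm(2)[of t] t by auto
        qed
        finally show ?thesis .
      qed
      have "sqrt t ^ k \<le> x powr (\<eta> * real k)"
      proof -
        have "sqrt t \<le> x powr \<eta>" using False t by (cases "t = 0") auto
        then have "sqrt t ^ k \<le> (x powr \<eta>) ^ k" using t by (intro power_mono) auto
        also have "\<dots> = x powr (\<eta> * real k)" using x by (simp add: powr_realpow[symmetric] powr_powr)
        finally show ?thesis .
      qed
      also have "x powr (\<eta> * real k) \<le> X powr (\<eta> * real k - (1 - \<eta>)) * x powr (1 - \<eta>)"
        using x \<eta> \<eta>k by (intro powr_rate) auto
      finally have tk: "b * (Cm * sqrt t ^ k) \<le> b * Cm * X powr (\<eta> * real k - (1 - \<eta>)) * x powr (1 - \<eta>)"
        using ab Cm(1) by (simp add: mult.assoc mult_left_mono)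
      have "(\<integral>\<^sup>+\<omega>. ennreal (cauchy_weight x (Y t \<omega>)) \<partial>M) \<le> ennreal (1 * (a * x\<^sup>2 + b * (Cm * sqrt t ^ k)))"
        using small[OF x(1)] moment ab Cm(1) t
        by (intro nn_integral_affine_bound[where a="\<lambda>_. a * x\<^sup>2" and b="\<lambda>\<omega>. \<bar>Y t \<omega> - y0\<bar> ^ k"]) (auto simp: emeasure_space_1)
      also have "\<dots> \<le> ennreal (C * x powr (1 - \<eta>))"
      proof (rule ennreal_leI)
        have "0 \<le> K * pi * x powr (1 - \<eta>)" using K by simp
        then show "1 * (a * x\<^sup>2 + b * (Cm * sqrt t ^ k)) \<le> C * x powr (1 - \<eta>)"
          using x2[OF x] tk unfolding C_def distrib_right mult_1 by linarith
      qed
      finally show ?thesis .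
    qed
  qed
qed

lemma increment_avg_moments:
  "moments_O (intervals T) (\<lambda>i \<omega>. Y_mean k i \<omega>) (\<lambda>i. sqrt (len i) ^ k)"
proof (rule moments_O_time_avg)
  show "moments_O (SIGMA i:intervals T. {fst i..snd i}) (\<lambda>(i, s) \<omega>. (Y s \<omega> - Y (fst i) \<omega>) ^ k) (\<lambda>(i, s). sqrt (len i) ^ k)"
    using moments_O_power[OF Y_inside_moments, of k] by (simp add: pointed_intervals_def case_prod_unfold)
  fix i \<omega> assume "i \<in> intervals T" "\<omega> \<in> space M"
  then show "continuous_on {fst i..snd i} (\<lambda>s. (Y s \<omega> - Y (fst i) \<omega>) ^ k)"
    by (intro continuous_intros continuous_on_subset[OF Y_continuous]) (auto simp: intervals_def)
qed (auto simp: intervals_def)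

lemma resid_continuous:
  assumes "i \<in> intervals T" "\<omega> \<in> space M"
  shows "continuous_on {fst i..snd i} (\<lambda>s. resid (fst i) s \<omega>)"
  unfolding resid_def using assms
  by (intro continuous_intros continuous_on_subset[OF Y_continuous] continuous_on_subset[OF W_continuous])
    (auto simp: intervals_def)

lemma resid_avg_moments:
  "moments_O (intervals T) (\<lambda>i \<omega>. resid_mean i \<omega>) len"
proof (rule moments_O_time_avg)
  show "moments_O (SIGMA i:intervals T. {fst i..snd i}) (\<lambda>(i, s). resid (fst i) s) (\<lambda>(i, s). len i)"
    using resid_inside_moments by (simp add: pointed_intervals_def)
qed (auto intro: resid_continuous simp: intervals_def)

lemma Y_left_moments: "moments_O (intervals T) (\<lambda>i. Y (fst i)) (\<lambda>_. 1)"
  using moments_O_reindex[OF Y_moments, of "intervals T" fst] by (auto simp: intervals_def)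

text \<open>\<open>P\<close> stands for \<open>\<psi>\<close> and \<open>P'\<close> for its derivative. The infimum of \<open>\<psi>\<close> is zero in both models, hence the
  maximum with \<open>0\<close>.\<close>
definition vol_error :: "(real \<Rightarrow> real) \<Rightarrow> (real \<Rightarrow> real) \<Rightarrow> real \<times> real \<Rightarrow> 'a \<Rightarrow> real" where
  "vol_error P P' i \<omega> = sqrt (time_avg (fst i) (snd i) (\<lambda>s. P (Y s \<omega>)))
     - sqrt (max (P (Y (fst i) \<omega>) + P' (Y (fst i) \<omega>) * (\<nu> * W_mean i \<omega>)) 0)"

lemma W_avg_measurable:
  assumes "i \<in> intervals T"
  shows "(\<lambda>\<omega>. W_mean i \<omega>) \<in> borel_measurable M"
  using assms by (intro time_avg_measurable continuous_intros continuous_on_subset[OF W_continuous]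
          borel_measurable_diff W_measurable) (auto simp: intervals_def)

lemma vol_error_measurable:
  assumes i: "i \<in> intervals T" and P: "continuous_on UNIV P" "continuous_on UNIV P'"
  shows "vol_error P P' i \<in> borel_measurable M"
proof -
  have [measurable]: "P \<in> borel_measurable borel" "P' \<in> borel_measurable borel"
    using P by (auto intro: borel_measurable_continuous_onI)
  have [measurable]: "Y (fst i) \<in> borel_measurable M" using i by (intro Y_measurable) (auto simp: intervals_def)
  note [measurable] = W_avg_measurable[OF i]
  have [measurable]: "(\<lambda>\<omega>. time_avg (fst i) (snd i) (\<lambda>s. P (Y s \<omega>))) \<in> borel_measurable M"
    using i by (intro time_avg_measurable continuous_on_compose2[OF P(1)] continuous_on_subset[OF Y_continuous]
          measurable_compose[OF Y_measurable \<open>P \<in> borel_measurable borel\<close>]) (auto simp: intervals_def)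
  show ?thesis unfolding vol_error_def[abs_def] by measurable
qed

text \<open>Write \<open>Y = a + D\<close> on the interval and expand; the mean of \<open>D\<close> is \<open>z + E\<close>. The last inequality integrates
  \<open>0 \<le> (a D + D\<^sup>2)\<^sup>2\<close> and \<open>0 \<le> (a D - D\<^sup>2)\<^sup>2\<close>.\<close>
lemma interval_decomposition:
  fixes \<omega> assumes i: "i \<in> intervals T" and \<omega>: "\<omega> \<in> space M"
  defines "a \<equiv> Y (fst i) \<omega>"
    and "z \<equiv> \<nu> * W_mean i \<omega>"
    and "E \<equiv> resid_mean i \<omega>"
    and "m k \<equiv> Y_mean k i \<omega>"
  shows "time_avg (fst i) (snd i) (\<lambda>s. (Y s \<omega>)\<^sup>2) = a\<^sup>2 + 2 * a * z + m 2 + 2 * a * E"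
    and "time_avg (fst i) (snd i) (\<lambda>s. Y s \<omega> ^ 4) =
      a ^ 4 + 4 * a ^ 3 * z + 4 * a ^ 3 * E + 6 * a\<^sup>2 * m 2 + 4 * a * m 3 + m 4"
    and "(a + m 1)\<^sup>2 \<le> time_avg (fst i) (snd i) (\<lambda>s. (Y s \<omega>)\<^sup>2)"
    and "(a + m 1) ^ 4 \<le> time_avg (fst i) (snd i) (\<lambda>s. Y s \<omega> ^ 4)"
    and "(m 1)\<^sup>2 \<le> m 2" and "(m 2)\<^sup>2 \<le> m 4" and "0 \<le> m 2" and "0 \<le> m 4"
    and "2 * \<bar>a * m 3\<bar> \<le> a\<^sup>2 * m 2 + m 4"
proof -
  have ab: "fst i < snd i" "{fst i..snd i} \<subseteq> {0..T}" using i by (auto simp: intervals_def)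
  let ?avg = "time_avg (fst i) (snd i)"
  define D where "D s = Y s \<omega> - a" for s
  have Yc: "continuous_on {fst i..snd i} (\<lambda>s. Y s \<omega>)"
    using ab by (intro continuous_on_subset[OF Y_continuous[OF \<omega>]])
  have Dc: "continuous_on {fst i..snd i} D" unfolding D_def by (intro continuous_intros Yc)
  have Wc: "continuous_on {fst i..snd i} (\<lambda>s. W s \<omega> - W (fst i) \<omega>)"
    using ab by (intro continuous_intros continuous_on_subset[OF W_continuous[OF \<omega>]])
  note Rc = resid_continuous[OF i \<omega>]
  have m: "m k = ?avg (\<lambda>s. D s ^ k)" for k by (simp add: m_def D_def a_def)
  have D_split: "D s = \<nu> * (W s \<omega> - W (fst i) \<omega>) + resid (fst i) s \<omega>" for s
    by (simp add: D_def a_def resid_def)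
  have m1: "m 1 = z + E"
  proof -
    have "m 1 = ?avg (\<lambda>s. \<nu> * (W s \<omega> - W (fst i) \<omega>) + resid (fst i) s \<omega>)"
      unfolding m by (simp only: power_one_right) (intro time_avg_cong D_split)
    then show ?thesis unfolding z_def E_def
      by (simp only: time_avg_add time_avg_cmult Wc Rc continuous_intros)
  qed
  then have m1: "m (Suc 0) = z + E" by simp
  have Y: "Y s \<omega> = a + D s" for s by (simp add: D_def)
  have "?avg (\<lambda>s. (Y s \<omega>)\<^sup>2) = ?avg (\<lambda>s. a\<^sup>2 + ((2 * a) * D s ^ 1 + D s ^ 2))"
    by (intro time_avg_cong) (simp add: Y power2_eq_square algebra_simps)
  also have "\<dots> = a\<^sup>2 + ((2 * a) * m 1 + m 2)" unfolding m
    using ab(1) by (simp only: time_avg_add time_avg_cmult time_avg_const Dc continuous_intros)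
  finally show eq2: "?avg (\<lambda>s. (Y s \<omega>)\<^sup>2) = a\<^sup>2 + 2 * a * z + m 2 + 2 * a * E"
    by (simp add: m1 algebra_simps)
  have "?avg (\<lambda>s. Y s \<omega> ^ 4) = ?avg (\<lambda>s. a ^ 4 + ((4 * a ^ 3) * D s ^ 1 + ((6 * a ^ 2) * D s ^ 2 + ((4 * a) * D s ^ 3 + D s ^ 4))))"
    by (intro time_avg_cong) (simp add: Y power2_eq_square power3_eq_cube power4_eq_xxxx algebra_simps)
  also have "\<dots> = a ^ 4 + ((4 * a ^ 3) * m 1 + ((6 * a ^ 2) * m 2 + ((4 * a) * m 3 + m 4)))" unfolding m
    using ab(1) by (simp only: time_avg_add time_avg_cmult time_avg_const Dc continuous_intros)
  finally show eq4: "?avg (\<lambda>s. Y s \<omega> ^ 4) =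
      a ^ 4 + 4 * a ^ 3 * z + 4 * a ^ 3 * E + 6 * a\<^sup>2 * m 2 + 4 * a * m 3 + m 4"
    by (simp add: m1 algebra_simps)
  have meanY: "?avg (\<lambda>s. Y s \<omega>) = a + m 1"
  proof -
    have "?avg (\<lambda>s. Y s \<omega>) = ?avg (\<lambda>s. a + D s ^ 1)" by (intro time_avg_cong) (simp add: Y)
    then show ?thesis unfolding m using ab(1) by (simp only: time_avg_add time_avg_const Dc continuous_intros)
  qed
  show sq: "(a + m 1)\<^sup>2 \<le> ?avg (\<lambda>s. (Y s \<omega>)\<^sup>2)"
    using time_avg_square_ge[OF ab(1) Yc] by (simp only: meanY)
  have "((a + m 1)\<^sup>2)\<^sup>2 \<le> (?avg (\<lambda>s. (Y s \<omega>)\<^sup>2))\<^sup>2" using sq by (intro power_mono) auto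
  also have "\<dots> \<le> ?avg (\<lambda>s. ((Y s \<omega>)\<^sup>2)\<^sup>2)" by (intro time_avg_square_ge ab continuous_intros Yc)
  finally show "(a + m 1) ^ 4 \<le> ?avg (\<lambda>s. Y s \<omega> ^ 4)" by (simp add: power_mult[symmetric])
  show "(m 1)\<^sup>2 \<le> m 2" using time_avg_square_ge[OF ab(1) Dc] by (simp add: m)
  have "(?avg (\<lambda>s. D s ^ 2))\<^sup>2 \<le> ?avg (\<lambda>s. (D s ^ 2)\<^sup>2)"
    by (intro time_avg_square_ge ab continuous_intros Dc)
  then show m24: "(m 2)\<^sup>2 \<le> m 4" by (simp add: m power_mult[symmetric])
  have nonneg: "0 \<le> ?avg g" if "continuous_on {fst i..snd i} g" "\<And>s. 0 \<le> g s" for g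
    using time_avg_mono[OF ab(1) continuous_on_const that(1), of 0] that(2) time_avg_const[OF ab(1), of 0] by simp
  show "0 \<le> m 2" "0 \<le> m 4" unfolding m by (intro nonneg continuous_intros Dc; simp)+
  have "0 \<le> ?avg (\<lambda>s. a\<^sup>2 * D s ^ 2 + ((2 * a) * D s ^ 3 + D s ^ 4))"
  proof (intro nonneg continuous_intros Dc)
    fix s
    have "0 \<le> (a * D s + D s ^ 2)\<^sup>2" by simp
    also have "\<dots> = a\<^sup>2 * D s ^ 2 + ((2 * a) * D s ^ 3 + D s ^ 4)" by (simp add: power2_eq_square power3_eq_cube power4_eq_xxxx algebra_simps)
    finally show "0 \<le> a\<^sup>2 * D s ^ 2 + ((2 * a) * D s ^ 3 + D s ^ 4)" .
  qed
  also have "\<dots> = a\<^sup>2 * m 2 + ((2 * a) * m 3 + m 4)" unfolding m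
    by (simp only: time_avg_add time_avg_cmult Dc continuous_intros)
  finally have 1: "0 \<le> a\<^sup>2 * m 2 + ((2 * a) * m 3 + m 4)" .
  have "0 \<le> ?avg (\<lambda>s. a\<^sup>2 * D s ^ 2 + ((- 2 * a) * D s ^ 3 + D s ^ 4))"
  proof (intro nonneg continuous_intros Dc)
    fix s
    have "0 \<le> (a * D s - D s ^ 2)\<^sup>2" by simp
    also have "\<dots> = a\<^sup>2 * D s ^ 2 + ((- 2 * a) * D s ^ 3 + D s ^ 4)" by (simp add: power2_eq_square power3_eq_cube power4_eq_xxxx algebra_simps)
    finally show "0 \<le> a\<^sup>2 * D s ^ 2 + ((- 2 * a) * D s ^ 3 + D s ^ 4)" .
  qed
  also have "\<dots> = a\<^sup>2 * m 2 + ((- 2 * a) * m 3 + m 4)" unfolding m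
    by (simp only: time_avg_add time_avg_cmult Dc continuous_intros)
  finally show "2 * \<bar>a * m 3\<bar> \<le> a\<^sup>2 * m 2 + m 4" using 1 by (simp add: abs_if)
qed

lemma quadratic_vol_error_moments:
  "moments_O (intervals T) (vol_error (\<lambda>y. y ^ 4) (\<lambda>y. 4 * y ^ 3)) len"
proof -
  let ?I = "intervals T"
  let ?s = "\<lambda>i \<omega>. sqrt (Y_mean 4 i \<omega>)"
  let ?E = "\<lambda>i \<omega>. resid_mean i \<omega>"
  have pos: "0 < len i" if "i \<in> ?I" for i using that by (auto simp: intervals_def)
  have s: "moments_O ?I ?s len"
  proof (rule moments_O_of_square)
    have "moments_O ?I (\<lambda>i \<omega>. Y_mean 4 i \<omega>) (\<lambda>i. (len i)\<^sup>2)"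
    proof (rule moments_O_rate[OF increment_avg_moments, where K=1])
      fix i assume "i \<in> ?I"
      then have i: "0 < len i" by (rule pos)
      then show "0 < (len i)\<^sup>2" by simp
      have "sqrt (len i) ^ 4 = (sqrt (len i) ^ 2) ^ 2" by (simp add: power_mult[symmetric])
      then show "sqrt (len i) ^ 4 \<le> 1 * (len i)\<^sup>2" using i by simp
    qed
    then show "moments_O ?I (\<lambda>i \<omega>. (?s i \<omega>)\<^sup>2) (\<lambda>i. (len i)\<^sup>2)"
    proof (rule moments_O_cong_AE)
      fix i assume i: "i \<in> ?I"
      show "(\<lambda>\<omega>. (?s i \<omega>)\<^sup>2) \<in> borel_measurable M"
        using moments_OD1[OF increment_avg_moments[of 4] i] by measurable
      show "AE \<omega> in M. (?s i \<omega>)\<^sup>2 = Y_mean 4 i \<omega>"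
        by (rule AE_I2) (simp add: interval_decomposition(8)[OF i])
    qed
    show "?s i \<in> borel_measurable M" if "i \<in> ?I" for i
      using moments_OD1[OF increment_avg_moments[of 4] that] by measurable
  qed (rule pos)
  have aE: "moments_O ?I (\<lambda>i \<omega>. \<bar>Y (fst i) \<omega>\<bar> * \<bar>?E i \<omega>\<bar>) len"
    by (intro bounded_moments_mult moments_O_abs Y_left_moments resid_avg_moments)
  have "moments_O ?I (\<lambda>i \<omega>. 16 * (\<bar>Y (fst i) \<omega>\<bar> * \<bar>?E i \<omega>\<bar>) + 35 * ?s i \<omega>) len"
    by (rule moments_O_add[OF moments_O_cmult[OF aE] moments_O_cmult[OF s]])
  then show ?thesis
  proof (rule moments_O_mono)
    fix i assume i: "i \<in> ?I"
    show "vol_error (\<lambda>y. y ^ 4) (\<lambda>y. 4 * y ^ 3) i \<in> borel_measurable M"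
      by (intro vol_error_measurable i continuous_intros)
    show "AE \<omega> in M. \<bar>vol_error (\<lambda>y. y ^ 4) (\<lambda>y. 4 * y ^ 3) i \<omega>\<bar> \<le> \<bar>16 * (\<bar>Y (fst i) \<omega>\<bar> * \<bar>?E i \<omega>\<bar>) + 35 * ?s i \<omega>\<bar>"
    proof (rule AE_I2)
      fix \<omega> assume \<omega>: "\<omega> \<in> space M"
      note dec = interval_decomposition[OF i \<omega>]
      let ?m = "\<lambda>k. Y_mean k i \<omega>"
      have s2: "(?s i \<omega>)\<^sup>2 = ?m 4" using dec(8) by simp
      have "?m 2 \<le> ?s i \<omega>" using dec(6) by (rule real_le_rsqrt)
      moreover from this dec(5) have "(?m 1)\<^sup>2 \<le> ?s i \<omega>" by (rule order_trans[rotated])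
      ultimately have m: "(?m 1)\<^sup>2 \<le> ?s i \<omega>" "?m 2 \<le> ?s i \<omega>" by blast+
      have s0: "0 \<le> ?s i \<omega>" using dec(8) by (rule real_sqrt_ge_zero)
      have "\<bar>vol_error (\<lambda>y. y ^ 4) (\<lambda>y. 4 * y ^ 3) i \<omega>\<bar> \<le> 16 * (\<bar>Y (fst i) \<omega>\<bar> * \<bar>?E i \<omega>\<bar>) + 35 * ?s i \<omega>"
      proof (rule quadratic_volatility_bound[where d="?m 1" and ?A2.0="?m 2" and ?A3.0="?m 3" and a="Y (fst i) \<omega>"
            and z="\<nu> * W_mean i \<omega>"
            and v="time_avg (fst i) (snd i) (\<lambda>s. Y s \<omega> ^ 4)", OF _ dec(4) s0 m(1) dec(7) m(2)])
        show "2 * \<bar>Y (fst i) \<omega> * ?m 3\<bar> \<le> (Y (fst i) \<omega>)\<^sup>2 * ?m 2 + (?s i \<omega>)\<^sup>2" unfolding s2 by (rule dec(9))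
        show "time_avg (fst i) (snd i) (\<lambda>s. Y s \<omega> ^ 4) = Y (fst i) \<omega> ^ 4
            + 4 * Y (fst i) \<omega> ^ 3 * (\<nu> * W_mean i \<omega>)
            + 4 * Y (fst i) \<omega> ^ 3 * ?E i \<omega> + 6 * (Y (fst i) \<omega>)\<^sup>2 * ?m 2 + 4 * Y (fst i) \<omega> * ?m 3 + (?s i \<omega>)\<^sup>2"
          unfolding s2 by (rule dec(2))
      qed (simp only: vol_error_def)
      then show "\<bar>vol_error (\<lambda>y. y ^ 4) (\<lambda>y. 4 * y ^ 3) i \<omega>\<bar> \<le> \<bar>16 * (\<bar>Y (fst i) \<omega>\<bar> * \<bar>?E i \<omega>\<bar>) + 35 * ?s i \<omega>\<bar>" by linarith
    qed
  qed
qed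

text \<open>Let \<open>\<delta>\<close> be the length of the interval and \<open>x = \<delta> powr ((1 - \<eta>) / 2)\<close>, slightly larger than \<open>sqrt \<delta>\<close>.
  Where \<open>Q \<le> x\<^sup>2\<close>, adding \<open>x\<^sup>2\<close> times the first pathwise bound to the second one gives
  \<open>D\<^sup>2 \<le> 5 x\<^sup>2 cauchy_weight x a\<close>, and the weight has expectation of order \<open>x powr (1 - \<eta>)\<close>. Where
  \<open>Q > x\<^sup>2\<close>, a high power of \<open>Q / x\<^sup>2\<close> is inserted, whose moments are bounded by high powers of
  \<open>\<delta> powr \<eta>\<close>.\<close>
lemma linear_vol_error_moment:
  assumes y0: "y0 \<noteq> 0" and p: "1 \<le> p" and \<epsilon>: "0 < \<epsilon>"
  obtains C where "0 \<le> C"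
    "\<And>i. i \<in> intervals T \<Longrightarrow> (\<integral>\<^sup>+\<omega>. ennreal ((vol_error (\<lambda>y. y\<^sup>2) (\<lambda>y. 2 * y) i \<omega>)\<^sup>2 powr p) \<partial>M)
       \<le> ennreal (C * (len i) powr (p + 1 / 2 - \<epsilon>))"
proof -
  let ?I = "intervals T"
  define Q where "Q i \<omega> = Y_mean 2 i \<omega>
      + 2 * \<bar>Y (fst i) \<omega>\<bar> * \<bar>resid_mean i \<omega>\<bar>" for i \<omega>
  have pos: "0 < len i" "len i \<le> T" if "i \<in> ?I" for i using that by (auto simp: intervals_def)
  have Qm: "moments_O ?I Q len"
  proof -
    have "moments_O ?I (\<lambda>i \<omega>. Y_mean 2 i \<omega>) len"
    proof (rule moments_O_rate[OF increment_avg_moments, where K=1])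
      show "sqrt (len i) ^ 2 \<le> 1 * (len i)" if "i \<in> ?I" for i
        using pos(1)[OF that] by simp
    qed (rule pos)
    moreover have "moments_O ?I (\<lambda>i \<omega>. 2 * (\<bar>Y (fst i) \<omega>\<bar> * \<bar>resid_mean i \<omega>\<bar>)) len"
      by (rule moments_O_cmult) (intro bounded_moments_mult moments_O_abs Y_left_moments resid_avg_moments)
    ultimately show ?thesis unfolding Q_def[abs_def] mult.assoc by (rule moments_O_add)
  qed
  \<comment> \<open>the loss in the exponent is at most \<open>\<eta> * (p + 1)\<close>\<close>
  define \<eta> where "\<eta> = min (1 / 2) (\<epsilon> / (p + 1))"
  have \<eta>: "0 < \<eta>" "\<eta> < 1" "\<eta> * (p + 1) \<le> \<epsilon>"
  proof -
    show "0 < \<eta>" "\<eta> < 1" using \<epsilon> p by (auto simp: \<eta>_def)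
    have "\<eta> * (p + 1) \<le> \<epsilon> / (p + 1) * (p + 1)" using p by (intro mult_right_mono) (auto simp: \<eta>_def)
    then show "\<eta> * (p + 1) \<le> \<epsilon>" using p by simp
  qed
  \<comment> \<open>large enough that \<open>(\<delta> powr \<eta>) ^ m\<close> beats \<open>sqrt \<delta>\<close> together with the loss \<open>\<eta> * p\<close> from \<open>x\<close>\<close>
  define m where "m = nat \<lceil>p + 1 / 2 / \<eta>\<rceil>"
  have "p + 1 / 2 / \<eta> \<le> real m" unfolding m_def by linarith
  moreover have "0 < 1 / 2 / \<eta>" using \<eta> by simp
  ultimately have m: "p \<le> real m" "p + 1 / 2 / \<eta> \<le> real m" by linarith+
  have \<eta>m: "\<eta> * p + 1 / 2 \<le> \<eta> * real m"
  proof -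
    have "\<eta> * (p + 1 / 2 / \<eta>) \<le> \<eta> * real m" using m(2) \<eta> by (intro mult_left_mono) auto
    then show ?thesis using \<eta> by (simp add: algebra_simps)
  qed
  define X where "X = T powr ((1 - \<eta>) / 2)"
  have X: "0 < X" using T by (simp add: X_def)
  obtain Cg where Cg: "0 \<le> Cg" "\<And>x t. 0 < x \<Longrightarrow> x \<le> X \<Longrightarrow> t \<in> {0..T} \<Longrightarrow>
      (\<integral>\<^sup>+\<omega>. ennreal (cauchy_weight x (Y t \<omega>)) \<partial>M) \<le> ennreal (Cg * x powr (1 - \<eta>))"
    using cauchy_weight_expectation[OF y0 \<eta>(1,2) X] by blast
  obtain Cm where Cm: "0 \<le> Cm" "\<And>i. i \<in> ?I \<Longrightarrow> abs_moment (Q i) m \<le> ennreal (Cm * (len i) ^ m)"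
    using moments_OE[OF Qm] by blast
  define e where "e = p + 1 / 2 - \<epsilon>"
  define e1 where "e1 = (1 - \<eta>) * p + (1 - \<eta>) / 2 * (1 - \<eta>)"
  define e2 where "e2 = (1 - \<eta>) * p + \<eta> * real m"
  have e1: "e \<le> e1"
  proof -
    have "e1 - e = (\<epsilon> - \<eta> * (p + 1)) + \<eta>\<^sup>2 / 2" by (simp add: e1_def e_def power2_eq_square field_simps)
    then show ?thesis using \<eta>(3) by (smt (verit) zero_le_power2 divide_nonneg_nonneg)
  qed
  have e2: "e \<le> e2"
  proof -
    have "e2 - e = (\<eta> * real m - (\<eta> * p + 1 / 2)) + \<epsilon>" by (simp add: e2_def e_def algebra_simps)
    then show ?thesis using \<eta>m \<epsilon> by linarith
  qed
  define C where "C = 5 powr p * (Cg * T powr (e1 - e) + Cm * T powr (e2 - e))"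
  show ?thesis
  proof (rule that)
    show "0 \<le> C" using Cg(1) Cm(1) by (simp add: C_def)
    fix i assume i: "i \<in> ?I"
    define \<delta> where "\<delta> = len i"
    have \<delta>: "0 < \<delta>" "\<delta> \<le> T" using pos[OF i] by (auto simp: \<delta>_def)
    define x where "x = \<delta> powr ((1 - \<eta>) / 2)"
    have x: "0 < x" "x \<le> X" using \<delta> \<eta> by (auto simp: x_def X_def intro!: powr_mono2)
    have x2: "x\<^sup>2 = \<delta> powr (1 - \<eta>)"
      unfolding x_def power2_eq_square powr_add[symmetric] by (simp add: field_sum_of_halves)
    let ?D = "vol_error (\<lambda>y. y\<^sup>2) (\<lambda>y. 2 * y) i"
    let ?G = "\<lambda>\<omega>. cauchy_weight x (Y (fst i) \<omega>)"
    have t: "fst i \<in> {0..T}" using i by (auto simp: intervals_def)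
    note [measurable] = Y_measurable[OF t] moments_OD1[OF Qm i]
    have [measurable]: "cauchy_weight x \<in> borel_measurable borel"
      using cauchy_weight_continuous[OF x(1)] by (rule borel_measurable_continuous_onI)
    define L where "L = (5 * x\<^sup>2) powr p"
    have L: "0 \<le> L" by (simp add: L_def)
    have xp: "0 < x\<^sup>2" using x by simp
    have pt: "(?D \<omega>)\<^sup>2 powr p \<le> L * (?G \<omega> + 1 / (x\<^sup>2) ^ m * \<bar>Q i \<omega>\<bar> ^ m)" if \<omega>: "\<omega> \<in> space M" for \<omega>
    proof -
      note dec = interval_decomposition[OF i \<omega>]
      have D: "(?D \<omega>)\<^sup>2 \<le> Q i \<omega>" "(?D \<omega>)\<^sup>2 * (Y (fst i) \<omega>)\<^sup>2 \<le> 4 * (Q i \<omega>)\<^sup>2"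
        by (rule linear_volatility_bound[OF dec(1) dec(3) dec(5)]; simp add: vol_error_def Q_def mult_ac)+
      have Q0: "0 \<le> Q i \<omega>" using D(1) by (meson order_trans zero_le_power2)
      show ?thesis
      proof (cases "Q i \<omega> \<le> x\<^sup>2")
        case True
        define y where "y = Y (fst i) \<omega>"
        have den: "0 < x\<^sup>2 + y\<^sup>2" using xp by (simp add: add_pos_nonneg)
        have "(?D \<omega>)\<^sup>2 * (x\<^sup>2 + y\<^sup>2) \<le> x\<^sup>2 * x\<^sup>2 + 4 * (x\<^sup>2)\<^sup>2"
        proof -
          have "(?D \<omega>)\<^sup>2 * x\<^sup>2 \<le> x\<^sup>2 * x\<^sup>2" using D(1) True by (intro mult_right_mono) auto
          moreover have "(Q i \<omega>)\<^sup>2 \<le> (x\<^sup>2)\<^sup>2" using True Q0 by (intro power_mono) auto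
          ultimately show ?thesis using D(2) unfolding y_def distrib_left by linarith
        qed
        then have "(?D \<omega>)\<^sup>2 \<le> 5 * x\<^sup>2 * ?G \<omega>"
          using den unfolding cauchy_weight_def y_def[symmetric] by (simp add: pos_le_divide_eq power2_eq_square algebra_simps)
        then have "(?D \<omega>)\<^sup>2 powr p \<le> (5 * x\<^sup>2 * ?G \<omega>) powr p" using p by (intro powr_mono2) auto
        also have "\<dots> = L * ?G \<omega> powr p" by (simp add: L_def powr_mult)
        also have "\<dots> \<le> L * ?G \<omega>"
        proof (rule mult_left_mono[OF _ L])
          show "?G \<omega> powr p \<le> ?G \<omega>"
          proof (cases "?G \<omega> = 0")
            case False
            then have "0 < ?G \<omega>" using cauchy_weight_nonneg[of x "Y (fst i) \<omega>"] by simp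
            then have "?G \<omega> powr p \<le> ?G \<omega> powr 1"
              using cauchy_weight_le_1 p by (intro powr_mono') auto
            then show ?thesis using \<open>0 < ?G \<omega>\<close> by simp
          qed simp
        qed
        also have "\<dots> \<le> L * (?G \<omega> + 1 / (x\<^sup>2) ^ m * \<bar>Q i \<omega>\<bar> ^ m)"
          using xp by (intro mult_left_mono[OF _ L]) simp
        finally show ?thesis .
      next
        case False
        then have r: "1 \<le> Q i \<omega> / x\<^sup>2" using xp by simp
        have "(?D \<omega>)\<^sup>2 powr p \<le> Q i \<omega> powr p" using D p by (intro powr_mono2) auto
        also have "Q i \<omega> = x\<^sup>2 * (Q i \<omega> / x\<^sup>2)" using xp by simp
        also have "(x\<^sup>2 * (Q i \<omega> / x\<^sup>2)) powr p = (x\<^sup>2) powr p * (Q i \<omega> / x\<^sup>2) powr p" by (rule powr_mult)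
        also have "\<dots> \<le> L * (Q i \<omega> / x\<^sup>2) powr real m"
        proof (rule mult_mono)
          show "(x\<^sup>2) powr p \<le> L" unfolding L_def using p by (intro powr_mono2) auto
          show "(Q i \<omega> / x\<^sup>2) powr p \<le> (Q i \<omega> / x\<^sup>2) powr real m" using r m by (intro powr_mono) auto
        qed (use L in auto)
        also have "(Q i \<omega> / x\<^sup>2) powr real m = 1 / (x\<^sup>2) ^ m * \<bar>Q i \<omega>\<bar> ^ m"
          using r Q0 by (subst powr_realpow) (auto simp: power_divide)
        also have "L * (1 / (x\<^sup>2) ^ m * \<bar>Q i \<omega>\<bar> ^ m) \<le> L * (?G \<omega> + 1 / (x\<^sup>2) ^ m * \<bar>Q i \<omega>\<bar> ^ m)"
          using cauchy_weight_nonneg by (intro mult_left_mono[OF _ L]) simp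
        finally show ?thesis .
      qed
    qed
    have "(\<integral>\<^sup>+\<omega>. ennreal ((?D \<omega>)\<^sup>2 powr p) \<partial>M) \<le> ennreal (L * (Cg * x powr (1 - \<eta>) + 1 / (x\<^sup>2) ^ m * (Cm * \<delta> ^ m)))"
    proof (rule nn_integral_affine_bound)
      show "AE \<omega> in M. (?D \<omega>)\<^sup>2 powr p \<le> L * (?G \<omega> + 1 / (x\<^sup>2) ^ m * \<bar>Q i \<omega>\<bar> ^ m)"
        using pt by (rule AE_I2)
      show "abs_moment (Q i) m \<le> ennreal (Cm * \<delta> ^ m)" unfolding \<delta>_def by (rule Cm(2)[OF i])
    qed (use L Cg Cm(1) \<delta> x t cauchy_weight_nonneg in auto)
    also have "L * (Cg * x powr (1 - \<eta>) + 1 / (x\<^sup>2) ^ m * (Cm * \<delta> ^ m)) = 5 powr p * (Cg * \<delta> powr e1 + Cm * \<delta> powr e2)"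
    proof -
      have 1: "L = 5 powr p * \<delta> powr ((1 - \<eta>) * p)" by (simp add: L_def powr_mult x2 powr_powr)
      have 2: "x powr (1 - \<eta>) = \<delta> powr ((1 - \<eta>) / 2 * (1 - \<eta>))" by (simp add: x_def powr_powr)
      have 3: "1 / (x\<^sup>2) ^ m * (Cm * \<delta> ^ m) = Cm * \<delta> powr (\<eta> * real m)"
      proof -
        have "(x\<^sup>2) ^ m = \<delta> powr ((1 - \<eta>) * real m)" using \<delta> unfolding x2 by (simp add: powr_realpow[symmetric] powr_powr)
        moreover have "\<delta> ^ m = \<delta> powr real m" using \<delta> by (simp add: powr_realpow)
        moreover have "\<delta> powr real m / \<delta> powr ((1 - \<eta>) * real m) = \<delta> powr (\<eta> * real m)"
          by (simp add: powr_diff[symmetric] algebra_simps)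
        ultimately show ?thesis by (metis mult.commute times_divide_eq_right mult.left_neutral times_divide_eq_left)
      qed
      show ?thesis unfolding 1 2 3 e1_def e2_def powr_add by (simp add: algebra_simps)
    qed
    also have "\<dots> \<le> C * \<delta> powr e"
    proof -
      have "Cg * \<delta> powr e1 \<le> Cg * (T powr (e1 - e) * \<delta> powr e)"
        using Cg(1) by (intro mult_left_mono powr_rate \<delta> e1) auto
      moreover have "Cm * \<delta> powr e2 \<le> Cm * (T powr (e2 - e) * \<delta> powr e)"
        using Cm(1) by (intro mult_left_mono powr_rate \<delta> e2) auto
      ultimately have "Cg * \<delta> powr e1 + Cm * \<delta> powr e2 \<le> (Cg * T powr (e1 - e) + Cm * T powr (e2 - e)) * \<delta> powr e"
        by (simp add: algebra_simps)
      then show ?thesis unfolding C_def mult.assoc[of "5 powr p"] by (intro mult_left_mono) auto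
    qed
    finally show "(\<integral>\<^sup>+\<omega>. ennreal ((?D \<omega>)\<^sup>2 powr p) \<partial>M) \<le> ennreal (C * (len i) powr (p + 1 / 2 - \<epsilon>))"
      by (simp add: \<delta>_def e_def ennreal_leI)
  qed
qed

end

section \<open>The strong error of the scheme\<close>

lemma abs_add_powr_le:
  fixes x y q :: real
  assumes "0 < q"
  shows "\<bar>x + y\<bar> powr q \<le> 2 powr q * (\<bar>x\<bar> powr q + \<bar>y\<bar> powr q)"
proof -
  have "\<bar>x + y\<bar> powr q \<le> (2 * max \<bar>x\<bar> \<bar>y\<bar>) powr q" using assms by (intro powr_mono2) auto
  also have "\<dots> = 2 powr q * (max \<bar>x\<bar> \<bar>y\<bar>) powr q" by (rule powr_mult)
  also have "\<dots> \<le> 2 powr q * (\<bar>x\<bar> powr q + \<bar>y\<bar> powr q)" by (intro mult_left_mono) (auto simp: max_def)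
  finally show ?thesis .
qed

lemma Max_image_nonneg:
  fixes g :: "nat \<Rightarrow> real"
  assumes "\<And>k. 0 \<le> g k"
  shows "0 \<le> (MAX k\<in>{0..N}. g k)"
  by (rule order_trans[OF assms[of 0] Max_ge]) auto

context volatility_model
begin

definition grid_vol_error :: "(real \<Rightarrow> real) \<Rightarrow> (real \<Rightarrow> real) \<Rightarrow> nat \<Rightarrow> nat \<Rightarrow> 'a \<Rightarrow> real" where
  "grid_vol_error P P' N l = vol_error P P' (grid T N l, grid T N (Suc l))"

lemma grid_vol_error_measurable:
  assumes "l < N" "continuous_on UNIV P" "continuous_on UNIV P'"
  shows "grid_vol_error P P' N l \<in> borel_measurable M"
  unfolding grid_vol_error_def using assms T by (intro vol_error_measurable grid_interval)

lemma grid_vol_error_W_functional: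
  assumes l: "l < N" and P: "continuous_on UNIV P" "continuous_on UNIV P'"
  shows "W_functional (grid_vol_error P P' N l)"
proof -
  have iv: "0 \<le> grid T N l" "grid T N l < grid T N (Suc l)" "grid T N (Suc l) \<le> T"
    using grid_interval[OF T l] by (auto simp: intervals_def)
  have Pm: "P \<in> borel_measurable borel" "P' \<in> borel_measurable borel"
    using P by (auto intro: borel_measurable_continuous_onI)
  have WY: "W_functional (Y (grid T N l))" using iv by (intro W_functional_Y) auto
  have 1: "W_functional (\<lambda>\<omega>. time_avg (grid T N l) (grid T N (Suc l)) (\<lambda>s. P (Y s \<omega>)))"
    using iv by (intro W_functional_time_avg W_functional_compose[OF W_functional_Y Pm(1)]
        continuous_on_compose2[OF P(1)] continuous_on_subset[OF Y_continuous]) auto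
  have 2: "W_functional (\<lambda>\<omega>. time_avg (grid T N l) (grid T N (Suc l)) (\<lambda>s. W s \<omega> - W (grid T N l) \<omega>))"
    using iv by (intro W_functional_time_avg W_functional_diff W_functional_W continuous_intros
        continuous_on_subset[OF W_continuous]) auto
  show ?thesis unfolding grid_vol_error_def vol_error_def[abs_def] fst_conv snd_conv
    by (intro W_functional_diff W_functional_compose[where f=sqrt] 1 W_functional_max W_functional_add W_functional_mult
        W_functional_const W_functional_compose[OF WY] Pm 2) auto
qed

text \<open>The terms in \<open>F\<close> telescope in the scheme and cancel against those of the reference process.\<close>
lemma scheme_error_decomposition:
  fixes f :: "real \<Rightarrow> real"
  assumes h: "h_coef r \<rho> \<nu> \<kappa> \<theta> f = quartic c" and P: "psi f = P" "deriv (psi f) = P'" "psi_inf f = 0"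
    and Pc: "continuous_on UNIV P"
    and N: "0 < N" and \<omega>: "\<omega> \<in> space M" and k: "k \<le> N"
  shows "X_tilde T r \<rho> s0 \<nu> \<kappa> \<theta> f B Y N k \<omega> - WeakTraj1 T r \<rho> s0 \<nu> \<kappa> \<theta> f W B Y N k \<omega>
    = T / real N * (\<Sum>l<k. time_avg (grid T N l) (grid T N (Suc l)) (\<lambda>s. quartic c (Y s \<omega>)) - quartic c (Y (grid T N l) \<omega>))
      + sqrt (1 - \<rho>\<^sup>2) * (\<Sum>l<k. grid_vol_error P P' N l \<omega> * dB N l \<omega>)"
proof -
  let ?t = "grid T N"
  let ?\<delta> = "T / real N"
  have iv: "0 \<le> ?t l" "?t l < ?t (Suc l)" "?t (Suc l) \<le> T" if "l < N" for l
    using grid_interval[OF T that] by (auto simp: intervals_def)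
  have \<delta>: "0 < ?\<delta>" using T N by simp
  have step: "(LBINT s=?t l..?t (Suc l). g s) = ?\<delta> * time_avg (?t l) (?t (Suc l)) g"
    if "l < N" "continuous_on {?t l..?t (Suc l)} g" for l g
    using LBINT_eq_time_avg[OF iv(2)[OF that(1)] that(2)] by (simp only: grid_simps)
  have Yc: "continuous_on {?t l..?t (Suc l)} (\<lambda>s. Y s \<omega>)" if "l < N" for l
    using iv[OF that] by (intro continuous_on_subset[OF Y_continuous[OF \<omega>]]) auto
  have hint: "(LBINT s=0..?t k. quartic c (Y s \<omega>)) = (\<Sum>l<k. ?\<delta> * time_avg (?t l) (?t (Suc l)) (\<lambda>s. quartic c (Y s \<omega>)))"
    if "k \<le> N" for k using that
  proof (induction k)
    case 0 then show ?case by (simp add: grid_simps zero_ereal_def)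
  next
    case (Suc k)
    have cont: "continuous_on {0..T} (\<lambda>s. quartic c (Y s \<omega>))"
      by (intro continuous_intros Y_continuous[OF \<omega>])
    have t0: "0 \<le> ?t k" "?t k < ?t (Suc k)" "?t (Suc k) \<le> T" using iv[of k] Suc.prems by auto
    have eqI: "(LBINT s=0..u. quartic c (Y s \<omega>)) = integral {0..u} (\<lambda>s. quartic c (Y s \<omega>))" if "0 \<le> u" "u \<le> T" for u
    proof (cases "u = 0")
      case False
      then show ?thesis using LBINT_eq_time_avg[of 0 u "\<lambda>s. quartic c (Y s \<omega>)"] that
          continuous_on_subset[OF cont, of "{0..u}"] by (simp add: time_avg_def zero_ereal_def)
    qed (simp add: zero_ereal_def)
    have "(\<lambda>s. quartic c (Y s \<omega>)) integrable_on {0..?t (Suc k)}"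
      using t0 by (intro integrable_continuous_real continuous_on_subset[OF cont]) auto
    then have "integral {0..?t k} (\<lambda>s. quartic c (Y s \<omega>)) + integral {?t k..?t (Suc k)} (\<lambda>s. quartic c (Y s \<omega>))
        = integral {0..?t (Suc k)} (\<lambda>s. quartic c (Y s \<omega>))"
      using t0 by (intro Henstock_Kurzweil_Integration.integral_combine) auto
    moreover have "integral {?t k..?t (Suc k)} (\<lambda>s. quartic c (Y s \<omega>)) = ?\<delta> * time_avg (?t k) (?t (Suc k)) (\<lambda>s. quartic c (Y s \<omega>))"
      unfolding time_avg_def grid_simps times_divide_eq_right
      by (rule nonzero_mult_div_cancel_left[symmetric]) (use \<delta> in linarith)
    ultimately show ?case using Suc t0 eqI[of "?t k"] eqI[of "?t (Suc k)"] by simp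
  qed
  have mean: "mean_psi T f Y N l \<omega> = time_avg (?t l) (?t (Suc l)) (\<lambda>s. P (Y s \<omega>))" if "l < N" for l
    using step[OF that, of "\<lambda>s. P (Y s \<omega>)"] continuous_on_compose2[OF Pc Yc[OF that]] T N
    by (simp add: mean_psi_def P)
  have Wint: "(LBINT s=?t l..?t (Suc l). W s \<omega> - W (?t l) \<omega>) = ?\<delta> * time_avg (?t l) (?t (Suc l)) (\<lambda>s. W s \<omega> - W (?t l) \<omega>)"
    if "l < N" for l
    using iv[OF that] by (intro step[OF that] continuous_intros continuous_on_subset[OF W_continuous[OF \<omega>]]) auto
  have weak: "WeakTraj1 T r \<rho> s0 \<nu> \<kappa> \<theta> f W B Y N k \<omega> = ln s0 + \<rho> * (F_prim \<nu> f (Y (?t k) \<omega>) - F_prim \<nu> f (Y (?t 0) \<omega>))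
      + ?\<delta> * (\<Sum>l<k. quartic c (Y (?t l) \<omega>))
      + sqrt (1 - \<rho>\<^sup>2) * (\<Sum>l<k. sqrt (max (P (Y (?t l) \<omega>) + P' (Y (?t l) \<omega>) * (\<nu> * time_avg (?t l) (?t (Suc l)) (\<lambda>s. W s \<omega> - W (?t l) \<omega>))) 0)
          * (B (?t (Suc l)) \<omega> - B (?t l) \<omega>))"
    if "k \<le> N" for k using that
  proof (induction k)
    case (Suc k)
    define R where "R = P' (Y (?t k) \<omega>) * (\<nu> * time_avg (?t k) (?t (Suc k)) (\<lambda>s. W s \<omega> - W (?t k) \<omega>))"
    have "\<nu> * deriv (psi f) (Y (?t k) \<omega>) / ?\<delta> * (LBINT s=?t k..?t (Suc k). W s \<omega> - W (?t k) \<omega>) = R"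
      unfolding Wint[OF Suc_le_lessD[OF Suc.prems]] P(2) R_def using T N by simp
    then have R: "\<nu> * P' (Y (?t k) \<omega>) / ?\<delta> * (LBINT s=?t k..?t (Suc k). W s \<omega> - W (?t k) \<omega>) = R"
      by (simp only: P(2))
    show ?case using Suc unfolding WeakTraj1.simps sum.lessThan_Suc h P(2) unfolding P(1) P(3) R R_def[symmetric]
      by (simp add: algebra_simps)
  qed simp
  show ?thesis
    using hint[OF k] weak[OF k] mean k
    by (simp add: X_tilde_def h grid_vol_error_def vol_error_def sum_subtractf left_diff_distrib right_diff_distrib sum_distrib_left)
qed

text \<open>Reduction of the theorem to the volatility error. The drift part contributes at the rate \<open>2 p\<close>, which is not worse
  than \<open>\<beta>\<close>; the diffusion part is controlled by \<open>vol\<close>, and each of the two maxima costs \<open>N powr \<epsilon>\<close>.\<close>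
lemma strong_error_bound:
  fixes f :: "real \<Rightarrow> real"
  assumes h: "h_coef r \<rho> \<nu> \<kappa> \<theta> f = quartic c" and P: "psi f = P" "deriv (psi f) = P'" "psi_inf f = 0"
    and Pc: "continuous_on UNIV P" "continuous_on UNIV P'"
    and p: "0 < p" and \<epsilon>: "0 < \<epsilon>" and \<beta>: "\<beta> \<le> 2 * p" and A: "0 \<le> A"
    and vol: "\<And>N. 1 \<le> N \<Longrightarrow> (\<integral>\<^sup>+\<omega>. ennreal ((T / real N * (\<Sum>l<N. (grid_vol_error P P' N l \<omega>)\<^sup>2)) powr p) \<partial>M)
        \<le> ennreal (A * real N powr (- \<beta>))"
  shows "\<exists>C. \<forall>N\<ge>1. integrable M (max_error T r \<rho> s0 \<nu> \<kappa> \<theta> f W B Y N (2 * p)) \<and>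
    expectation (max_error T r \<rho> s0 \<nu> \<kappa> \<theta> f W B Y N (2 * p)) \<le> C / real N powr (\<beta> - \<epsilon>)"
proof -
  let ?q = "2 * p"
  have q: "0 < ?q" using p by simp
  define dr where "dr N k \<omega> = T / real N * (\<Sum>l<k. time_avg (grid T N l) (grid T N (Suc l)) (\<lambda>s. quartic c (Y s \<omega>)) - quartic c (Y (grid T N l) \<omega>))" for N k \<omega>
  define df where "df N k \<omega> = (\<Sum>l<k. grid_vol_error P P' N l \<omega> * dB N l \<omega>)" for N k \<omega>
  have drm: "moments_O {(N, k). 0 < N \<and> k \<le> N} (\<lambda>(N, k). dr N k) (\<lambda>(N, k). T / real N)"
    using drift_error_moments[of c] by (simp add: dr_def[abs_def])
  have "\<exists>Cf. \<forall>m N k. 0 < N \<and> k \<le> N \<longrightarrow> abs_moment (dr N k) m \<le> ennreal (Cf m * (T / real N) ^ m)"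
  proof -
    have "\<forall>m. \<exists>C. \<forall>N k. 0 < N \<and> k \<le> N \<longrightarrow> abs_moment (dr N k) m \<le> ennreal (C * (T / real N) ^ m)"
      using drm unfolding moments_O_def by auto
    then show ?thesis by (rule choice)
  qed
  then obtain Cf where Cf: "\<And>m N k. 0 < N \<Longrightarrow> k \<le> N \<Longrightarrow> abs_moment (dr N k) m \<le> ennreal (Cf m * (T / real N) ^ m)"
    by blast
  obtain K1 where K1: "0 \<le> K1" and max1: "\<And>N c (Z :: nat \<Rightarrow> 'a \<Rightarrow> real). 1 \<le> N \<Longrightarrow> 0 < c \<Longrightarrow> (\<And>k. k \<le> N \<Longrightarrow> Z k \<in> borel_measurable M) \<Longrightarrow>
       (\<And>k m. k \<le> N \<Longrightarrow> abs_moment (Z k) m \<le> ennreal (Cf m * c ^ m)) \<Longrightarrow>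
       (\<integral>\<^sup>+\<omega>. ennreal (MAX k\<in>{0..N}. \<bar>Z k \<omega>\<bar> powr ?q) \<partial>M) \<le> ennreal (K1 * real N powr \<epsilon> * c powr ?q)"
    using max_moment_bound[OF q \<epsilon>, of Cf] by blast
  obtain K2 where K2: "0 \<le> K2" and max2: "\<And>N D. 1 \<le> N \<Longrightarrow> (\<And>l. l < N \<Longrightarrow> W_functional (D l)) \<Longrightarrow>
      (\<integral>\<^sup>+\<omega>. ennreal (MAX k\<in>{0..N}. \<bar>\<Sum>l<k. D l \<omega> * dB N l \<omega>\<bar> powr ?q) \<partial>M)
      \<le> ennreal (K2 * real N powr \<epsilon>) * (\<integral>\<^sup>+\<omega>. ennreal ((T / real N * (\<Sum>l<N. (D l \<omega>)\<^sup>2)) powr (?q / 2)) \<partial>M)"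
    using diffusion_max_bound[OF q \<epsilon>] by blast
  define C where "C = 2 powr ?q * (K1 * T powr ?q + \<bar>sqrt (1 - \<rho>\<^sup>2)\<bar> powr ?q * (K2 * A))"
  have C: "0 \<le> C" using K1 K2 A by (simp add: C_def)
  show ?thesis
  proof (intro exI[of _ C] allI impI)
    fix N :: nat assume N: "1 \<le> N"
    let ?s = "sqrt (1 - \<rho>\<^sup>2)"
    let ?err = "max_error T r \<rho> s0 \<nu> \<kappa> \<theta> f W B Y N ?q"
    have gr: "grid T N l \<in> {0..T}" if "l \<le> N" for l by (rule grid_range[OF T that])
    have err: "?err \<omega> = (MAX k\<in>{0..N}. \<bar>dr N k \<omega> + ?s * df N k \<omega>\<bar> powr ?q)" if "\<omega> \<in> space M" for \<omega>
    proof -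
      have eq: "X_tilde T r \<rho> s0 \<nu> \<kappa> \<theta> f B Y N k \<omega> - WeakTraj1 T r \<rho> s0 \<nu> \<kappa> \<theta> f W B Y N k \<omega> = dr N k \<omega> + ?s * df N k \<omega>"
        if "k \<in> {0..N}" for k
        unfolding dr_def df_def using that N \<open>\<omega> \<in> space M\<close> by (intro scheme_error_decomposition[OF h P Pc(1)]) auto
      show ?thesis unfolding max_error_def by (intro arg_cong[where f=Max] image_cong refl) (simp only: eq)
    qed
    have drM [measurable]: "dr N k \<in> borel_measurable M" if "k \<le> N" for k
      using moments_OD1[OF drm, of "(N, k)"] that N by simp
    have dfM [measurable]: "df N k \<in> borel_measurable M" if "k \<le> N" for k
      unfolding df_def using that gr
      by (intro borel_measurable_sum borel_measurable_times borel_measurable_diff grid_vol_error_measurable Pc B.W_measurable) auto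
    have errM: "?err \<in> borel_measurable M"
    proof (subst measurable_cong[OF err])
      show "(\<lambda>\<omega>. MAX k\<in>{0..N}. \<bar>dr N k \<omega> + ?s * df N k \<omega>\<bar> powr ?q) \<in> borel_measurable M"
        by (intro borel_measurable_Max) auto
    qed
    have err0: "0 \<le> ?err \<omega>" for \<omega>
      unfolding max_error_def by (rule Max_image_nonneg) simp
    define MD where "MD \<omega> = (MAX k\<in>{0..N}. \<bar>dr N k \<omega>\<bar> powr ?q)" for \<omega>
    define MF where "MF \<omega> = (MAX k\<in>{0..N}. \<bar>df N k \<omega>\<bar> powr ?q)" for \<omega>
    have [measurable]: "MD \<in> borel_measurable M" "MF \<in> borel_measurable M"
      unfolding MD_def[abs_def] MF_def[abs_def] by (intro borel_measurable_Max; auto)+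
    have MF0: "0 \<le> MF \<omega>" "0 \<le> MD \<omega>" for \<omega>
      unfolding MF_def MD_def by (rule Max_image_nonneg, simp)+
    have pt: "?err \<omega> \<le> 2 powr ?q * (MD \<omega> + \<bar>?s\<bar> powr ?q * MF \<omega>)" if \<omega>: "\<omega> \<in> space M" for \<omega>
      unfolding err[OF \<omega>]
    proof (intro Max.boundedI)
      fix y assume "y \<in> (\<lambda>k. \<bar>dr N k \<omega> + ?s * df N k \<omega>\<bar> powr ?q) ` {0..N}"
      then obtain k where k: "k \<in> {0..N}" "y = \<bar>dr N k \<omega> + ?s * df N k \<omega>\<bar> powr ?q" by auto
      have "y \<le> 2 powr ?q * (\<bar>dr N k \<omega>\<bar> powr ?q + \<bar>?s * df N k \<omega>\<bar> powr ?q)"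
        unfolding k(2) by (rule abs_add_powr_le[OF q])
      also have "\<bar>?s * df N k \<omega>\<bar> powr ?q = \<bar>?s\<bar> powr ?q * \<bar>df N k \<omega>\<bar> powr ?q" by (simp add: abs_mult powr_mult)
      also have "2 powr ?q * (\<bar>dr N k \<omega>\<bar> powr ?q + \<bar>?s\<bar> powr ?q * \<bar>df N k \<omega>\<bar> powr ?q) \<le> 2 powr ?q * (MD \<omega> + \<bar>?s\<bar> powr ?q * MF \<omega>)"
        unfolding MD_def MF_def using k(1) by (intro mult_left_mono add_mono Max_ge) auto
      finally show "y \<le> 2 powr ?q * (MD \<omega> + \<bar>?s\<bar> powr ?q * MF \<omega>)" .
    qed auto
    have MDb: "(\<integral>\<^sup>+\<omega>. ennreal (MD \<omega>) \<partial>M) \<le> ennreal (K1 * T powr ?q * real N powr (\<epsilon> - \<beta>))"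
    proof -
      have "(\<integral>\<^sup>+\<omega>. ennreal (MD \<omega>) \<partial>M) \<le> ennreal (K1 * real N powr \<epsilon> * (T / real N) powr ?q)"
        unfolding MD_def using N T by (intro max1 drM Cf) auto
      also have "\<dots> \<le> ennreal (K1 * T powr ?q * real N powr (\<epsilon> - \<beta>))"
      proof (rule ennreal_leI)
        have "real N powr \<epsilon> * (T / real N) powr ?q = T powr ?q * real N powr (\<epsilon> - ?q)"
          using N T by (simp add: powr_divide powr_diff)
        also have "\<dots> \<le> T powr ?q * real N powr (\<epsilon> - \<beta>)"
          using N \<beta> by (intro mult_left_mono powr_mono) auto
        finally show "K1 * real N powr \<epsilon> * (T / real N) powr ?q \<le> K1 * T powr ?q * real N powr (\<epsilon> - \<beta>)"
          using K1 by (simp add: mult.assoc mult_left_mono)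
      qed
      finally show ?thesis .
    qed
    have MFb: "(\<integral>\<^sup>+\<omega>. ennreal (MF \<omega>) \<partial>M) \<le> ennreal (K2 * A * real N powr (\<epsilon> - \<beta>))"
    proof -
      have "(\<integral>\<^sup>+\<omega>. ennreal (MF \<omega>) \<partial>M) \<le> ennreal (K2 * real N powr \<epsilon>) * (\<integral>\<^sup>+\<omega>. ennreal ((T / real N * (\<Sum>l<N. (grid_vol_error P P' N l \<omega>)\<^sup>2)) powr (?q / 2)) \<partial>M)"
        unfolding MF_def df_def by (intro max2 N grid_vol_error_W_functional Pc)
      also have "\<dots> \<le> ennreal (K2 * real N powr \<epsilon>) * ennreal (A * real N powr (- \<beta>))"
        using vol[OF N] by (intro mult_left_mono) auto
      also have "\<dots> = ennreal (K2 * A * real N powr (\<epsilon> - \<beta>))"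
        using K2 A N by (simp add: ennreal_mult[symmetric] powr_diff powr_minus divide_inverse mult_ac)
      finally show ?thesis .
    qed
    have total: "(\<integral>\<^sup>+\<omega>. ennreal (?err \<omega>) \<partial>M) \<le> ennreal (C / real N powr (\<beta> - \<epsilon>))"
    proof -
      have "(\<integral>\<^sup>+\<omega>. ennreal (?err \<omega>) \<partial>M) \<le> ennreal (2 powr ?q * (K1 * T powr ?q * real N powr (\<epsilon> - \<beta>) + \<bar>?s\<bar> powr ?q * (K2 * A * real N powr (\<epsilon> - \<beta>))))"
        by (rule nn_integral_affine_bound[OF AE_I2[OF pt] _ _ MF0(2) MF0(1) _ _ _ _ MDb MFb]) (use K1 K2 A in auto)
      also have "2 powr ?q * (K1 * T powr ?q * real N powr (\<epsilon> - \<beta>) + \<bar>?s\<bar> powr ?q * (K2 * A * real N powr (\<epsilon> - \<beta>))) = C * real N powr (\<epsilon> - \<beta>)"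
        unfolding C_def by (simp only: distrib_left distrib_right mult.assoc)
      also have "\<dots> = C / real N powr (\<beta> - \<epsilon>)" by (simp add: powr_diff)
      finally show ?thesis .
    qed
    have int: "integrable M ?err"
    proof (rule integrableI_bounded[OF errM])
      have "(\<integral>\<^sup>+\<omega>. ennreal (norm (?err \<omega>)) \<partial>M) \<le> ennreal (C / real N powr (\<beta> - \<epsilon>))" using total err0 by simp
      also have "\<dots> < \<infinity>" by simp
      finally show "(\<integral>\<^sup>+\<omega>. ennreal (norm (?err \<omega>)) \<partial>M) < \<infinity>" .
    qed
    have "ennreal (expectation ?err) = (\<integral>\<^sup>+\<omega>. ennreal (?err \<omega>) \<partial>M)"
      using int err0 by (intro nn_integral_eq_integral[symmetric]) auto
    then have "ennreal (expectation ?err) \<le> ennreal (C / real N powr (\<beta> - \<epsilon>))" using total by simp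
    then have "expectation ?err \<le> C / real N powr (\<beta> - \<epsilon>)"
      using C by (subst (asm) ennreal_le_iff) auto
    with int show "integrable M ?err \<and> expectation ?err \<le> C / real N powr (\<beta> - \<epsilon>)" by blast
  qed
qed

lemma quadratic_grid_volatility:
  assumes p: "0 < p"
  obtains A where "0 \<le> A"
    "\<And>N. 1 \<le> N \<Longrightarrow> (\<integral>\<^sup>+\<omega>. ennreal ((T / real N * (\<Sum>l<N. (grid_vol_error (\<lambda>y. y ^ 4) (\<lambda>y. 4 * y ^ 3) N l \<omega>)\<^sup>2)) powr p) \<partial>M)
        \<le> ennreal (A * real N powr (- (2 * p)))"
proof -
  let ?D = "grid_vol_error (\<lambda>y. y ^ 4) (\<lambda>y. 4 * y ^ 3)"
  let ?J = "SIGMA N:{1::nat..}. {..<N}"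
  have "moments_O ?J (\<lambda>j \<omega>. vol_error (\<lambda>y. y ^ 4) (\<lambda>y. 4 * y ^ 3) (grid T (fst j) (snd j), grid T (fst j) (Suc (snd j))) \<omega> ^ 2)
      (\<lambda>j. (snd (grid T (fst j) (snd j), grid T (fst j) (Suc (snd j))) - fst (grid T (fst j) (snd j), grid T (fst j) (Suc (snd j)))) ^ 2)"
    using T by (intro moments_O_power moments_O_reindex[OF quadratic_vol_error_moments]) (auto intro!: grid_interval)
  then have "moments_O ?J (\<lambda>(N, l) \<omega>. (?D N l \<omega>)\<^sup>2) (\<lambda>(N, l). (T / real N)\<^sup>2)"
    by (simp add: grid_vol_error_def case_prod_unfold grid_simps)
  from moments_O_mean[OF this]
  have "moments_O {1..} (\<lambda>N \<omega>. (\<Sum>l<N. (?D N l \<omega>)\<^sup>2) / real N) (\<lambda>N. (T / real N)\<^sup>2)" by auto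
  from moments_O_powr[OF moments_O_cmult[OF this, of T] p]
  obtain C where C: "0 \<le> C" "\<And>N. N \<in> {1..} \<Longrightarrow> (\<integral>\<^sup>+\<omega>. ennreal (\<bar>T * ((\<Sum>l<N. (?D N l \<omega>)\<^sup>2) / real N)\<bar> powr p) \<partial>M) \<le> ennreal (C * (T / real N)\<^sup>2 powr p)"
    by blast
  show ?thesis
  proof (rule that)
    show "0 \<le> C * T\<^sup>2 powr p" using C by simp
    fix N :: nat assume N: "1 \<le> N"
    have "(T / real N)\<^sup>2 powr p = T\<^sup>2 powr p * real N powr (- (2 * p))"
    proof -
      have "(real N)\<^sup>2 powr p = real N powr (2 * p)" using N by (simp add: powr_powr flip: powr_numeral)
      then show ?thesis by (simp add: power_divide powr_divide powr_minus_divide)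
    qed
    moreover have "T / real N * (\<Sum>l<N. (?D N l \<omega>)\<^sup>2) = \<bar>T * ((\<Sum>l<N. (?D N l \<omega>)\<^sup>2) / real N)\<bar>" for \<omega>
      using T by (simp add: sum_nonneg abs_mult)
    ultimately show "(\<integral>\<^sup>+\<omega>. ennreal ((T / real N * (\<Sum>l<N. (?D N l \<omega>)\<^sup>2)) powr p) \<partial>M) \<le> ennreal (C * T\<^sup>2 powr p * real N powr (- (2 * p)))"
      using C(2)[of N] N by (simp add: mult.assoc)
  qed
qed

text \<open>Jensen's inequality over the \<open>N\<close> steps keeps the moment of order \<open>p\<close> of each single step, where
  \<open>linear_vol_error_moment\<close> applies.\<close>
lemma linear_grid_volatility:
  assumes y0: "y0 \<noteq> 0" and p: "1 \<le> p" and \<epsilon>: "0 < \<epsilon>"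
  obtains A where "0 \<le> A"
    "\<And>N. 1 \<le> N \<Longrightarrow> (\<integral>\<^sup>+\<omega>. ennreal ((T / real N * (\<Sum>l<N. (grid_vol_error (\<lambda>y. y\<^sup>2) (\<lambda>y. 2 * y) N l \<omega>)\<^sup>2)) powr p) \<partial>M)
        \<le> ennreal (A * real N powr (- (p + 1 / 2 - \<epsilon>)))"
proof -
  let ?D = "grid_vol_error (\<lambda>y. y\<^sup>2) (\<lambda>y. 2 * y)"
  let ?e = "p + 1 / 2 - \<epsilon>"
  obtain C where C: "0 \<le> C" "\<And>i. i \<in> intervals T \<Longrightarrow> (\<integral>\<^sup>+\<omega>. ennreal ((vol_error (\<lambda>y. y\<^sup>2) (\<lambda>y. 2 * y) i \<omega>)\<^sup>2 powr p) \<partial>M)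
       \<le> ennreal (C * (len i) powr ?e)"
    using linear_vol_error_moment[OF y0 p \<epsilon>] by blast
  show ?thesis
  proof (rule that)
    show "0 \<le> T powr p * C * T powr ?e" using C by simp
    fix N :: nat assume N: "1 \<le> N"
    have [measurable]: "?D N l \<in> borel_measurable M" if "l < N" for l
      using that by (intro grid_vol_error_measurable continuous_intros)
    have step: "(\<integral>\<^sup>+\<omega>. ennreal ((?D N l \<omega>)\<^sup>2 powr p) \<partial>M) \<le> ennreal (C * (T / real N) powr ?e)" if "l < N" for l
      using C(2)[OF grid_interval[OF T that]] by (simp add: grid_vol_error_def grid_simps)
    have pt: "(T / real N * (\<Sum>l<N. (?D N l \<omega>)\<^sup>2)) powr p \<le> T powr p / real N * (\<Sum>l<N. (?D N l \<omega>)\<^sup>2 powr p)" for \<omega>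
    proof -
      have "(T / real N * (\<Sum>l<N. (?D N l \<omega>)\<^sup>2)) powr p = T powr p * ((\<Sum>l<N. (?D N l \<omega>)\<^sup>2) / real N) powr p"
        by (simp add: powr_mult[symmetric])
      also have "\<dots> \<le> T powr p * ((\<Sum>l<N. (?D N l \<omega>)\<^sup>2 powr p) / real N)"
        using N p by (intro mult_left_mono mean_powr_le) auto
      finally show ?thesis by simp
    qed
    have "(\<integral>\<^sup>+\<omega>. ennreal ((T / real N * (\<Sum>l<N. (?D N l \<omega>)\<^sup>2)) powr p) \<partial>M)
        \<le> (\<integral>\<^sup>+\<omega>. ennreal (T powr p / real N) * (\<Sum>l<N. ennreal ((?D N l \<omega>)\<^sup>2 powr p)) \<partial>M)"
    proof (rule nn_integral_mono)
      fix \<omega>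
      have "ennreal (T powr p / real N) * (\<Sum>l<N. ennreal ((?D N l \<omega>)\<^sup>2 powr p)) = ennreal (T powr p / real N * (\<Sum>l<N. (?D N l \<omega>)\<^sup>2 powr p))"
        by (simp add: sum_ennreal ennreal_mult'[symmetric] sum_nonneg)
      then show "ennreal ((T / real N * (\<Sum>l<N. (?D N l \<omega>)\<^sup>2)) powr p) \<le> ennreal (T powr p / real N) * (\<Sum>l<N. ennreal ((?D N l \<omega>)\<^sup>2 powr p))"
        using ennreal_leI[OF pt[of \<omega>]] by simp
    qed
    also have "\<dots> = ennreal (T powr p / real N) * (\<Sum>l<N. \<integral>\<^sup>+\<omega>. ennreal ((?D N l \<omega>)\<^sup>2 powr p) \<partial>M)"
      by (subst nn_integral_cmult, measurable, subst nn_integral_sum) (auto simp del: sum_ennreal)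
    also have "\<dots> \<le> ennreal (T powr p / real N) * (\<Sum>l<N. ennreal (C * (T / real N) powr ?e))"
      using step by (intro mult_left_mono sum_mono) auto
    also have "\<dots> = ennreal (T powr p / real N * (real N * (C * (T / real N) powr ?e)))"
      using C(1) by (subst sum_ennreal) (auto simp: ennreal_mult'[symmetric])
    also have "T powr p / real N * (real N * (C * (T / real N) powr ?e)) = T powr p * C * T powr ?e * real N powr (- ?e)"
    proof -
      have "(T / real N) powr e = T powr e * real N powr (- e)" for e
        by (simp add: powr_divide powr_minus_divide)
      then show ?thesis using N by simp
    qed
    finally show "(\<integral>\<^sup>+\<omega>. ennreal ((T / real N * (\<Sum>l<N. (?D N l \<omega>)\<^sup>2)) powr p) \<partial>M)
        \<le> ennreal (T powr p * C * T powr ?e * real N powr (- ?e))" .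
  qed
qed

end

lemma psi_data:
  shows "psi (\<lambda>y. y) = (\<lambda>y. y\<^sup>2)" "deriv (psi (\<lambda>y. y)) = (\<lambda>y. 2 * y)" "psi_inf (\<lambda>y. y) = 0"
    "psi (\<lambda>y. y\<^sup>2) = (\<lambda>y. y ^ 4)" "deriv (psi (\<lambda>y. y\<^sup>2)) = (\<lambda>y. 4 * y ^ 3)" "psi_inf (\<lambda>y. y\<^sup>2) = 0"
proof -
  show 1: "psi (\<lambda>y. y) = (\<lambda>y. y\<^sup>2)" and 2: "psi (\<lambda>y. y\<^sup>2) = (\<lambda>y. y ^ 4)"
    by (auto simp: psi_def power_mult[symmetric])
  show "deriv (psi (\<lambda>y. y)) = (\<lambda>y. 2 * y)" unfolding 1
    by (intro ext DERIV_imp_deriv) (auto intro!: derivative_eq_intros)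
  show "deriv (psi (\<lambda>y. y\<^sup>2)) = (\<lambda>y. 4 * y ^ 3)" unfolding 2
    by (intro ext DERIV_imp_deriv) (auto intro!: derivative_eq_intros)
  have inf: "(INF y::real. g y) = 0" if "\<And>y. 0 \<le> g y" "g 0 = 0" for g :: "real \<Rightarrow> real"
    by (rule cInf_eq_minimum) (use that in \<open>auto intro!: image_eqI[of _ _ 0]\<close>)
  show "psi_inf (\<lambda>y. y) = 0" "psi_inf (\<lambda>y. y\<^sup>2) = 0"
    unfolding psi_inf_def 1 2 by (intro inf; simp)+
qed

lemma h_coef_quartic:
  assumes "\<nu> > 0"
  shows "h_coef r \<rho> \<nu> \<kappa> \<theta> (\<lambda>y. y) = quartic (\<lambda>n. [r - \<rho> * \<nu> / 2, - \<rho> * \<kappa> * \<theta> / \<nu>, \<rho> * \<kappa> / \<nu> - 1 / 2, 0, 0] ! n)"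
    and "h_coef r \<rho> \<nu> \<kappa> \<theta> (\<lambda>y. y\<^sup>2) = quartic (\<lambda>n. [r, - \<rho> * \<nu>, - \<rho> * \<kappa> * \<theta> / \<nu>, \<rho> * \<kappa> / \<nu>, - 1 / 2] ! n)"
proof -
  have d1: "deriv (\<lambda>y::real. y) y = 1" for y by (intro DERIV_imp_deriv) (auto intro!: derivative_eq_intros)
  have d2: "deriv (\<lambda>y::real. y\<^sup>2) y = 2 * y" for y by (intro DERIV_imp_deriv) (auto intro!: derivative_eq_intros)
  show "h_coef r \<rho> \<nu> \<kappa> \<theta> (\<lambda>y. y) = quartic (\<lambda>n. [r - \<rho> * \<nu> / 2, - \<rho> * \<kappa> * \<theta> / \<nu>, \<rho> * \<kappa> / \<nu> - 1 / 2, 0, 0] ! n)"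
    using assms by (intro ext) (simp add: h_coef_def quartic_def d1 numeral_eq_Suc field_simps)
  show "h_coef r \<rho> \<nu> \<kappa> \<theta> (\<lambda>y. y\<^sup>2) = quartic (\<lambda>n. [r, - \<rho> * \<nu>, - \<rho> * \<kappa> * \<theta> / \<nu>, \<rho> * \<kappa> / \<nu>, - 1 / 2] ! n)"
    using assms by (intro ext) (simp add: h_coef_def quartic_def d2 numeral_eq_Suc field_simps)
qed

theorem proposition10:
  fixes M :: "'a measure"
    and W B Y :: "real \<Rightarrow> 'a \<Rightarrow> real"
    and T r \<rho> s0 y0 \<nu> \<kappa> \<theta> :: real
  assumes "prob_space M"
    and "T > 0" and "-1 \<le> \<rho>" and "\<rho> \<le> 1" and "s0 > 0" and "\<nu> > 0"
    and "standard_brownian_motion M T W"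
    and "standard_brownian_motion M T B"
    and "independent_processes M T W B"
    and "OU_solution M T \<nu> \<kappa> \<theta> y0 W Y"
  shows
    "(y0 \<noteq> 0 \<longrightarrow>
       (\<forall>p::real. p \<ge> 1 \<longrightarrow> (\<forall>\<epsilon>::real. \<epsilon> > 0 \<longrightarrow> (\<exists>C::real. \<forall>N::nat. N \<ge> 1 \<longrightarrow>
          integrable M (max_error T r \<rho> s0 \<nu> \<kappa> \<theta> (\<lambda>y. y) W B Y N (2 * p)) \<and>
          prob_space.expectation M (max_error T r \<rho> s0 \<nu> \<kappa> \<theta> (\<lambda>y. y) W B Y N (2 * p))
            \<le> C / real N powr ((2 * p + 1) / 2 - \<epsilon>))))) \<and>
     (\<forall>p::real. p \<ge> 1 \<longrightarrow> (\<forall>\<epsilon>::real. \<epsilon> > 0 \<longrightarrow> (\<exists>C::real. \<forall>N::nat. N \<ge> 1 \<longrightarrow>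
          integrable M (max_error T r \<rho> s0 \<nu> \<kappa> \<theta> (\<lambda>y. y\<^sup>2) W B Y N (2 * p)) \<and>
          prob_space.expectation M (max_error T r \<rho> s0 \<nu> \<kappa> \<theta> (\<lambda>y. y\<^sup>2) W B Y N (2 * p))
            \<le> C / real N powr (2 * p - \<epsilon>)))) \<and>
     (y0 \<noteq> 0 \<longrightarrow>
       (\<forall>\<epsilon>::real. \<epsilon> > 0 \<longrightarrow> (\<exists>C::real. \<forall>N::nat. N \<ge> 1 \<longrightarrow>
          integrable M (max_error T r \<rho> s0 \<nu> \<kappa> \<theta> (\<lambda>y. y) W B Y N 2) \<and>
          sqrt (prob_space.expectation M (max_error T r \<rho> s0 \<nu> \<kappa> \<theta> (\<lambda>y. y) W B Y N 2))
            \<le> C * real N powr (- (3 / 4 - \<epsilon>)))))"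
proof -
  interpret prob_space M by fact
  interpret volatility_model M T W Y \<nu> \<kappa> \<theta> y0 B
    by unfold_locales fact+
  have linear: "\<exists>C. \<forall>N\<ge>1. integrable M (max_error T r \<rho> s0 \<nu> \<kappa> \<theta> (\<lambda>y. y) W B Y N (2 * p)) \<and>
      expectation (max_error T r \<rho> s0 \<nu> \<kappa> \<theta> (\<lambda>y. y) W B Y N (2 * p)) \<le> C / real N powr ((2 * p + 1) / 2 - \<epsilon>)"
    if y0: "y0 \<noteq> 0" and p: "1 \<le> p" and \<epsilon>: "0 < \<epsilon>" for p \<epsilon>
  proof -
    \<comment> \<open>one half of \<open>\<epsilon>\<close> is spent on the volatility error, the other half on the maximum over the grid\<close>
    have \<epsilon>2: "0 < \<epsilon> / 2" using \<epsilon> by simp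
    obtain A where A: "0 \<le> A" "\<And>N. 1 \<le> N \<Longrightarrow> (\<integral>\<^sup>+\<omega>. ennreal ((T / real N * (\<Sum>l<N. (grid_vol_error (\<lambda>y. y\<^sup>2) (\<lambda>y. 2 * y) N l \<omega>)\<^sup>2)) powr p) \<partial>M)
        \<le> ennreal (A * real N powr (- (p + 1 / 2 - \<epsilon> / 2)))"
      using linear_grid_volatility[OF y0 p \<epsilon>2] by blast
    have "\<exists>C. \<forall>N\<ge>1. integrable M (max_error T r \<rho> s0 \<nu> \<kappa> \<theta> (\<lambda>y. y) W B Y N (2 * p)) \<and>
      expectation (max_error T r \<rho> s0 \<nu> \<kappa> \<theta> (\<lambda>y. y) W B Y N (2 * p)) \<le> C / real N powr ((p + 1 / 2 - \<epsilon> / 2) - \<epsilon> / 2)"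
      by (rule strong_error_bound[OF h_coef_quartic(1)[OF nu] psi_data(1,2,3) _ _ _ \<epsilon>2 _ A(1,2)])
        (use p \<epsilon> in \<open>auto intro!: continuous_intros\<close>)
    moreover have "(p + 1 / 2 - \<epsilon> / 2) - \<epsilon> / 2 = (2 * p + 1) / 2 - \<epsilon>" by (simp add: field_simps)
    ultimately show ?thesis by simp
  qed
  have quadratic: "\<exists>C. \<forall>N\<ge>1. integrable M (max_error T r \<rho> s0 \<nu> \<kappa> \<theta> (\<lambda>y. y\<^sup>2) W B Y N (2 * p)) \<and>
      expectation (max_error T r \<rho> s0 \<nu> \<kappa> \<theta> (\<lambda>y. y\<^sup>2) W B Y N (2 * p)) \<le> C / real N powr (2 * p - \<epsilon>)"
    if p: "1 \<le> p" and \<epsilon>: "0 < \<epsilon>" for p \<epsilon>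
  proof -
    have p0: "0 < p" using p by simp
    obtain A where A: "0 \<le> A" "\<And>N. 1 \<le> N \<Longrightarrow> (\<integral>\<^sup>+\<omega>. ennreal ((T / real N * (\<Sum>l<N. (grid_vol_error (\<lambda>y. y ^ 4) (\<lambda>y. 4 * y ^ 3) N l \<omega>)\<^sup>2)) powr p) \<partial>M)
        \<le> ennreal (A * real N powr (- (2 * p)))"
      using quadratic_grid_volatility[OF p0] by blast
    show ?thesis
      by (rule strong_error_bound[OF h_coef_quartic(2)[OF nu] psi_data(4,5,6) _ _ p0 \<epsilon> _ A(1,2)])
        (auto intro!: continuous_intros)
  qed
  have root: "\<exists>C. \<forall>N\<ge>1. integrable M (max_error T r \<rho> s0 \<nu> \<kappa> \<theta> (\<lambda>y. y) W B Y N 2) \<and>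
      sqrt (expectation (max_error T r \<rho> s0 \<nu> \<kappa> \<theta> (\<lambda>y. y) W B Y N 2)) \<le> C * real N powr (- (3 / 4 - \<epsilon>))"
    if y0: "y0 \<noteq> 0" and \<epsilon>: "0 < \<epsilon>" for \<epsilon>
  proof -
    \<comment> \<open>the square root halves the exponent, hence the use of \<open>2 * \<epsilon>\<close>\<close>
    obtain C where C: "\<And>N. 1 \<le> N \<Longrightarrow> integrable M (max_error T r \<rho> s0 \<nu> \<kappa> \<theta> (\<lambda>y. y) W B Y N 2) \<and>
        expectation (max_error T r \<rho> s0 \<nu> \<kappa> \<theta> (\<lambda>y. y) W B Y N 2) \<le> C / real N powr (3 / 2 - 2 * \<epsilon>)"
      using linear[OF y0, of 1 "2 * \<epsilon>"] \<epsilon> by auto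
    have "sqrt (expectation (max_error T r \<rho> s0 \<nu> \<kappa> \<theta> (\<lambda>y. y) W B Y N 2)) \<le> sqrt \<bar>C\<bar> * real N powr (- (3 / 4 - \<epsilon>))"
      if N: "1 \<le> N" for N
    proof -
      let ?u = "real N powr (- (3 / 4 - \<epsilon>))"
      have u2: "?u\<^sup>2 = real N powr (- (3 / 2 - 2 * \<epsilon>))"
        using N by (simp add: power2_eq_square powr_add[symmetric] algebra_simps)
      have "C / real N powr e = C * real N powr (- e)" for e by (simp add: powr_minus divide_inverse)
      then have "C / real N powr (3 / 2 - 2 * \<epsilon>) = C * ?u\<^sup>2" unfolding u2 .
      also have "\<dots> \<le> \<bar>C\<bar> * ?u\<^sup>2" by (intro mult_right_mono) auto
      finally have "expectation (max_error T r \<rho> s0 \<nu> \<kappa> \<theta> (\<lambda>y. y) W B Y N 2) \<le> \<bar>C\<bar> * ?u\<^sup>2"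
        using C[OF N] by linarith
      then have "sqrt (expectation (max_error T r \<rho> s0 \<nu> \<kappa> \<theta> (\<lambda>y. y) W B Y N 2)) \<le> sqrt (\<bar>C\<bar> * ?u\<^sup>2)"
        by (rule real_sqrt_le_mono)
      then show ?thesis by (simp add: real_sqrt_mult)
    qed
    then show ?thesis using C by blast
  qed
  show ?thesis using linear quadratic root by blast
qed

end
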